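(* Let $A\in\mathbb{R}^{n\times n}$, $B\in\mathbb{R}^{n\times m}$ and $C\in\mathbb{R}^{q\times n}$ satisfy the following: $(A,B)$ is stabilizable, $(C,A)$ is detectable, and all eigenvalues of $A$ lie in the closed left half plane. Let $\bar\tau\ge0$ satisfy \[ \bar\tau\,\omega_{\max}<\frac{\pi}{2}, \] where $\omega_{\max}=0$ if $A$ is Hurwitz and $\omega_{\max}=\max\{\omega\in\mathbb{R}:\det(j\omega I-A)=0\}$ otherwise. Let $K$ be any matrix such that $A-KC$ is Hurwitz. Then there exist $\rho>1$ and $\varepsilon^*>0$, depending only on $A,B,C$ and $\bar\tau$, such that the following holds for every $\varepsilon\in(0,\varepsilon^*]$. Let $P_\varepsilon$ be the unique positive definite solution of \[ A^{T}P_\varepsilon+P_\varepsilon A-P_\varepsilon BB^{T}P_\varepsilon+\varepsilon I=0 . \] Consider any integer $N\ge1$, any nonempty node set $\mathcal{C}\subseteq\{1,\dots,N\}$, any weighted directed graph $\mathcal{G}\in\mathbb{G}_{\mathcal{C}}^N$ with adjacency weights $a_{ij}\ge0$ ($a_{ii}=0$), and any delays $\tau_1,\dots,\tau_N\in[0,\bar\tau]$. Let the multi-agent system be \[ \dot x_i(t)=Ax_i(t)+Bu_i(t-\tau_i),\quad y_i(t)=Cx_i(t),\quad x_i(\delta)=\phi_i(\delta),\ \delta\in[-\bar\tau,0],\qquad i=1,\dots,N, \] with arbitrary continuous initial functions $\phi_i$. Let the exosystem be $\dot x_r(t)=Ax_r(t)$, $y_r(t)=Cx_r(t)$, with arbitrary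 initial condition. Let each agent $i$ use the protocol \[ \begin{aligned} \dot{\hat x}_i(t)&=A\hat x_i(t)+B\Phi_i^\tau(t)+K(\bar\zeta_i(t)-C\hat x_i(t))+\iota_iBu_i(t-\tau_i),\\ \dot\chi_i(t)&=A\chi_i(t)+Bu_i(t-\tau_i)+\hat x_i(t)-\check\zeta_i(t)-\iota_i\chi_i(t),\\ u_i(t)&=-\rho B^{T}P_\varepsilon\chi_i(t), \end{aligned} \] with arbitrary initial conditions, where \[ \bar\zeta_i(t)=\sum_{j=1}^N a_{ij}(y_i(t)-y_j(t))+\iota_i(y_i(t)-y_r(t)), \] \[ \check\zeta_i(t)=\sum_{j=1}^N a_{ij}(\chi_i(t)-\chi_j(t)), \] \[ \Phi_i^\tau(t)=\sum_{j=1}^N a_{ij}\big(u_i(t-\tau_i)-u_j(t-\tau_j)\big), \] and $\iota_i=1$ if $i\in\mathcal{C}$, $\iota_i=0$ otherwise. Then $\lim_{t\to\infty}(x_i(t)-x_r(t))=0$ for all $i=1,\dots,N$; that is, the scalable regulated state synchronization problem with additional information exchange is solved.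
   Context: A weighted directed graph on nodes $\{1,\dots,N\}$ has adjacency matrix $[a_{ij}]$ with $a_{ij}>0$ iff there is an edge from $j$ to $i$, and $a_{ii}=0$. A directed tree is a subgraph in which every node has exactly one parent except one node, the root, which has none. For a node set $\mathcal{C}$, $\mathbb{G}_{\mathcal{C}}^N$ denotes the set of all such graphs with $N$ nodes containing $\mathcal{C}$ in which every node is a member of a directed tree whose root lies in $\mathcal{C}$. $j=\sqrt{-1}$. "Hurwitz" means all eigenvalues lie in the open left half plane. *)

theory Defs
  imports "HOL-Analysis.Analysis"
begin

definition cmat :: "real^'c^'r \<Rightarrow> complex^'c^'r" where
  "cmat M = (\<chi> i j. complex_of_real (M $ i $ j))"

definition is_eigenvalue :: "real^'n^'n \<Rightarrow> complex \<Rightarrow> bool" where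
  "is_eigenvalue A z \<longleftrightarrow> det (mat z - cmat A) = 0"

definition hurwitz :: "real^'n^'n \<Rightarrow> bool" where
  "hurwitz A \<longleftrightarrow> (\<forall>z. is_eigenvalue A z \<longrightarrow> Re z < 0)"

definition stabilizable :: "real^'n^'n \<Rightarrow> real^'m^'n \<Rightarrow> bool" where
  "stabilizable A B \<longleftrightarrow> (\<exists>F :: real^'n^'m. hurwitz (A + B ** F))"

definition detectable :: "real^'n^'q \<Rightarrow> real^'n^'n \<Rightarrow> bool" where
  "detectable C A \<longleftrightarrow> (\<exists>L :: real^'q^'n. hurwitz (A - L ** C))"

definition omega_max :: "real^'n^'n \<Rightarrow> real" where
  "omega_max A = (if hurwitz A then 0
                  else Max {\<omega>::real. is_eigenvalue A (\<i> * complex_of_real \<omega>)})"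

definition pos_def :: "real^'n^'n \<Rightarrow> bool" where
  "pos_def P \<longleftrightarrow> transpose P = P \<and> (\<forall>x. x \<noteq> 0 \<longrightarrow> x \<bullet> (P *v x) > 0)"

text \<open>Directed trees in the graph with adjacency a on nodes: an edge from j to i iff a i j > 0.
  A directed tree with node set V, root r and parent map par: every non-root node v of V
  has exactly one parent par v in V (edge par v -> v), the root has none, and following
  parents from any node reaches the root (so the subgraph is a tree, no cycles).\<close>
definition directed_tree :: "(nat \<Rightarrow> nat \<Rightarrow> real) \<Rightarrow> nat set \<Rightarrow> nat \<Rightarrow> (nat \<Rightarrow> nat) \<Rightarrow> bool" where
  "directed_tree a V r par \<longleftrightarrow> r \<in> V \<and>
     (\<forall>v \<in> V - {r}. par v \<in> V \<and> a v (par v) > 0) \<and>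
     (\<forall>v \<in> V. \<exists>k. (par ^^ k) v = r)"

definition in_GC :: "nat \<Rightarrow> nat set \<Rightarrow> (nat \<Rightarrow> nat \<Rightarrow> real) \<Rightarrow> bool" where
  "in_GC N Cs a \<longleftrightarrow> Cs \<subseteq> {1..N} \<and>
     (\<forall>i\<in>{1..N}. \<forall>j\<in>{1..N}. a i j \<ge> 0) \<and> (\<forall>i\<in>{1..N}. a i i = 0) \<and>
     (\<forall>i\<in>{1..N}. \<exists>V r par. V \<subseteq> {1..N} \<and> i \<in> V \<and> r \<in> Cs \<and> directed_tree a V r par)"

definition iota :: "nat set \<Rightarrow> nat \<Rightarrow> real" where
  "iota Cs i = (if i \<in> Cs then 1 else 0)"

text \<open>Closed loop: agents x_i, observer states xh_i, chi_i, exosystem xr, with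
  u_i(t) = - rho B^T P chi_i(t).  States x_i and chi_i are continuous on [-taubar, inf)
  (their restriction to [-taubar,0] is the arbitrary continuous initial function) and all
  equations hold for t >= 0.\<close>
definition closed_loop ::
  "real^'n^'n \<Rightarrow> real^'m^'n \<Rightarrow> real^'n^'q \<Rightarrow> real^'q^'n \<Rightarrow> real \<Rightarrow> real^'n^'n \<Rightarrow>
   nat \<Rightarrow> nat set \<Rightarrow> (nat \<Rightarrow> nat \<Rightarrow> real) \<Rightarrow> (nat \<Rightarrow> real) \<Rightarrow> real \<Rightarrow>
   (nat \<Rightarrow> real \<Rightarrow> real^'n) \<Rightarrow> (nat \<Rightarrow> real \<Rightarrow> real^'n) \<Rightarrow> (nat \<Rightarrow> real \<Rightarrow> real^'n) \<Rightarrow>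
   (real \<Rightarrow> real^'n) \<Rightarrow> bool" where
  "closed_loop A B C K \<rho> P N Cs a \<tau> \<tau>bar x xh chi xr \<longleftrightarrow>
    (let u = (\<lambda>i t. - (\<rho> *\<^sub>R ((transpose B ** P) *v chi i t)));
         y = (\<lambda>i t. C *v x i t);
         yr = (\<lambda>t. C *v xr t);
         zbar = (\<lambda>i t. (\<Sum>j=1..N. a i j *\<^sub>R (y i t - y j t)) + iota Cs i *\<^sub>R (y i t - yr t));
         zchk = (\<lambda>i t. \<Sum>j=1..N. a i j *\<^sub>R (chi i t - chi j t));
         Phi = (\<lambda>i t. \<Sum>j=1..N. a i j *\<^sub>R (u i (t - \<tau> i) - u j (t - \<tau> j)))
     in (\<forall>i\<in>{1..N}.
          continuous_on {-\<tau>bar..} (x i) \<and> continuous_on {-\<tau>bar..} (chi i) \<and>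
          (\<forall>t\<ge>0. (x i has_vector_derivative (A *v x i t + B *v u i (t - \<tau> i))) (at t within {0..})) \<and>
          (\<forall>t\<ge>0. (xh i has_vector_derivative
               (A *v xh i t + B *v Phi i t + K *v (zbar i t - C *v xh i t)
                + iota Cs i *\<^sub>R (B *v u i (t - \<tau> i)))) (at t within {0..})) \<and>
          (\<forall>t\<ge>0. (chi i has_vector_derivative
               (A *v chi i t + B *v u i (t - \<tau> i) + xh i t - zchk i t - iota Cs i *\<^sub>R chi i t))
               (at t within {0..}))) \<and>
        (\<forall>t\<ge>0. (xr has_vector_derivative (A *v xr t)) (at t within {0..})))"

end

theory Submission
  imports Defs "HOL-Complex_Analysis.Complex_Analysis" "HOL-Real_Asymp.Real_Asymp"
    "HOL-Probability.Sinc_Integral" "HOL-Computational_Algebra.Fundamental_Theorem_Algebra"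
begin

text \<open>
  Let s_i be the sum over j of a_ij (x_i - x_j), plus (x_i - x_r) when i is in \<open>\<C>\<close>. The observer errors
  e_i = xh_i - s_i obey e_i' = (A - KC) e_i, and the differences d_i = x_i - x_r - chi_i form the network
  d' = (I \<open>\<otimes>\<close> A - L \<open>\<otimes>\<close> I) d - e with the grounded Laplacian L. Both decay exponentially, because A has
  its spectrum in the closed left half plane and L is a nonsingular M-matrix. What remains is, for each agent,
  the delay equation z'(t) = A z(t) - \<open>\<rho>\<close> B B^T P z(t - \<open>\<tau>\<close>) + f(t) with f exponentially decaying.

  Its characteristic matrix is nonsingular on the closed right half plane: near the part of the imaginary axis
  that can carry eigenvalues of A we have \<open>\<rho>\<close> Re exp (-s \<open>\<tau>\<close>) >= 1/2, so the Riccati equation excludes roots, and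
  elsewhere the resolvent of A is bounded while P tends to 0 with \<open>\<epsilon>\<close>. Convergence of z follows by Laplace
  inversion: the transform of the convolution of z with exp (-t) is holomorphic and quadratically decaying on a
  half plane Re s > -\<open>\<delta>\<close>, so that this convolution equals an exponentially decaying inversion integral.
\<close>

section \<open>The Laplace transform on the half line\<close>

text \<open>Two obstacles shape the proof. First, \<open>\<rho>\<close> and the bound on
  \<open>\<epsilon>\<close> precede the quantifiers over the graph and the delays, so nothing about
  the network may enter the choice of the gain. This is possible because the delayed inputs reach
  plant, observer and \<open>chi\<close> alike and cancel in the equations of e and d. The graph
  then acts only on undelayed linear systems; their decay rate may depend on it, since they enter
  the delay equation only as forcing. Second, along vertical lines the transform of z decays only
  like 1/|s|, which is not absolutely integrable. Convolution with exp (-t) divides the transform by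
  s + 1 and gives the quadratic decay that inversion needs. The way back from the convolution w to z
  uses that z - A w - G v - \<phi> - w, with v and \<phi> the same convolutions of the delayed z and
  of f, solves p' = -p.\<close>

lemma set_integrable_exp_minus:
  assumes "(a::real) > 0"
  shows "set_integrable lborel {0..} (\<lambda>t::real. exp (- (a * t)))"
    and "(LBINT t:{0..}. exp (- (a * t))) = 1 / a"
proof -
  have hi: "((\<lambda>t. exp (-a*t)) has_integral exp (-a*0)/a) {0..}"
    by (rule has_integral_exp_minus_to_infinity[OF assms])
  have "(\<lambda>t. exp (-a*t)) absolutely_integrable_on {0..}"
    by (rule nonnegative_absolutely_integrable_1) (use hi in \<open>auto simp: integrable_on_def\<close>)
  then have "integrable lebesgue (\<lambda>x. indicator {0..} x *\<^sub>R exp (-a*x))"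
    unfolding set_integrable_def .
  then have "integrable lborel (\<lambda>x. indicator {0..} x *\<^sub>R exp (-a*x))"
    by (subst (asm) integrable_completion) auto
  then show i: "set_integrable lborel {0..} (\<lambda>t::real. exp (- (a * t)))"
    unfolding set_integrable_def by simp
  show "(LBINT t:{0..}. exp (- (a * t))) = 1 / a"
    using set_borel_integral_eq_integral(2)[OF i] integral_unique[OF hi] by simp
qed

lemma exp_bounded_integrable:
  fixes h :: "real \<Rightarrow> 'a::euclidean_space"
  assumes cont: "continuous_on {0..} h" and bnd: "\<And>t. t \<ge> 0 \<Longrightarrow> norm (h t) \<le> C * exp (- (a * t))" and "a > 0"
  shows "set_integrable lborel {0..} h" and "norm (LBINT t:{0..}. h t) \<le> C / a"
proof -
  have I: "set_integrable lborel {0..} (\<lambda>t. C * exp (- (a * t)))"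
    by (intro set_integrable_mult_right impI set_integrable_exp_minus(1) assms)
  have M: "set_borel_measurable lborel {0..} h"
    unfolding set_borel_measurable_def
    using borel_measurable_continuous_on_indicator[OF _ cont] by simp
  show S: "set_integrable lborel {0..} h"
    by (rule set_integrable_bound[OF I M]) (use bnd in \<open>auto intro!: AE_I2 order_trans[OF _ abs_ge_self]\<close>)
  have "norm (LBINT t:{0..}. h t) \<le> (LBINT t:{0..}. norm (h t))"
    by (rule set_integral_norm_bound[OF S])
  also have "\<dots> \<le> (LBINT t:{0..}. C * exp (- (a * t)))"
    by (rule set_integral_mono[OF set_integrable_norm[OF S] I]) (use bnd in auto)
  also have "\<dots> = C / a"
    using set_integrable_exp_minus(2)[OF \<open>a>0\<close>] by simp
  finally show "norm (LBINT t:{0..}. h t) \<le> C / a" .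
qed

lemma norm_exp_weight_le:
  assumes "norm y \<le> C * exp (\<sigma> * t)"
  shows "norm (exp (- (s * t)) *\<^sub>R y) \<le> C * exp (- ((s - \<sigma>) * (t :: real)))"
proof -
  have "norm (exp (- (s * t)) *\<^sub>R y) \<le> exp (- (s * t)) * (C * exp (\<sigma> * t))"
    using assms by simp
  also have "\<dots> = C * exp (- ((s - \<sigma>) * t))"
    by (simp add: exp_add[symmetric] algebra_simps)
  finally show ?thesis .
qed

lemma tendsto_exp_minus: "(c::real) > 0 \<Longrightarrow> ((\<lambda>t. K * exp (- (c * t))) \<longlongrightarrow> 0) at_top"
  by real_asymp

lemma tendsto_zero_of_exp_bound:
  fixes y :: "real \<Rightarrow> 'a::real_normed_vector"
  assumes "\<And>t. t \<ge> 0 \<Longrightarrow> norm (y t) \<le> K * exp (- (c * t))" "c > 0"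
  shows "(y \<longlongrightarrow> 0) at_top"
proof (rule Lim_null_comparison)
  show "\<forall>\<^sub>F t in at_top. norm (y t) \<le> K * exp (- (c * t))"
    using assms(1) by (auto simp: eventually_at_top_linorder)
  show "((\<lambda>t. K * exp (- (c * t))) \<longlongrightarrow> 0) at_top" by (rule tendsto_exp_minus[OF assms(2)])
qed

lemma laplace_bounded_integrable:
  fixes g :: "real \<Rightarrow> 'a::euclidean_space"
  assumes cont: "continuous_on {0..} g" and bnd: "\<And>t. t \<ge> 0 \<Longrightarrow> norm (g t) \<le> C * exp (\<sigma> * t)" and "\<sigma> < s"
  shows "set_integrable lborel {0..} (\<lambda>t. exp (- (s * t)) *\<^sub>R g t)"
proof (rule exp_bounded_integrable(1))
  show "continuous_on {0..} (\<lambda>t. exp (- (s * t)) *\<^sub>R g t)"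
    by (intro continuous_intros cont)
  show "norm (exp (- (s * t)) *\<^sub>R g t) \<le> C * exp (- ((s - \<sigma>) * t))" if "t \<ge> 0" for t
    by (rule norm_exp_weight_le[OF bnd[OF that]])
qed (use assms in auto)

abbreviation laplace :: "(real \<Rightarrow> 'a::{banach, second_countable_topology}) \<Rightarrow> real \<Rightarrow> 'a" where
  "laplace g s \<equiv> (LBINT t:{0..}. exp (- (s * t)) *\<^sub>R g t)"

lemma laplace_derivative:
  fixes y :: "real \<Rightarrow> 'a::euclidean_space"
  assumes der: "\<And>t. t \<ge> 0 \<Longrightarrow> (y has_vector_derivative y' t) (at t within {0..})"
    and cont: "continuous_on {0..} y'"
    and bnd: "\<And>t. t \<ge> 0 \<Longrightarrow> norm (y t) \<le> C * exp (\<sigma> * t)"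
    and bnd': "\<And>t. t \<ge> 0 \<Longrightarrow> norm (y' t) \<le> C' * exp (\<sigma> * t)" and s: "\<sigma> < s"
  shows "laplace y' s
     = s *\<^sub>R laplace y s - y 0"
proof -
  have conty: "continuous_on {0..} y"
    by (rule continuous_on_vector_derivative) (use der in auto)
  let ?F = "\<lambda>t. exp (- (s * t)) *\<^sub>R y t"
  let ?f = "\<lambda>t. exp (- (s * t)) *\<^sub>R y' t - s *\<^sub>R (exp (- (s * t)) *\<^sub>R y t)"
  have i1: "set_integrable lborel {0..} (\<lambda>t. exp (- (s * t)) *\<^sub>R y' t)"
    by (rule laplace_bounded_integrable[OF cont bnd' s])
  have i2: "set_integrable lborel {0..} (\<lambda>t. exp (- (s * t)) *\<^sub>R y t)"
    by (rule laplace_bounded_integrable[OF conty bnd s])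
  have i2': "set_integrable lborel {0..} (\<lambda>t. s *\<^sub>R (exp (- (s * t)) *\<^sub>R y t))"
    using i2 by (intro set_integrable_scaleR_right)
  have i3: "set_integrable lborel {0..} ?f"
    by (rule set_integral_diff(1)[OF i1 i2'])
  have "((\<lambda>b. set_lebesgue_integral lborel {0..b} ?f) \<longlongrightarrow> set_lebesgue_integral lborel {0..} ?f) at_top"
    by (rule tendsto_set_lebesgue_integral_at_top) (use i3 in \<open>auto\<close>)
  moreover have "((\<lambda>b. set_lebesgue_integral lborel {0..b} ?f) \<longlongrightarrow> 0 - y 0) at_top"
  proof (rule Lim_transform_eventually)
    have "(?F \<longlongrightarrow> 0) at_top"
      by (rule tendsto_zero_of_exp_bound[OF norm_exp_weight_le[OF bnd]]) (use s in auto)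
    then show "((\<lambda>b. ?F b - y 0) \<longlongrightarrow> 0 - y 0) at_top"
      by (intro tendsto_intros)
    have "?F b - y 0 = set_lebesgue_integral lborel {0..b} ?f" if "b \<ge> 0" for b
    proof -
      have "(LBINT x. indicator {0..b} x *\<^sub>R ?f x) = ?F b - ?F 0"
      proof (rule integral_FTC_atLeastAtMost[OF that])
        fix x assume x: "0 \<le> x" "x \<le> b"
        have "(y has_vector_derivative y' x) (at x within {0..b})"
          by (rule has_vector_derivative_within_subset[OF der]) (use x in auto)
        then show "(?F has_vector_derivative ?f x) (at x within {0..b})"
          by (auto intro!: derivative_eq_intros simp: algebra_simps)
      next
        show "continuous_on {0..b} ?f"
          by (intro continuous_intros continuous_on_subset[OF cont] continuous_on_subset[OF conty]) auto
      qed
      then show ?thesis by (simp add: set_lebesgue_integral_def)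
    qed
    then show "\<forall>\<^sub>F b in at_top. ?F b - y 0 = set_lebesgue_integral lborel {0..b} ?f"
      by (auto simp: eventually_at_top_linorder)
  qed
  ultimately have "set_lebesgue_integral lborel {0..} ?f = 0 - y 0"
    using tendsto_unique trivial_limit_at_top_linorder by blast
  moreover have "set_lebesgue_integral lborel {0..} ?f
     = laplace y' s - s *\<^sub>R laplace y s"
    unfolding set_integral_diff(2)[OF i1 i2'] set_integral_scaleR_right ..
  ultimately show ?thesis
    by (simp add: algebra_simps)
qed

section \<open>Uniqueness of the Laplace transform\<close>

text \<open>Lerch's theorem by moments: with x = exp (-t) the transforms at s0 + 1 + n become the
  moments of the continuous function \<open>\<phi>\<close> on [0,1]. A continuous function with
  vanishing moments is orthogonal to all polynomials, hence by Weierstrass to itself.\<close>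

lemma laplace_unique_real:
  fixes g :: "real \<Rightarrow> real"
  assumes cont: "continuous_on {0..} g" and bnd: "\<And>t. t \<ge> 0 \<Longrightarrow> \<bar>g t\<bar> \<le> C * exp (\<sigma> * t)"
    and zero: "\<And>s. s > \<sigma> \<Longrightarrow> (LBINT t:{0..}. exp (- (s * t)) * g t) = 0"
    and "t \<ge> 0"
  shows "g t = 0"
proof -
  \<comment> \<open>The margin s0 - \<sigma> >= 1 gives \<open>\<psi>\<close> the decay exp (-t), so
    \<open>\<phi> x\<close> is O(x) and the value 0 at x = 0 makes \<open>\<phi>\<close> continuous
    on [0,1].\<close>
  define s0 where "s0 = \<bar>\<sigma>\<bar> + 1"
  have s0: "s0 > 0" "s0 > \<sigma>" "s0 - \<sigma> \<ge> 1" by (auto simp: s0_def)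
  have C: "C \<ge> 0" using bnd[of 0] by simp
  define \<psi> where "\<psi> = (\<lambda>t. exp (- (s0 * t)) * g t)"
  define \<phi> where "\<phi> = (\<lambda>x. if x \<le> 0 then 0 else x powr s0 * g (- ln x))"
  have \<psi>b: "\<bar>\<psi> t\<bar> \<le> C * exp (- t)" if "t \<ge> 0" for t
  proof -
    have "\<bar>\<psi> t\<bar> \<le> C * exp (- ((s0 - \<sigma>) * t))"
      using norm_exp_weight_le[of "g t" C \<sigma> t s0] bnd[OF that] by (simp add: \<psi>_def)
    also have "\<dots> \<le> C * exp (- t)"
      using C s0(3) mult_right_mono[OF s0(3) that] by (intro mult_left_mono) auto
    finally show ?thesis .
  qed
  have \<psi>cont: "continuous_on {0..} \<psi>"
    unfolding \<psi>_def by (intro continuous_intros cont)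
  have \<phi>\<psi>: "\<phi> (exp (- t)) = \<psi> t" for t
    by (simp add: \<phi>_def \<psi>_def powr_def)
  have \<phi>b: "\<bar>\<phi> x\<bar> \<le> C * x" if "0 \<le> x" "x \<le> 1" for x
  proof (cases "x = 0")
    case False
    then have "\<phi> x = \<psi> (- ln x)" using \<phi>\<psi>[of "- ln x"] that by simp
    then show ?thesis using \<psi>b[of "- ln x"] that False by simp
  qed (auto simp: \<phi>_def)
  have \<phi>cont: "continuous_on {0..1} \<phi>"
    unfolding continuous_on_eq_continuous_within
  proof
    fix x :: real assume x: "x \<in> {0..1}"
    show "continuous (at x within {0..1}) \<phi>"
    proof (cases "x = 0")
      case True
      have "(\<phi> \<longlongrightarrow> 0) (at 0 within {0..1})"
      proof (rule Lim_null_comparison)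
        show "\<forall>\<^sub>F x in at 0 within {0..1}. norm (\<phi> x) \<le> C * x"
          using \<phi>b by (auto simp: eventually_at_filter)
        show "((\<lambda>x. C * x) \<longlongrightarrow> 0) (at 0 within {0..1})"
          by (auto intro!: tendsto_eq_intros)
      qed
      then show ?thesis using True by (simp add: continuous_within \<phi>_def)
    next
      case False
      have "continuous_on {0<..1} (\<lambda>x. \<psi> (- ln x))"
        by (intro continuous_on_compose2[OF \<psi>cont] continuous_intros) auto
      moreover have "\<psi> (- ln x) = \<phi> x" if "x \<in> {0<..1}" for x
        using \<phi>\<psi>[of "- ln x"] that by simp
      ultimately have "continuous_on {0<..1} \<phi>"
        by (metis (no_types, lifting) continuous_on_cong)
      then have "continuous (at x within {0<..1}) \<phi>"
        using x False by (simp add: continuous_on_eq_continuous_within)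
      moreover have "at x within {0<..1} = at x within {0..1}"
        by (rule at_within_nhd[of x "{0<..}"]) (use x False in auto)
      ultimately show ?thesis by simp
    qed
  qed
  have poly0: "(LBINT t:{0..}. exp (- t) * \<psi> t * exp (- t) ^ n) = 0" for n
  proof -
    have "exp (- t) * \<psi> t * exp (- t) ^ n = exp (- ((s0 + 1 + real n) * t)) * g t" for t
      by (simp add: \<psi>_def exp_of_nat_mult[symmetric] exp_add[symmetric] algebra_simps)
    then show ?thesis using zero[of "s0 + 1 + real n"] s0 by simp
  qed
  have int0: "set_integrable lborel {0..} (\<lambda>t. exp (- t) * \<psi> t * exp (- t) ^ n)" for n
  proof (rule exp_bounded_integrable(1)[where C=C and a=1])
    show "continuous_on {0..} (\<lambda>t. exp (- t) * \<psi> t * exp (- t) ^ n)"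
      by (intro continuous_intros \<psi>cont)
    fix t :: real assume t: "t \<ge> 0"
    have "exp (- t) * \<bar>\<psi> t\<bar> * exp (- t) ^ n \<le> 1 * (C * exp (- t)) * 1"
      using \<psi>b[OF t] t C by (intro mult_mono power_le_one) auto
    then show "norm (exp (- t) * \<psi> t * exp (- t) ^ n) \<le> C * exp (- (1 * t))"
      by (simp add: abs_mult)
  qed auto
  have intsq: "set_integrable lborel {0..} (\<lambda>t. exp (- t) * \<psi> t * \<psi> t)"
  proof (rule exp_bounded_integrable(1)[where C="C*C" and a=1])
    show "continuous_on {0..} (\<lambda>t. exp (- t) * \<psi> t * \<psi> t)"
      by (intro continuous_intros \<psi>cont)
    fix t :: real assume t: "t \<ge> 0"
    have "\<bar>\<psi> t\<bar> \<le> C * 1"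
      by (rule order_trans[OF \<psi>b[OF t]]) (use t C in \<open>intro mult_left_mono, auto\<close>)
    then have "exp (- t) * \<bar>\<psi> t\<bar> * \<bar>\<psi> t\<bar> \<le> 1 * (C * exp (- t)) * (C * 1)"
      using \<psi>b[OF t] t C by (intro mult_mono) auto
    then show "norm (exp (- t) * \<psi> t * \<psi> t) \<le> (C * C) * exp (- (1 * t))"
      by (simp add: abs_mult algebra_simps)
  qed auto
  have small: "(LBINT t:{0..}. exp (- t) * \<psi> t * \<psi> t) \<le> \<eta> * C" if "\<eta> > 0" for \<eta>
  proof -
    obtain p where p: "real_polynomial_function p" "\<And>x. x \<in> {0..1} \<Longrightarrow> \<bar>\<phi> x - p x\<bar> < \<eta>"
      using Stone_Weierstrass_real_polynomial_function[OF compact_Icc \<phi>cont \<open>\<eta> > 0\<close>] by blast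
    obtain a n where pn: "p = (\<lambda>x. \<Sum>i\<le>n. a i * x ^ i)"
      using p(1) real_polynomial_function_iff_sum by blast
    have ip: "set_integrable lborel {0..} (\<lambda>t. exp (- t) * \<psi> t * p (exp (- t)))"
      and zp: "(LBINT t:{0..}. exp (- t) * \<psi> t * p (exp (- t))) = 0"
    proof -
      have eq: "exp (- t) * \<psi> t * p (exp (- t)) = (\<Sum>i\<le>n. a i * (exp (- t) * \<psi> t * exp (- t) ^ i))" for t
        unfolding pn by (simp add: sum_distrib_left algebra_simps)
      have i: "set_integrable lborel {0..} (\<lambda>t. a i * (exp (- t) * \<psi> t * exp (- t) ^ i))" for i
        using int0 by auto
      show "set_integrable lborel {0..} (\<lambda>t. exp (- t) * \<psi> t * p (exp (- t)))"
        unfolding eq using i unfolding set_integrable_def scaleR_sum_right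
        by (intro Bochner_Integration.integrable_sum)
      have "(LBINT t:{0..}. (\<Sum>i\<le>n. a i * (exp (- t) * \<psi> t * exp (- t) ^ i)))
        = (\<Sum>i\<le>n. LBINT t:{0..}. a i * (exp (- t) * \<psi> t * exp (- t) ^ i))"
        using i unfolding set_integrable_def set_lebesgue_integral_def scaleR_sum_right
        by (intro Bochner_Integration.integral_sum)
      also have "\<dots> = 0" using poly0 by simp
      finally show "(LBINT t:{0..}. exp (- t) * \<psi> t * p (exp (- t))) = 0"
        unfolding eq .
    qed
    \<comment> \<open>Subtracting the polynomial from one factor leaves the integral unchanged, as
      the polynomial is orthogonal to \<open>\<psi>\<close>, and makes that factor at most
      \<open>\<eta>\<close>.\<close>
    have "(LBINT t:{0..}. exp (- t) * \<psi> t * \<psi> t)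
      = (LBINT t:{0..}. exp (- t) * \<psi> t * \<psi> t - exp (- t) * \<psi> t * p (exp (- t)))"
      using set_integral_diff(2)[OF intsq ip] zp by simp
    also have "\<dots> \<le> norm \<dots>" by simp
    also have "\<dots> \<le> (\<eta> * C) / 1"
    proof (rule exp_bounded_integrable(2))
      have "continuous_on {0..} (\<lambda>t. p (exp (- t)))"
        unfolding pn by (intro continuous_intros)
      then show "continuous_on {0..} (\<lambda>t. exp (- t) * \<psi> t * \<psi> t - exp (- t) * \<psi> t * p (exp (- t)))"
        by (intro continuous_intros \<psi>cont)
      fix t :: real assume t: "t \<ge> 0"
      have 1: "\<bar>\<psi> t - p (exp (- t))\<bar> \<le> \<eta>" using p(2)[of "exp (- t)"] t \<phi>\<psi>[of t] by force
      have "norm (exp (- t) * \<psi> t * \<psi> t - exp (- t) * \<psi> t * p (exp (- t)))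
        = exp (- t) * \<bar>\<psi> t\<bar> * \<bar>\<psi> t - p (exp (- t))\<bar>"
        by (simp add: abs_mult[symmetric] right_diff_distrib[symmetric] mult.assoc)
          (simp add: abs_mult mult.assoc)
      also have "\<dots> \<le> 1 * (C * exp (- t)) * \<eta>"
        using \<psi>b[OF t] t C 1 by (intro mult_mono) auto
      finally show "norm (exp (- t) * \<psi> t * \<psi> t - exp (- t) * \<psi> t * p (exp (- t))) \<le> \<eta> * C * exp (- (1 * t))"
        by (simp add: algebra_simps)
    qed auto
    finally show ?thesis by simp
  qed
  have le0: "(LBINT t:{0..}. exp (- t) * \<psi> t * \<psi> t) \<le> 0"
  proof (rule field_le_epsilon)
    fix e :: real assume "e > 0"
    have "(LBINT t:{0..}. exp (- t) * \<psi> t * \<psi> t) \<le> (e / (C + 1)) * C"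
      using \<open>e > 0\<close> C by (intro small) auto
    also have "\<dots> \<le> e" using \<open>e > 0\<close> C by (simp add: field_simps)
    finally show "(LBINT t:{0..}. exp (- t) * \<psi> t * \<psi> t) \<le> 0 + e" by simp
  qed
  \<comment> \<open>The interval has positive length even for t = 0, where a vanishing integral over
    [0,t] would say nothing.\<close>
  define T where "T = t + 1"
  have T: "T > 0" "t \<in> {0..T}" using \<open>t \<ge> 0\<close> by (auto simp: T_def)
  let ?q = "\<lambda>t. exp (- t) * \<psi> t * \<psi> t"
  have qT: "set_integrable lborel {0..T} ?q"
    by (rule set_integrable_subset[OF intsq]) auto
  have q0: "?q t \<ge> 0" for t by (simp add: mult.assoc)
  have "(LBINT t:{0..T}. ?q t) \<le> (LBINT t:{0..}. ?q t)"
    using qT intsq q0 unfolding set_lebesgue_integral_def set_integrable_def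
    by (intro integral_mono) (auto simp: indicator_def)
  moreover have "(LBINT t:{0..T}. ?q t) \<ge> 0"
    unfolding set_lebesgue_integral_def using q0
    by (intro Bochner_Integration.integral_nonneg) (auto simp: indicator_def)
  ultimately have "(LBINT t:{0..T}. ?q t) = 0" using le0 by simp
  then have hi: "(?q has_integral 0) (cbox 0 T)"
    using set_borel_integral_eq_integral[OF qT] by (simp add: has_integral_iff)
  have "?q t = 0"
    by (rule has_integral_0_cbox_imp_0[OF _ _ hi])
      (use q0 T in \<open>auto intro!: continuous_intros continuous_on_subset[OF \<psi>cont]\<close>)
  then show ?thesis by (simp add: \<psi>_def)
qed

section \<open>Inversion along a vertical line\<close>

lemma integrable_inverse_1_plus_sq: "integrable lborel (\<lambda>x::real. inverse (1 + x\<^sup>2))"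
  using integrable_inverse_1_plus_square unfolding set_integrable_def by (simp add: einterval_def)

lemma vertical_line_decay:
  fixes H :: "complex \<Rightarrow> complex"
  assumes hol: "H holomorphic_on {s. Re s > - \<delta>}"
    and bnd: "\<And>s. Re s > - \<delta> \<Longrightarrow> norm (H s) \<le> M / (1 + (norm s)\<^sup>2)"
    and c: "- \<delta> < c"
  shows "M \<ge> 0" and "continuous_on UNIV (\<lambda>y. H (Complex c y))"
    and "\<And>y. norm (H (Complex c y)) \<le> M * inverse (1 + y\<^sup>2)"
proof -
  show M: "M \<ge> 0"
  proof -
    have p: "0 < 1 + (norm (complex_of_real c))\<^sup>2" by (rule add_pos_nonneg) auto
    have "0 \<le> M / (1 + (norm (complex_of_real c))\<^sup>2)"
      using bnd[of "complex_of_real c"] c order_trans[OF norm_ge_zero] by fastforce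
    then show ?thesis using p by (metis divide_less_0_iff not_le)
  qed
  show "continuous_on UNIV (\<lambda>y. H (Complex c y))"
    by (rule continuous_on_compose2[OF holomorphic_on_imp_continuous_on[OF hol]])
      (use c in \<open>auto simp: Complex_eq intro!: continuous_intros\<close>)
  show "norm (H (Complex c y)) \<le> M * inverse (1 + y\<^sup>2)" for y
  proof -
    have "norm (H (Complex c y)) \<le> M / (1 + (norm (Complex c y))\<^sup>2)"
      using c by (intro bnd) auto
    also have "\<dots> \<le> M / (1 + y\<^sup>2)"
      using M by (intro divide_left_mono mult_pos_pos) (auto simp: cmod_def add_pos_nonneg)
    finally show ?thesis by (simp add: field_simps)
  qed
qed

text \<open>Cauchy's formula on a rectangle with left side on Re = c: as it grows, the other three
  sides contribute O(1/R) by the quadratic decay of \<open>H\<close>. The left side is traversed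
  downwards and the kernel is s - w instead of w - s, so the two signs cancel.\<close>

lemma cauchy_half_plane:
  fixes H :: "complex \<Rightarrow> complex"
  assumes hol: "H holomorphic_on {s. Re s > - \<delta>}"
    and bnd: "\<And>s. Re s > - \<delta> \<Longrightarrow> norm (H s) \<le> M / (1 + (norm s)\<^sup>2)"
    and c: "- \<delta> < c" and s: "c < s"
  shows "integrable lborel (\<lambda>y. H (Complex c y) / (of_real s - Complex c y))"
    and "(LBINT y. H (Complex c y) / (of_real s - Complex c y)) = 2 * pi * H s"
proof -
  let ?S = "{s. Re s > - \<delta>}"
  let ?f = "\<lambda>y. H (Complex c y) / (of_real s - Complex c y)"
  note M = vertical_line_decay(1)[OF hol bnd c] and contH = vertical_line_decay(2)[OF hol bnd c]
    and nb = vertical_line_decay(3)[OF hol bnd c]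
  have ne: "complex_of_real s - Complex c y \<noteq> 0" for y
    using s by (auto simp: complex_eq_iff)
  have contf: "continuous_on UNIV ?f"
    using ne by (intro continuous_intros contH) (auto simp: Complex_eq intro!: continuous_intros)
  have den: "norm (of_real s - Complex c y) \<ge> s - c" for y
    using complex_Re_le_cmod[of "of_real s - Complex c y"] by simp
  show int: "integrable lborel ?f"
  proof (rule Bochner_Integration.integrable_bound)
    show "integrable lborel (\<lambda>y. M / (s - c) * inverse (1 + y\<^sup>2))"
      by (intro integrable_mult_right integrable_inverse_1_plus_sq)
    show "?f \<in> borel_measurable lborel"
      using borel_measurable_continuous_onI[OF contf] by simp
    have "norm (?f y) \<le> M / (s - c) * inverse (1 + y\<^sup>2)" for y
    proof -
      have "norm (?f y) \<le> (M * inverse (1 + y\<^sup>2)) / (s - c)"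
        unfolding norm_divide using nb den s M by (intro frac_le) (auto intro: mult_nonneg_nonneg add_nonneg_nonneg)
      then show ?thesis by (simp add: field_simps)
    qed
    then show "AE y in lborel. norm (?f y) \<le> norm (M / (s - c) * inverse (1 + y\<^sup>2))"
      unfolding real_norm_def using abs_ge_self order_trans by (intro AE_I2) blast
  qed
  \<comment> \<open>From this size on the three outer sides keep distance at least 1 from
    \<open>s\<close> and have length at most 2R each, whence the factor 6R.\<close>
  define R0 where "R0 = \<bar>s\<bar> + \<bar>c\<bar> + 2"
  have key: "norm ((LBINT y:{-R..R}. ?f y) - 2 * pi * H s) \<le> M / (1 + R\<^sup>2) * (6 * R)" if R: "R \<ge> R0" for R
  proof -
    have R': "R > \<bar>s\<bar> + 1" "R > \<bar>c\<bar> + 1" "R > 1" using R by (auto simp: R0_def)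
    define a1 a2 a3 a4 where "a1 = Complex c (-R)" and "a2 = Complex R (-R)" and "a3 = Complex R R" and "a4 = Complex c R"
    let ?g = "\<lambda>w. H w / (w - s)"
    have pi_sub: "path_image (rectpath a1 a3) \<subseteq> ?S - {of_real s}"
      using R' c s by (subst path_image_rectpath)
         (auto simp: a1_def a3_def)
    have H0: "(?g has_contour_integral (2 * pi * \<i> * winding_number (rectpath a1 a3) s * H s)) (rectpath a1 a3)"
    proof (rule Cauchy_integral_formula_convex_simple[OF _ hol])
      show "convex ?S" by (rule convex_halfspace_Re_gt)
      have "interior ?S = ?S" by (rule interior_open) (rule open_halfspace_Re_gt)
      then show "of_real s \<in> interior ?S" using c s by simp
    qed (use pi_sub in auto)
    have "winding_number (rectpath a1 a3) s = 1"
      using R' s by (intro winding_number_rectpath) (auto simp: in_box_complex_iff a1_def a3_def)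
    with H0 have H1: "(?g has_contour_integral (2 * pi * \<i> * H s)) (rectpath a1 a3)" by simp
    have rp: "rectpath a1 a3 = linepath a1 a2 +++ linepath a2 a3 +++ linepath a3 a4 +++ linepath a4 a1"
      by (simp add: rectpath_def Let_def a1_def a2_def a3_def a4_def)
    have ci: "?g contour_integrable_on linepath a1 a2" "?g contour_integrable_on linepath a2 a3"
       "?g contour_integrable_on linepath a3 a4" "?g contour_integrable_on linepath a4 a1"
    proof -
      have "?g contour_integrable_on (linepath a1 a2 +++ linepath a2 a3 +++ linepath a3 a4 +++ linepath a4 a1)"
        using H1 unfolding rp contour_integrable_on_def by blast
      then show "?g contour_integrable_on linepath a1 a2" "?g contour_integrable_on linepath a2 a3"
       "?g contour_integrable_on linepath a3 a4" "?g contour_integrable_on linepath a4 a1" by auto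
    qed
    let ?I1 = "contour_integral (linepath a1 a2) ?g" and ?I2 = "contour_integral (linepath a2 a3) ?g"
     and ?I3 = "contour_integral (linepath a3 a4) ?g" and ?I4 = "contour_integral (linepath a4 a1) ?g"
    have "contour_integral (rectpath a1 a3) ?g = ?I1 + (?I2 + (?I3 + ?I4))"
      unfolding rp using ci by simp
    then have sum: "?I1 + (?I2 + (?I3 + ?I4)) = 2 * pi * \<i> * H s"
      using contour_integral_unique[OF H1] by simp
    have bd: "norm (?g w) \<le> M / (1 + R\<^sup>2)" if "Re w > - \<delta>" "norm w \<ge> R" "norm (w - s) \<ge> 1" for w
    proof -
      have "norm (?g w) \<le> norm (H w) / 1"
        unfolding norm_divide using that(3) by (intro divide_left_mono) auto
      also have "\<dots> \<le> M / (1 + (norm w)\<^sup>2)" using bnd[OF that(1)] by simp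
      also have "\<dots> \<le> M / (1 + R\<^sup>2)"
        using M that(2) R' by (intro divide_left_mono mult_pos_pos add_left_mono power_mono) (auto simp: add_pos_nonneg)
      finally show ?thesis .
    qed
    have B0: "0 \<le> M / (1 + R\<^sup>2)" using M by (simp add: add_nonneg_nonneg)
    have reg: "Re w > - \<delta> \<and> norm w \<ge> R \<and> norm (w - s) \<ge> 1"
      if "w \<in> closed_segment a1 a2 \<or> w \<in> closed_segment a2 a3 \<or> w \<in> closed_segment a3 a4" for w
    proof -
      have "(Re w = R \<or> \<bar>Im w\<bar> = R) \<and> Re w \<ge> c"
        using that R' by (auto simp: a1_def a2_def a3_def a4_def closed_segment_same_Im closed_segment_same_Re closed_segment_eq_real_ivl split: if_splits)
      then show ?thesis
        using abs_Re_le_cmod[of w] abs_Im_le_cmod[of w] abs_Re_le_cmod[of "w - s"] abs_Im_le_cmod[of "w - s"] R' c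
        by auto
    qed
    have n1: "norm ?I1 \<le> M / (1 + R\<^sup>2) * norm (a2 - a1)"
      by (rule contour_integral_bound_linepath[OF ci(1) B0]) (use bd reg in blast)
    have n2: "norm ?I2 \<le> M / (1 + R\<^sup>2) * norm (a3 - a2)"
      by (rule contour_integral_bound_linepath[OF ci(2) B0]) (use bd reg in blast)
    have n3: "norm ?I3 \<le> M / (1 + R\<^sup>2) * norm (a4 - a3)"
      by (rule contour_integral_bound_linepath[OF ci(3) B0]) (use bd reg in blast)
    have l: "norm (a2 - a1) \<le> 2 * R" "norm (a3 - a2) \<le> 2 * R" "norm (a4 - a3) \<le> 2 * R"
      using R' cmod_le[of "a2 - a1"] cmod_le[of "a3 - a2"] cmod_le[of "a4 - a3"]
      by (auto simp: a1_def a2_def a3_def a4_def)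
    have n: "norm (?I1 + (?I2 + ?I3)) \<le> M / (1 + R\<^sup>2) * (6 * R)"
    proof -
      have "norm (?I1 + (?I2 + ?I3)) \<le> norm ?I1 + (norm ?I2 + norm ?I3)"
        by (intro norm_triangle_le add_left_mono norm_triangle_ineq)
      also have "\<dots> \<le> M / (1 + R\<^sup>2) * (2 * R) + (M / (1 + R\<^sup>2) * (2 * R) + M / (1 + R\<^sup>2) * (2 * R))"
        by (intro add_mono order_trans[OF n1 mult_left_mono[OF l(1) B0]]
            order_trans[OF n2 mult_left_mono[OF l(2) B0]] order_trans[OF n3 mult_left_mono[OF l(3) B0]])
      also have "\<dots> = M / (1 + R\<^sup>2) * (6 * R)" by (simp add: algebra_simps)
      finally show ?thesis .
    qed
    have "?I4 = - contour_integral (linepath a1 a4) ?g"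
      using contour_integral_reversepath[of "linepath a1 a4" ?g] by simp
    also have "contour_integral (linepath a1 a4) ?g = \<i> * integral {-R..R} (\<lambda>x. ?g (Complex c x))"
      by (rule contour_integral_linepath_same_Re) (use R' in \<open>auto simp: a1_def a4_def\<close>)
    also have "integral {-R..R} (\<lambda>x. ?g (Complex c x)) = - integral {-R..R} ?f"
    proof -
      have "?g (Complex c x) = - ?f x" for x
        using ne[of x] by (simp add: field_simps)
      then show ?thesis by (simp)
    qed
    also have "integral {-R..R} ?f = (LBINT y:{-R..R}. ?f y)"
      using int unfolding set_integrable_def
      by (intro set_borel_integral_eq_integral(2)[symmetric])
        (auto simp: set_integrable_def intro!: integrable_mult_indicator[OF _ int])
    finally have I4: "?I4 = \<i> * (LBINT y:{-R..R}. ?f y)" by simp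
    have "\<i> * ((LBINT y:{-R..R}. ?f y) - 2 * pi * H s) = - (?I1 + (?I2 + ?I3))"
      using sum I4 by (simp add: algebra_simps)
    from arg_cong[OF this, of norm]
    have "norm ((LBINT y:{-R..R}. ?f y) - 2 * pi * H s) = norm (?I1 + (?I2 + ?I3))"
      unfolding norm_mult norm_minus_cancel norm_ii mult_1 .
    then show ?thesis using n by simp
  qed
  have lim1: "((\<lambda>R. (LBINT y:{-R..R}. ?f y) - 2 * pi * H s) \<longlongrightarrow> 0) at_top"
  proof (rule Lim_null_comparison)
    show "\<forall>\<^sub>F R in at_top. norm ((LBINT y:{-R..R}. ?f y) - 2 * pi * H s) \<le> M / (1 + R\<^sup>2) * (6 * R)"
      using key by (auto simp: eventually_at_top_linorder)
    show "((\<lambda>R. M / (1 + R\<^sup>2) * (6 * R)) \<longlongrightarrow> 0) at_top"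
      by real_asymp
  qed
  have lim2: "((\<lambda>R. LBINT y:{-R..R}. ?f y) \<longlongrightarrow> (LBINT y. ?f y)) at_top"
  proof (rule tendsto_at_topI_sequentially)
    fix X :: "nat \<Rightarrow> real" assume X: "filterlim X at_top sequentially"
    show "(\<lambda>n. LINT y:{- X n..X n}|lborel. ?f y) \<longlonglongrightarrow> (LBINT y. ?f y)"
      unfolding set_lebesgue_integral_def
    proof (rule integral_dominated_convergence)
      show "integrable lborel (\<lambda>y. norm (?f y))" using int by simp
      show "AE y in lborel. (\<lambda>n. indicat_real {- X n..X n} y *\<^sub>R ?f y) \<longlonglongrightarrow> ?f y"
      proof (intro AE_I2 tendsto_eventually)
        fix y
        have "\<forall>\<^sub>F n in sequentially. X n \<ge> \<bar>y\<bar>" using X by (auto simp: filterlim_at_top)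
        then show "\<forall>\<^sub>F n in sequentially. indicat_real {- X n..X n} y *\<^sub>R ?f y = ?f y"
          by eventually_elim (auto simp: indicator_def)
      qed
    qed (use int in \<open>auto simp: indicator_def\<close>)
  qed
  have "((\<lambda>R. (LBINT y:{-R..R}. ?f y) - 2 * pi * H s) \<longlongrightarrow> (LBINT y. ?f y) - 2 * pi * H s) at_top"
    by (intro tendsto_intros lim2)
  then have "(LBINT y. ?f y) - 2 * pi * H s = 0"
    using lim1 tendsto_unique trivial_limit_at_top_linorder by blast
  then show "(LBINT y. ?f y) = 2 * pi * H s" by simp
qed

lemma set_integral_bounded_linear:
  fixes T :: "'a::euclidean_space \<Rightarrow> 'b::euclidean_space"
  assumes "bounded_linear T" "set_integrable M S f"
  shows "set_integrable M S (\<lambda>x. T (f x))" and "(LINT x:S|M. T (f x)) = T (LINT x:S|M. f x)"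
proof -
  have eq: "indicat_real S x *\<^sub>R T (f x) = T (indicat_real S x *\<^sub>R f x)" for x
    using assms(1) by (simp add: bounded_linear.linear linear_cmul)
  show "set_integrable M S (\<lambda>x. T (f x))"
    using assms(2) unfolding set_integrable_def eq by (rule integrable_bounded_linear[OF assms(1)])
  show "(LINT x:S|M. T (f x)) = T (LINT x:S|M. f x)"
    using assms(2) unfolding set_integrable_def set_lebesgue_integral_def eq
    by (rule integral_bounded_linear[OF assms(1)])
qed

lemma laplace_unique_complex:
  fixes g :: "real \<Rightarrow> complex"
  assumes cont: "continuous_on {0..} g" and bnd: "\<And>t. t \<ge> 0 \<Longrightarrow> norm (g t) \<le> C * exp (\<sigma> * t)"
    and zero: "\<And>s. s > \<sigma> \<Longrightarrow> laplace g s = 0"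
    and t: "t \<ge> 0"
  shows "g t = 0"
proof -
  have int: "set_integrable lborel {0..} (\<lambda>t. exp (- (s * t)) *\<^sub>R g t)" if "s > \<sigma>" for s
    by (rule laplace_bounded_integrable[OF cont bnd that])
  have part: "p (g t) = 0" if p: "bounded_linear p" "\<And>z. \<bar>p z\<bar> \<le> norm z" for p :: "complex \<Rightarrow> real"
  proof (rule laplace_unique_real[where g = "\<lambda>t. p (g t)" and C = C and \<sigma> = \<sigma>])
    show "(LBINT t:{0..}. exp (- (s * t)) * p (g t)) = 0" if "s > \<sigma>" for s
      using set_integral_bounded_linear(2)[OF p(1) int[OF that]] zero[OF that]
      by (simp add: bounded_linear.linear[OF p(1)] linear_cmul linear_0)
    show "\<bar>p (g t)\<bar> \<le> C * exp (\<sigma> * t)" if "t \<ge> 0" for t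
      using bnd[OF that] p(2)[of "g t"] by linarith
  qed (use t bounded_linear.continuous_on[OF p(1) cont] in auto)
  show ?thesis
    using part[OF bounded_linear_Re abs_Re_le_cmod] part[OF bounded_linear_Im abs_Im_le_cmod]
    by (simp add: complex_eq_iff)
qed

lemma laplace_exp:
  assumes "Re w < s"
  shows "laplace (\<lambda>t. exp (w * of_real t)) s = 1 / (of_real s - w)"
proof -
  let ?y = "\<lambda>t. exp (w * of_real t)"
  have b: "norm (?y t) = exp (Re w * t)" for t by (simp add: norm_exp_eq_Re)
  have "(LBINT t:{0..}. exp (- (s * t)) *\<^sub>R (w * ?y t))
     = s *\<^sub>R (LBINT t:{0..}. exp (- (s * t)) *\<^sub>R ?y t) - ?y 0"
  proof (rule laplace_derivative[where C=1 and C'="norm w" and \<sigma>="Re w"])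
    show "(?y has_vector_derivative w * ?y t) (at t within {0..})" for t
      by (rule has_vector_derivative_real_field) (auto intro!: derivative_eq_intros)
  qed (use assms in \<open>auto intro!: continuous_intros simp: b norm_mult\<close>)
  moreover have "(LBINT t:{0..}. exp (- (s * t)) *\<^sub>R (w * ?y t)) = w * (LBINT t:{0..}. exp (- (s * t)) *\<^sub>R ?y t)"
    unfolding mult_scaleR_right[symmetric] by (rule set_integral_mult_right)
  ultimately have "w * (LBINT t:{0..}. exp (- (s * t)) *\<^sub>R ?y t)
     = s * (LBINT t:{0..}. exp (- (s * t)) *\<^sub>R ?y t) - 1"
    by (simp add: scaleR_conv_of_real)
  moreover have "of_real s - w \<noteq> 0" using assms by (auto simp: complex_eq_iff)
  ultimately show ?thesis by (simp add: field_simps)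
qed

text \<open>The candidate \<open>k\<close> is the inversion integral on the line Re = c, and is
  therefore bounded by a multiple of exp (c t). Fubini and the transform 1/(s - w) of exp (w t) turn
  its transform into the Cauchy integral of \<open>H\<close>, that is \<open>H s\<close> for s > c;
  uniqueness then gives h = k.\<close>

lemma laplace_decay:
  fixes H :: "complex \<Rightarrow> complex" and h :: "real \<Rightarrow> complex"
  assumes hol: "H holomorphic_on {s. Re s > - \<delta>}"
    and bnd: "\<And>s. Re s > - \<delta> \<Longrightarrow> norm (H s) \<le> M / (1 + (norm s)\<^sup>2)"
    and c: "- \<delta> < c"
    and cont: "continuous_on {0..} h" and hb: "\<And>t. t \<ge> 0 \<Longrightarrow> norm (h t) \<le> C * exp (\<sigma> * t)"
    and lap: "\<And>s. s > \<sigma> \<Longrightarrow> laplace h s = H s"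
  shows "\<exists>K. \<forall>t\<ge>0. norm (h t) \<le> K * exp (c * t)"
proof -
  let ?k = "\<lambda>t y. exp (Complex c y * of_real t) * H (Complex c y)"
  define k where "k = (\<lambda>t. (1 / (2 * pi)) *\<^sub>R (LBINT y. ?k t y))"
  note M = vertical_line_decay(1)[OF hol bnd c] and contH = vertical_line_decay(2)[OF hol bnd c]
    and nb = vertical_line_decay(3)[OF hol bnd c]
  have Hm [measurable]: "(\<lambda>y. H (Complex c y)) \<in> borel_measurable borel"
    by (rule borel_measurable_continuous_onI[OF contH])
  have Cm [measurable]: "Complex c \<in> borel_measurable borel"
    by (rule borel_measurable_continuous_onI) (auto simp: Complex_eq[abs_def] intro!: continuous_intros)
  define J where "J = (LBINT y. M * inverse (1 + y\<^sup>2))"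
  have Ji: "integrable lborel (\<lambda>y. M * inverse (1 + y\<^sup>2))"
    by (intro integrable_mult_right integrable_inverse_1_plus_sq)
  have ne: "norm (?k t y) \<le> exp (c * t) * (M * inverse (1 + y\<^sup>2))" for y t
    using nb by (simp add: norm_mult norm_exp_eq_Re)
  have ki: "integrable lborel (\<lambda>y. ?k t y)" for t
  proof (rule Bochner_Integration.integrable_bound[OF integrable_mult_right[OF Ji, of "exp (c * t)"]])
    show "AE y in lborel. norm (?k t y) \<le> norm (exp (c * t) * (M * inverse (1 + y\<^sup>2)))"
      unfolding real_norm_def using ne abs_ge_self order_trans by (intro AE_I2) blast
  qed measurable
  have kb: "norm (k t) \<le> J * exp (c * t)" for t
  proof -
    have "norm (LBINT y. ?k t y)
       \<le> (LBINT y. norm (?k t y))"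
      by (rule integral_norm_bound)
    also have "\<dots> \<le> (LBINT y. exp (c * t) * (M * inverse (1 + y\<^sup>2)))"
      by (intro integral_mono integrable_norm ki integrable_mult_right Ji ne)
    also have "\<dots> = J * exp (c * t)" by (simp add: J_def)
    finally have *: "norm (LBINT y. ?k t y) \<le> J * exp (c * t)" .
    have "norm (k t) = 1 / (2 * pi) * norm (LBINT y. ?k t y)"
      by (simp add: k_def)
    also have "\<dots> \<le> 1 * norm (LBINT y. ?k t y)"
      using pi_gt3 by (intro mult_right_mono) (auto simp: field_simps)
    finally show ?thesis using * by simp
  qed
  have kc: "continuous_on {0..} k"
    unfolding continuous_on_sequentially
  proof (intro allI ballI impI)
    fix X :: "nat \<Rightarrow> real" and a assume X: "a \<in> {0..}" "(\<forall>n. X n \<in> {0..}) \<and> X \<longlonglongrightarrow> a"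
    then have "Bseq X" by (intro convergent_imp_Bseq convergentI) auto
    then obtain B where B: "\<And>n. \<bar>X n\<bar> \<le> B" unfolding Bseq_def by auto
    have "(\<lambda>n. LBINT y. ?k (X n) y)
       \<longlonglongrightarrow> (LBINT y. ?k a y)"
    proof (rule integral_dominated_convergence)
      show "integrable lborel (\<lambda>y. exp (\<bar>c\<bar> * B) * (M * inverse (1 + y\<^sup>2)))"
        by (intro integrable_mult_right Ji)
      show "AE y in lborel. (\<lambda>n. ?k (X n) y) \<longlonglongrightarrow> ?k a y"
        using X by (intro AE_I2 tendsto_intros) auto
      show "AE y in lborel. norm (?k (X n) y) \<le> exp (\<bar>c\<bar> * B) * (M * inverse (1 + y\<^sup>2))" for n
      proof (intro AE_I2)
        fix y
        have "c * X n \<le> \<bar>c\<bar> * \<bar>X n\<bar>" by (metis abs_ge_self abs_mult)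
        also have "\<dots> \<le> \<bar>c\<bar> * B" using B by (intro mult_left_mono) auto
        finally have "exp (c * X n) * (M * inverse (1 + y\<^sup>2)) \<le> exp (\<bar>c\<bar> * B) * (M * inverse (1 + y\<^sup>2))"
          using M by (intro mult_right_mono) (auto intro!: mult_nonneg_nonneg add_nonneg_nonneg)
        then show "norm (?k (X n) y) \<le> exp (\<bar>c\<bar> * B) * (M * inverse (1 + y\<^sup>2))"
          using ne order_trans by blast
      qed
    qed measurable
    then show "(k \<circ> X) \<longlonglongrightarrow> k a"
      unfolding k_def comp_def by (intro tendsto_intros)
  qed
  have kl: "laplace k s = H s" if s: "s > c" for s
  proof -
    let ?q = "\<lambda>t y. indicat_real {0..} t *\<^sub>R (exp (- (s * t)) *\<^sub>R (?k t y))"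
    have qb: "norm (?q t y) \<le> indicat_real {0..} t * exp (- ((s - c) * t)) * (M * inverse (1 + y\<^sup>2))" for t y
    proof -
      have "norm (?q t y) \<le> indicat_real {0..} t * (exp (- (s * t)) * (exp (c * t) * (M * inverse (1 + y\<^sup>2))))"
        unfolding norm_scaleR using ne[of y t] by (simp add: mult.assoc) (intro mult_left_mono, auto)
      also have "\<dots> = indicat_real {0..} t * exp (- ((s - c) * t)) * (M * inverse (1 + y\<^sup>2))"
        by (simp add: left_diff_distrib exp_diff exp_minus field_simps)
      finally show ?thesis .
    qed
    have expi: "integrable lborel (\<lambda>t. indicat_real {0..} t * exp (- ((s - c) * t)))"
      using set_integrable_exp_minus(1)[of "s - c"] s by (simp add: set_integrable_def)
    have qm [measurable]: "case_prod ?q \<in> borel_measurable (lborel \<Otimes>\<^sub>M lborel)"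
      by measurable
    have qi: "integrable (lborel \<Otimes>\<^sub>M lborel) (case_prod ?q)"
    proof (rule lborel_pair.Fubini_integrable[OF qm])
      have qi2: "integrable lborel (?q t)" for t
        by (intro integrable_scaleR_right ki)
      then show "AE t in lborel. integrable lborel (\<lambda>y. case_prod ?q (t, y))" by simp
      show "integrable lborel (\<lambda>t. LBINT y. norm (case_prod ?q (t, y)))"
      proof (rule Bochner_Integration.integrable_bound[OF integrable_mult_left[OF expi, of J]])
        show "(\<lambda>t. LBINT y. norm (case_prod ?q (t, y))) \<in> borel_measurable lborel"
          by measurable
        have "norm (LBINT y. norm (?q t y)) \<le> indicat_real {0..} t * exp (- ((s - c) * t)) * J" for t
        proof -
          have "norm (LBINT y. norm (?q t y)) = (LBINT y. norm (?q t y))"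
            by (simp)
          also have "\<dots> \<le> (LBINT y. indicat_real {0..} t * exp (- ((s - c) * t)) * (M * inverse (1 + y\<^sup>2)))"
            by (intro integral_mono integrable_norm qi2 integrable_mult_right Ji qb)
          also have "\<dots> = indicat_real {0..} t * exp (- ((s - c) * t)) * J" unfolding J_def by (rule integral_mult_right_zero)
          finally show ?thesis .
        qed
        then show "AE t in lborel. norm (LBINT y. norm (case_prod ?q (t, y))) \<le> norm (indicat_real {0..} t * exp (- ((s - c) * t)) * J)"
          unfolding case_prod_conv real_norm_def[of "_ * J"] using abs_ge_self order_trans by (intro AE_I2) blast
      qed
    qed
    have "laplace k s = (1 / (2 * pi)) *\<^sub>R (LBINT t. LBINT y. ?q t y)"
      unfolding k_def set_lebesgue_integral_def
      by (simp add: integral_scaleR_right[symmetric] mult.commute mult.left_commute del: integral_scaleR_right)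
    also have "(LBINT t. LBINT y. ?q t y) = (LBINT y. LBINT t. ?q t y)"
      by (rule lborel_pair.Fubini_integral[OF qi, symmetric])
    also have "(\<lambda>y. LBINT t. ?q t y) = (\<lambda>y. H (Complex c y) / (of_real s - Complex c y))"
    proof
      fix y
      have "(LBINT t. ?q t y) = (LBINT t:{0..}. (exp (- (s * t)) *\<^sub>R exp (Complex c y * of_real t)) * H (Complex c y))"
        unfolding set_lebesgue_integral_def by (simp add: mult.assoc)
      also have "\<dots> = 1 / (of_real s - Complex c y) * H (Complex c y)"
        using s by (subst set_integral_mult_left, subst laplace_exp) auto
      finally show "(LBINT t. ?q t y) = H (Complex c y) / (of_real s - Complex c y)" by simp
    qed
    also have "(LBINT y. H (Complex c y) / (of_real s - Complex c y)) = 2 * pi * H s"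
      by (rule cauchy_half_plane(2)[OF hol bnd c s])
    finally show ?thesis by (simp add: scaleR_conv_of_real)
  qed
  \<comment> \<open>Agreement of the transforms to the right of both abscissae suffices for
    uniqueness, even when \<open>c\<close> is negative and \<open>\<sigma>\<close> positive.\<close>
  define \<sigma>' where "\<sigma>' = max \<sigma> c"
  have "h t - k t = 0" if t: "t \<ge> 0" for t
  proof (rule laplace_unique_complex[where g="\<lambda>t. h t - k t", OF _ _ _ t])
    show "continuous_on {0..} (\<lambda>t. h t - k t)" by (intro continuous_intros cont kc)
    show "norm (h t - k t) \<le> (\<bar>C\<bar> + \<bar>J\<bar>) * exp (\<sigma>' * t)" if t: "t \<ge> 0" for t
    proof -
      have "norm (h t - k t) \<le> C * exp (\<sigma> * t) + J * exp (c * t)"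
        using hb[OF t] kb[of t] norm_triangle_ineq4[of "h t" "k t"] by simp
      also have "\<dots> \<le> \<bar>C\<bar> * exp (\<sigma>' * t) + \<bar>J\<bar> * exp (\<sigma>' * t)"
        using t by (intro add_mono mult_mono) (auto simp: \<sigma>'_def intro!: mult_right_mono)
      finally show ?thesis by (simp add: algebra_simps)
    qed
    show "laplace (\<lambda>t. h t - k t) s = 0" if s: "s > \<sigma>'" for s
    proof -
      have s1: "s > \<sigma>" "s > c" using s by (auto simp: \<sigma>'_def)
      have i1: "set_integrable lborel {0..} (\<lambda>t. exp (- (s * t)) *\<^sub>R h t)"
        by (rule laplace_bounded_integrable[OF cont hb s1(1)])
      have i2: "set_integrable lborel {0..} (\<lambda>t. exp (- (s * t)) *\<^sub>R k t)"
        by (rule laplace_bounded_integrable[OF kc kb s1(2)])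
      show ?thesis unfolding scaleR_diff_right set_integral_diff(2)[OF i1 i2]
        using lap[OF s1(1)] kl[OF s1(2)] by simp
    qed
  qed
  then have "norm (h t) \<le> J * exp (c * t)" if "t \<ge> 0" for t using kb[of t] that by simp
  then show ?thesis by blast
qed

section \<open>Stability of linear delay equations\<close>

lemma has_vector_derivative_interior:
  assumes "(f has_vector_derivative D) (at t within {0::real..})" "t > 0"
  shows "(f has_vector_derivative D) (at t)"
proof -
  have "at t within {0..} = at t"
    by (rule at_within_interior) (use assms(2) in \<open>auto simp: interior_Ici[of "-1"]\<close>)
  then show ?thesis using assms by simp
qed

lemma has_vector_derivative_shift:
  assumes "(g has_vector_derivative g') (at (t + \<tau>) within {0..})" "(\<tau>::real) \<ge> 0"
  shows "((\<lambda>t. g (t + \<tau>)) has_vector_derivative g') (at t within {0..})"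
proof -
  have "(g has_vector_derivative g') (at (t + \<tau>) within (\<lambda>t. t + \<tau>) ` {0..})"
    by (rule has_vector_derivative_within_subset[OF assms(1)]) (use assms(2) in auto)
  moreover have "((\<lambda>t. t + \<tau>) has_vector_derivative 1) (at t within {0..})"
    by (auto intro!: derivative_eq_intros)
  ultimately show ?thesis
    using vector_diff_chain_within[of "\<lambda>t. t + \<tau>" 1 t "{0..}" g] by (simp add: o_def)
qed

lemma tendsto_at_top_unshift:
  assumes "((\<lambda>t. g (t + \<tau>)) \<longlongrightarrow> l) at_top"
  shows "(g \<longlongrightarrow> l) (at_top :: real filter)"
proof -
  have "filterlim (\<lambda>t::real. t - \<tau>) at_top at_top" by real_asymp
  from filterlim_compose[OF assms this] show ?thesis by simp
qed

section \<open>Growth bounds and the first-order filter\<close>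

lemma norm_le_exp_of_derivative:
  fixes y :: "real \<Rightarrow> 'a::real_normed_vector"
  assumes der: "\<And>t. t \<ge> 0 \<Longrightarrow> (y has_vector_derivative y' t) (at t within {0..})"
    and b: "\<And>r. 0 \<le> r \<Longrightarrow> r \<le> t \<Longrightarrow> norm (y' r) \<le> C * exp (\<kappa> * r)" and "\<kappa> > 0" "t \<ge> 0"
  shows "norm (y t) \<le> norm (y 0) + C / \<kappa> * exp (\<kappa> * t)"
proof (cases "t = 0")
  case True
  have "0 \<le> C" using order_trans[OF norm_ge_zero b[of 0]] assms by simp
  then show ?thesis using True \<open>\<kappa> > 0\<close> by simp
next
  case False
  have C: "0 \<le> C" using order_trans[OF norm_ge_zero b[of 0]] assms by simp
  have cont: "continuous_on {0..} y"
    by (rule continuous_on_vector_derivative) (use der in auto)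
  have "norm (y t - y 0) \<le> C / \<kappa> * exp (\<kappa> * t) - C / \<kappa> * exp (\<kappa> * 0)"
  proof (rule differentiable_bound_general)
    show "continuous_on {0..t} y" by (rule continuous_on_subset[OF cont]) auto
    show "continuous_on {0..t} (\<lambda>t. C / \<kappa> * exp (\<kappa> * t))" by (intro continuous_intros)
    show "(y has_vector_derivative y' x) (at x)" if "0 < x" for x
      using has_vector_derivative_interior[OF der] that by simp
    show "((\<lambda>t. C / \<kappa> * exp (\<kappa> * t)) has_vector_derivative C * exp (\<kappa> * x)) (at x)" for x
      unfolding has_real_derivative_iff_has_vector_derivative[symmetric]
      using \<open>\<kappa> > 0\<close> by (auto intro!: derivative_eq_intros)
  qed (use b False \<open>t \<ge> 0\<close> in auto)
  also have "\<dots> \<le> C / \<kappa> * exp (\<kappa> * t)" using C \<open>\<kappa> > 0\<close> by simp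
  finally show ?thesis using norm_triangle_sub[of "y t" "y 0"] by linarith
qed

text \<open>With the integrating factor exp t, the product exp t * w has derivative exp t * g, which
  grows at rate \<sigma> + 1 > 0.\<close>

lemma first_order_filter_bound:
  fixes w :: "real \<Rightarrow> 'a::real_normed_vector"
  assumes der: "\<And>t. t \<ge> 0 \<Longrightarrow> (w has_vector_derivative (g t - w t)) (at t within {0..})"
    and g: "\<And>t. t \<ge> 0 \<Longrightarrow> norm (g t) \<le> C * exp (\<sigma> * t)" and \<sigma>: "\<sigma> > - 1" and t: "t \<ge> 0"
  shows "norm (w t) \<le> norm (w 0) * exp (- t) + C / (\<sigma> + 1) * exp (\<sigma> * t)"
proof -
  have "norm (exp t *\<^sub>R w t) \<le> norm (exp 0 *\<^sub>R w 0) + C / (\<sigma> + 1) * exp ((\<sigma> + 1) * t)"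
  proof (rule norm_le_exp_of_derivative[where y' = "\<lambda>t. exp t *\<^sub>R g t"])
    show "((\<lambda>t. exp t *\<^sub>R w t) has_vector_derivative exp t *\<^sub>R g t) (at t within {0..})" if "t \<ge> 0" for t
      using der[OF that] by (auto intro!: derivative_eq_intros simp: algebra_simps)
    show "norm (exp r *\<^sub>R g r) \<le> C * exp ((\<sigma> + 1) * r)" if "0 \<le> r" for r
    proof -
      have "norm (exp r *\<^sub>R g r) \<le> exp r * (C * exp (\<sigma> * r))" using g[OF that] by simp
      also have "\<dots> = C * exp ((\<sigma> + 1) * r)" by (simp add: exp_add algebra_simps)
      finally show ?thesis .
    qed
  qed (use \<sigma> t in auto)
  then have "exp t * norm (w t) \<le> norm (w 0) + C / (\<sigma> + 1) * exp ((\<sigma> + 1) * t)" by simp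
  then have "exp (- t) * (exp t * norm (w t)) \<le> exp (- t) * (norm (w 0) + C / (\<sigma> + 1) * exp ((\<sigma> + 1) * t))"
    by (intro mult_left_mono) auto
  also have "exp (- t) * (norm (w 0) + C / (\<sigma> + 1) * exp ((\<sigma> + 1) * t))
     = norm (w 0) * exp (- t) + C / (\<sigma> + 1) * (exp (- t) * exp ((\<sigma> + 1) * t))"
    by (simp only: distrib_left mult_ac)
  also have "exp (- t) * exp ((\<sigma> + 1) * t) = exp (\<sigma> * t)" by (simp add: exp_add[symmetric] algebra_simps)
  finally show ?thesis by (simp add: mult.assoc[symmetric] exp_add[symmetric])
qed

text \<open>Variation of constants: \<open>w\<close> is the convolution of \<open>g\<close> with exp
  (-t).\<close>

lemma first_order_filter_exists:
  fixes g :: "real \<Rightarrow> 'a::banach"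
  assumes cont: "continuous_on {0..} g"
  obtains w where "w 0 = 0" "\<And>t. t \<ge> 0 \<Longrightarrow> (w has_vector_derivative (g t - w t)) (at t within {0..})"
proof -
  define w where "w = (\<lambda>t. exp (- t) *\<^sub>R integral {0..t} (\<lambda>r. exp r *\<^sub>R g r))"
  have "w 0 = 0" by (simp add: w_def)
  moreover have "(w has_vector_derivative (g t - w t)) (at t within {0..})" if t: "t \<ge> 0" for t
  proof -
    have "((\<lambda>u. integral {0..u} (\<lambda>r. exp r *\<^sub>R g r)) has_vector_derivative exp t *\<^sub>R g t) (at t within {0..t+1})"
      by (rule integral_has_vector_derivative)
        (use t in \<open>auto intro!: continuous_intros continuous_on_subset[OF cont]\<close>)
    moreover have "at t within {0..t+1} = at t within {0..}"
      by (rule at_within_nhd[of t "{..<t+1}"]) (use t in auto)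
    ultimately have "((\<lambda>u. integral {0..u} (\<lambda>r. exp r *\<^sub>R g r)) has_vector_derivative exp t *\<^sub>R g t) (at t within {0..})"
      by simp
    then show ?thesis unfolding w_def
      by (auto intro!: derivative_eq_intros simp: exp_add[symmetric])
  qed
  ultimately show thesis using that by blast
qed

lemma matrix_vector_bound:
  fixes A :: "'a::{euclidean_space,real_algebra_1}^'n^'m"
  obtains a where "a > 0" "\<And>v. norm (A *v v) \<le> a * norm v"
proof -
  obtain a where "a > 0" "\<forall>v. norm (A *v v) \<le> norm v * a"
    using bounded_linear.pos_bounded[OF matrix_vector_mul_bounded_linear, of A] by blast
  then show ?thesis by (intro that[of a]) (auto simp: mult.commute)
qed

lemma continuous_on_matrix_vector [continuous_intros]:
  fixes A :: "'a::{euclidean_space,real_algebra_1}^'n^'m"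
  assumes "continuous_on S f" shows "continuous_on S (\<lambda>t. A *v f t)"
  using bounded_linear.continuous_on[OF matrix_vector_mul_bounded_linear assms] .

text \<open>An a priori growth bound, without which no transform can be formed. For the norm
  weighted by exp (-\<sigma> t) the integrated equation is a contraction up to constants, so the
  weighted maximum over [0,T] is bounded independently of T.\<close>

lemma dde_exp_bounded:
  fixes A G :: "complex^'n^'n" and z f :: "real \<Rightarrow> complex^'n"
  assumes "\<tau> \<ge> 0" and cz: "continuous_on {-\<tau>..} z"
    and der: "\<And>t. t \<ge> 0 \<Longrightarrow> (z has_vector_derivative (A *v z t + G *v z (t - \<tau>) + f t)) (at t within {0..})"
    and fb: "\<And>t. t \<ge> 0 \<Longrightarrow> norm (f t) \<le> Kf"
  obtains C \<sigma> where "C \<ge> 0" "\<sigma> > 0" "\<And>t. t \<ge> 0 \<Longrightarrow> norm (z t) \<le> C * exp (\<sigma> * t)"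
    "\<And>t. t \<ge> 0 \<Longrightarrow> norm (z (t - \<tau>)) \<le> C * exp (\<sigma> * t)"
    "\<And>t. t \<ge> 0 \<Longrightarrow> norm (A *v z t + G *v z (t - \<tau>) + f t) \<le> C * exp (\<sigma> * t)"
proof -
  obtain a where a: "a > 0" "\<And>v. norm (A *v v) \<le> a * norm v" using matrix_vector_bound by blast
  obtain g where g: "g > 0" "\<And>v. norm (G *v v) \<le> g * norm v" using matrix_vector_bound by blast
  have "compact (z ` {-\<tau>..0})"
    by (intro compact_continuous_image continuous_on_subset[OF cz]) auto
  then obtain h where h: "\<And>t. t \<in> {-\<tau>..0} \<Longrightarrow> norm (z t) \<le> h"
    using compact_imp_bounded[of "z ` {-\<tau>..0}"] unfolding bounded_iff by blast
  have h0: "h \<ge> 0" using h[of 0] \<open>\<tau> \<ge> 0\<close> order_trans[OF norm_ge_zero] by auto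
  have Kf: "Kf \<ge> 0" using fb[of 0] order_trans[OF norm_ge_zero] by auto
  \<comment> \<open>Chosen so that (a + g) / \<sigma> <= 1/2: the term with the unknown maximum
    \<open>\<mu>\<close> is absorbed on the left, and the remainder doubles to
    \<open>m\<close>.\<close>
  define \<sigma> where "\<sigma> = 2 * (a + g) + 1"
  have \<sigma>: "\<sigma> \<ge> 1" using a g by (simp add: \<sigma>_def)
  define m where "m = 2 * (norm (z 0) + g * h + Kf)"
  have m0: "m \<ge> 0" using g h0 Kf by (simp add: m_def)
  \<comment> \<open>Before time \<open>\<tau>\<close> the delayed argument lies in the initial
    interval, where the bound \<open>h\<close> of the history takes over.\<close>
  have delayed: "norm (z (t - \<tau>)) \<le> (\<mu> + h) * exp (\<sigma> * t)"
    if "\<And>r. 0 \<le> r \<Longrightarrow> r \<le> t \<Longrightarrow> norm (z r) \<le> \<mu> * exp (\<sigma> * r)" "t \<ge> 0" "\<mu> \<ge> 0" for t \<mu>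
  proof (cases "t \<ge> \<tau>")
    case True
    then have "norm (z (t - \<tau>)) \<le> \<mu> * exp (\<sigma> * (t - \<tau>))" using that \<open>\<tau> \<ge> 0\<close> by simp
    also have "\<dots> \<le> (\<mu> + h) * exp (\<sigma> * t)"
      using \<sigma> \<open>\<tau> \<ge> 0\<close> h0 that by (intro mult_mono) auto
    finally show ?thesis .
  next
    case False
    have "norm (z (t - \<tau>)) \<le> h" using False that by (intro h) auto
    also have "\<dots> \<le> (\<mu> + h) * exp (\<sigma> * t)"
      using \<sigma> h0 that mult_mono[of h "\<mu> + h" 1 "exp (\<sigma> * t)"] by simp
    finally show ?thesis .
  qed
  have rhs: "norm (A *v z t + G *v z (t - \<tau>) + f t) \<le> (a * \<mu> + g * (\<mu> + h) + Kf) * exp (\<sigma> * t)"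
    if "\<And>r. 0 \<le> r \<Longrightarrow> r \<le> t \<Longrightarrow> norm (z r) \<le> \<mu> * exp (\<sigma> * r)" "t \<ge> 0" "\<mu> \<ge> 0" for t \<mu>
  proof -
    have "norm (A *v z t + G *v z (t - \<tau>) + f t) \<le> a * norm (z t) + g * norm (z (t - \<tau>)) + Kf"
      using a(2)[of "z t"] g(2)[of "z (t - \<tau>)"] fb[OF that(2)]
      by (intro norm_triangle_le add_mono) auto
    also have "\<dots> \<le> a * (\<mu> * exp (\<sigma> * t)) + g * ((\<mu> + h) * exp (\<sigma> * t)) + Kf * exp (\<sigma> * t)"
      using that(1)[of t] delayed[OF that] a(1) g(1) Kf that(2) \<sigma> mult_left_mono[of 1 "exp (\<sigma> * t)" Kf]
      by (intro add_mono mult_left_mono) auto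
    finally show ?thesis by (simp add: algebra_simps)
  qed
  have main: "norm (z T) \<le> m * exp (\<sigma> * T)" if T: "T \<ge> 0" for T
  proof -
    have *: "continuous_on {0..T} (\<lambda>t. exp (- (\<sigma> * t)) * norm (z t))"
      using \<open>\<tau> \<ge> 0\<close> by (intro continuous_intros continuous_on_subset[OF cz]) auto
    obtain t1 where t1: "t1 \<in> {0..T}" "\<And>t. t \<in> {0..T} \<Longrightarrow> exp (- (\<sigma> * t)) * norm (z t) \<le> exp (- (\<sigma> * t1)) * norm (z t1)"
      using continuous_attains_sup[OF compact_Icc _ *] T by auto
    define \<mu> where "\<mu> = exp (- (\<sigma> * t1)) * norm (z t1)"
    have \<mu>0: "\<mu> \<ge> 0" by (simp add: \<mu>_def)
    have \<mu>: "norm (z t) \<le> \<mu> * exp (\<sigma> * t)" if "t \<in> {0..T}" for t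
    proof -
      have "exp (- (\<sigma> * t)) * norm (z t) \<le> \<mu>" using t1(2)[OF that] by (simp add: \<mu>_def)
      then have "exp (\<sigma> * t) * (exp (- (\<sigma> * t)) * norm (z t)) \<le> exp (\<sigma> * t) * \<mu>"
        by (intro mult_left_mono) auto
      then show ?thesis by (simp add: exp_minus field_simps)
    qed
    have "norm (z t1) \<le> norm (z 0) + (a * \<mu> + g * (\<mu> + h) + Kf) / \<sigma> * exp (\<sigma> * t1)"
      by (rule norm_le_exp_of_derivative[OF der]) (use rhs \<mu> \<mu>0 t1(1) \<sigma> in auto)
    also have "\<dots> \<le> norm (z 0) * exp (\<sigma> * t1) + (a * \<mu> + g * (\<mu> + h) + Kf) / \<sigma> * exp (\<sigma> * t1)"
      using t1(1) \<sigma> mult_left_mono[of 1 "exp (\<sigma> * t1)" "norm (z 0)"] by simp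
    also have "\<dots> = (norm (z 0) + (a * \<mu> + g * (\<mu> + h) + Kf) / \<sigma>) * exp (\<sigma> * t1)"
      by (simp add: algebra_simps)
    finally have "exp (- (\<sigma> * t1)) * norm (z t1) \<le> exp (- (\<sigma> * t1)) * ((norm (z 0) + (a * \<mu> + g * (\<mu> + h) + Kf) / \<sigma>) * exp (\<sigma> * t1))"
      by (intro mult_left_mono) auto
    also have "\<dots> = norm (z 0) + (a * \<mu> + g * (\<mu> + h) + Kf) / \<sigma>"
      by (simp add: exp_minus)
    finally have m1: "\<mu> \<le> norm (z 0) + ((a + g) * \<mu>) / \<sigma> + (g * h + Kf) / \<sigma>"
      by (simp add: \<mu>_def add_divide_distrib algebra_simps)
    have m2: "((a + g) * \<mu>) / \<sigma> \<le> \<mu> / 2"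
      using \<mu>0 \<sigma> a g by (simp add: field_simps \<sigma>_def)
    have m3: "(g * h + Kf) / \<sigma> \<le> g * h + Kf"
      using \<sigma> g h0 Kf mult_left_mono[of 1 \<sigma> "g * h + Kf"] by (simp add: field_simps)
    have "\<mu> \<le> norm (z 0) + \<mu> / 2 + (g * h + Kf)"
      by (rule order_trans[OF m1 add_mono[OF add_left_mono[OF m2] m3]])
    then have "\<mu> \<le> m" by (simp add: m_def)
    then show ?thesis using T by (intro order_trans[OF \<mu>[of T]] mult_right_mono) auto
  qed
  define C where "C = m + (m + h) + (a * m + g * (m + h) + Kf)"
  have C: "m \<le> C" "m + h \<le> C" "a * m + g * (m + h) + Kf \<le> C"
    using m0 h0 a g Kf by (auto simp: C_def intro!: add_nonneg_nonneg mult_nonneg_nonneg)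
  show thesis
  proof
    show "C \<ge> 0" "\<sigma> > 0" using C m0 \<sigma> by auto
    show "norm (z t) \<le> C * exp (\<sigma> * t)" if "t \<ge> 0" for t
      by (rule order_trans[OF main[OF that] mult_right_mono[OF C(1)]]) simp
    show "norm (z (t - \<tau>)) \<le> C * exp (\<sigma> * t)" if "t \<ge> 0" for t
      by (rule order_trans[OF delayed[OF main that m0] mult_right_mono[OF C(2)]]) simp_all
    show "norm (A *v z t + G *v z (t - \<tau>) + f t) \<le> C * exp (\<sigma> * t)" if "t \<ge> 0" for t
      by (rule order_trans[OF rhs[OF main that m0] mult_right_mono[OF C(3)]]) simp_all
  qed
qed

section \<open>Holomorphic transforms and the characteristic matrix\<close>

lemma finite_laplace_holomorphic:
  fixes f :: "real \<Rightarrow> complex"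
  assumes "continuous_on {0..T} f"
  shows "(\<lambda>s. integral {0..T} (\<lambda>t. exp (- (s * of_real t)) * f t)) holomorphic_on UNIV"
proof -
  have "(\<lambda>s. integral (cbox 0 T) (\<lambda>t. exp (- (s * of_real t)) * f t)) holomorphic_on UNIV"
  proof (rule leibniz_rule_holomorphic)
    show "((\<lambda>s. exp (- (s * of_real t)) * f t) has_field_derivative
       (- of_real t * exp (- (s * of_real t)) * f t)) (at s within UNIV)" for s t
      by (auto intro!: derivative_eq_intros)
    show "(\<lambda>t. exp (- (s * of_real t)) * f t) integrable_on cbox 0 T" for s
      by (intro integrable_continuous continuous_intros) (use assms in auto)
    show "continuous_on (UNIV \<times> cbox 0 T) (\<lambda>(s, t). - of_real t * exp (- (s * of_real t)) * f t)"
      unfolding split_beta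
      by (intro continuous_intros continuous_on_compose2[OF assms]) auto
  qed auto
  then show ?thesis by simp
qed

text \<open>The truncations to [0,n] are entire and converge uniformly on closed discs inside the
  half plane, with a common majorant K exp (-d t).\<close>

lemma laplace_holomorphic:
  fixes f :: "real \<Rightarrow> complex"
  assumes cont: "continuous_on {0..} f" and bnd: "\<And>t. t \<ge> 0 \<Longrightarrow> norm (f t) \<le> K * exp (- (\<gamma> * t))"
  shows "(\<lambda>s. LBINT t:{0..}. exp (- (s * of_real t)) * f t) holomorphic_on {s. Re s > - \<gamma>}"
    and "\<And>s \<delta>. \<delta> < \<gamma> \<Longrightarrow> Re s \<ge> - \<delta> \<Longrightarrow> norm (LBINT t:{0..}. exp (- (s * of_real t)) * f t) \<le> K / (\<gamma> - \<delta>)"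
proof -
  let ?e = "\<lambda>s t. exp (- (s * of_real t)) * f t"
  have K: "K \<ge> 0" using order_trans[OF norm_ge_zero bnd[of 0]] by simp
  have nb: "norm (?e s t) \<le> K * exp (- ((\<gamma> - \<delta>) * t))"
    if "Re s \<ge> - \<delta>" "t \<ge> 0" for s t \<delta>
  proof -
    have "norm (?e s t) \<le> exp (- (Re s * t)) * (K * exp (- (\<gamma> * t)))"
      using bnd[OF that(2)] by (simp add: norm_mult norm_exp_eq_Re mult_left_mono)
    also have "\<dots> \<le> exp (\<delta> * t) * (K * exp (- (\<gamma> * t)))"
      using that K mult_right_mono[OF that] by (intro mult_right_mono) auto
    also have "\<dots> = K * exp (- ((\<gamma> - \<delta>) * t))" by (simp add: exp_add[symmetric] algebra_simps)
    finally show ?thesis .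
  qed
  have c: "continuous_on {0..} (?e s)" for s
    by (intro continuous_intros cont)
  show "norm (LBINT t:{0..}. ?e s t) \<le> K / (\<gamma> - \<delta>)"
    if "\<delta> < \<gamma>" "Re s \<ge> - \<delta>" for s \<delta>
    by (rule exp_bounded_integrable(2)[OF c nb]) (use that in auto)
  show "(\<lambda>s. LBINT t:{0..}. ?e s t) holomorphic_on {s. Re s > - \<gamma>}"
  proof (rule holomorphic_uniform_sequence[where f = "\<lambda>n s. LINT t:{0..real n}|lborel. ?e s t"])
    show "open {s. Re s > - \<gamma>}" by (rule open_halfspace_Re_gt)
    show "(\<lambda>s. LINT t:{0..real n}|lborel. ?e s t) holomorphic_on {s. Re s > - \<gamma>}" for n
    proof -
      have "(LINT t:{0..real n}|lborel. ?e s t) = integral {0..real n} (?e s)" for s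
        by (intro set_borel_integral_eq_integral borel_integrable_atLeastAtMost' continuous_on_subset[OF c]) auto
      then show ?thesis
        using finite_laplace_holomorphic[of "real n" f] continuous_on_subset[OF cont, of "{0..real n}"]
        by (auto intro: holomorphic_on_subset)
    qed
    fix x assume x: "x \<in> {s. Re s > - \<gamma>}"
    define d where "d = (Re x + \<gamma>) / 2"
    have d: "d > 0" using x by (simp add: d_def)
    have R: "Re s \<ge> - (\<gamma> - d)" if "s \<in> cball x d" for s
      using that abs_Re_le_cmod[of "x - s"] by (simp add: dist_norm d_def field_simps)
    have "uniform_limit (cball x d) (\<lambda>b s. LBINT t:{0..b}. ?e s t)
       (\<lambda>s. LBINT t:{0..}. ?e s t) at_top"
    proof (rule uniform_limit_set_lebesgue_integral_at_top)
      show "norm (?e s t) \<le> K * exp (- (d * t))" if "s \<in> cball x d" "t \<ge> 0" for s t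
        using nb[OF R[OF that(1)] that(2)] by simp
      show "set_integrable lborel {0..} (\<lambda>t. K * exp (- (d * t)))"
        by (intro set_integrable_mult_right impI set_integrable_exp_minus(1) d)
      show "set_borel_measurable lborel {0..} (?e s)" for s
        unfolding set_borel_measurable_def
        using borel_measurable_continuous_on_indicator[OF _ c[of s]] by simp
    qed auto
    then have "uniform_limit (cball x d) (\<lambda>n s. LINT t:{0..real n}|lborel. ?e s t)
       (\<lambda>s. LBINT t:{0..}. ?e s t) sequentially"
      by (rule filterlim_compose) (rule filterlim_real_sequentially)
    moreover have "cball x d \<subseteq> {s. Re s > - \<gamma>}" using R d by fastforce
    ultimately show "\<exists>d. 0 < d \<and> cball x d \<subseteq> {s. Re s > - \<gamma>} \<and>
      uniform_limit (cball x d) (\<lambda>n s. LINT t:{0..real n}|lborel. ?e s t)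
       (\<lambda>s. LBINT t:{0..}. ?e s t) sequentially"
      using d by blast
  qed
qed

lemma holomorphic_on_det:
  fixes M :: "complex \<Rightarrow> complex^'n^'n"
  assumes "\<And>i j. (\<lambda>s. M s $ i $ j) holomorphic_on S"
  shows "(\<lambda>s. det (M s)) holomorphic_on S"
  unfolding det_def by (intro holomorphic_intros assms)

text \<open>The characteristic matrix s I - A - exp (-s \<tau>) G of z' = A z + G z(t - \<tau>),
  given entrywise because holomorphy of its determinant is checked on entries.\<close>

definition dde_matrix :: "complex^'n^'n \<Rightarrow> complex^'n^'n \<Rightarrow> real \<Rightarrow> complex \<Rightarrow> complex^'n^'n" where
  "dde_matrix A G \<tau> s = (\<chi> i j. (if i = j then s else 0) - A $ i $ j - exp (- (s * of_real \<tau>)) * G $ i $ j)"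

lemma dde_matrix_mult:
  "dde_matrix A G \<tau> s *v v = s *s v - A *v v - exp (- (s * of_real \<tau>)) *s (G *v v)"
  by (simp add: vec_eq_iff dde_matrix_def matrix_vector_mult_def left_diff_distrib sum_subtractf
      sum_distrib_left mult.assoc if_distrib[of "\<lambda>x. x * _"] cong: if_cong)

lemma det_dde_matrix_holomorphic: "(\<lambda>s. det (dde_matrix A G \<tau> s)) holomorphic_on S"
proof (rule holomorphic_on_det)
  show "(\<lambda>s. dde_matrix A G \<tau> s $ i $ j) holomorphic_on S" for i j
    by (cases "i = j") (auto simp: dde_matrix_def intro!: holomorphic_intros)
qed

lemma det_nonzero_iff_ker:
  fixes M :: "complex^'n^'n"
  shows "det M \<noteq> 0 \<longleftrightarrow> (\<forall>v. M *v v = 0 \<longrightarrow> v = 0)"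
  using invertible_det_nz[of M] matrix_left_invertible_ker[of M] invertible_left_inverse by blast

lemma norm_smult_vec: "norm (c *s (v :: complex^'n)) = norm c * norm v"
  by (simp add: norm_vec_def L2_set_def norm_mult power_mult_distrib sum_distrib_left[symmetric] real_sqrt_mult)

text \<open>On Re s >= -1 the delay factor is at most exp \<tau>, so s v dominates the other terms
  for large s. This confines the characteristic roots there to a disc and makes the resolvent
  O(1/|s|).\<close>

lemma dde_matrix_bound:
  fixes A G :: "complex^'n^'n"
  assumes "\<tau> \<ge> 0"
  shows "\<exists>R\<ge>1. \<forall>s v. Re s \<ge> - 1 \<longrightarrow> norm s * norm v \<le> norm (dde_matrix A G \<tau> s *v v) + R * norm v"
proof -
  obtain a where a: "a > 0" "\<And>v. norm (A *v v) \<le> a * norm v" using matrix_vector_bound by blast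
  obtain g where g: "g > 0" "\<And>v. norm (G *v v) \<le> g * norm v" using matrix_vector_bound by blast
  show ?thesis
  proof (intro exI[of _ "a + exp \<tau> * g + 1"] conjI allI impI)
    show "1 \<le> a + exp \<tau> * g + 1" using a g by (simp add: add_nonneg_nonneg)
    fix s :: complex and v :: "complex^'n" assume s: "Re s \<ge> - 1"
    have e: "norm (exp (- (s * complex_of_real \<tau>))) \<le> exp \<tau>"
      using mult_right_mono[OF s assms] by (simp add: norm_exp_eq_Re)
    have "s *s v = dde_matrix A G \<tau> s *v v + A *v v + exp (- (s * of_real \<tau>)) *s (G *v v)"
      unfolding dde_matrix_mult by simp
    then have "norm s * norm v \<le> norm (dde_matrix A G \<tau> s *v v) + norm (A *v v) + norm (exp (- (s * of_real \<tau>))) * norm (G *v v)"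
      unfolding norm_smult_vec[symmetric] by (metis norm_triangle_ineq norm_triangle_le add_right_mono)
    also have "\<dots> \<le> norm (dde_matrix A G \<tau> s *v v) + a * norm v + exp \<tau> * (g * norm v)"
      using a g e by (intro add_mono mult_mono) auto
    also have "\<dots> \<le> norm (dde_matrix A G \<tau> s *v v) + (a + exp \<tau> * g + 1) * norm v"
      by (simp add: algebra_simps)
    finally show "norm s * norm v \<le> norm (dde_matrix A G \<tau> s *v v) + (a + exp \<tau> * g + 1) * norm v" .
  qed
qed

text \<open>The roots with Re s >= -1 form a closed subset of a disc, so by compactness their
  largest real part is attained, and it is negative by assumption.\<close>

lemma dde_zero_free_strip:
  fixes A G :: "complex^'n^'n"
  assumes "\<tau> \<ge> 0" and nz: "\<And>s. Re s \<ge> 0 \<Longrightarrow> det (dde_matrix A G \<tau> s) \<noteq> 0"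
  obtains \<delta> where "\<delta> > 0" "\<And>s. Re s > - \<delta> \<Longrightarrow> det (dde_matrix A G \<tau> s) \<noteq> 0"
proof -
  obtain R where R: "R \<ge> 1" "\<forall>s v. Re s \<ge> - 1 \<longrightarrow> norm s * norm v \<le> norm (dde_matrix A G \<tau> s *v v) + R * norm v"
    using dde_matrix_bound[OF assms(1), of A G] by auto
  define Z where "Z = {s. det (dde_matrix A G \<tau> s) = 0} \<inter> ({s. Re s \<ge> - 1} \<inter> cball 0 R)"
  have inZ: "s \<in> Z" if "det (dde_matrix A G \<tau> s) = 0" "Re s \<ge> - 1" for s
  proof -
    have "\<not> (\<forall>v. dde_matrix A G \<tau> s *v v = 0 \<longrightarrow> v = 0)"
      unfolding det_nonzero_iff_ker[symmetric] using that(1) by simp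
    then obtain v where "v \<noteq> 0" "dde_matrix A G \<tau> s *v v = 0" by auto
    with R(2)[rule_format, OF that(2), of v] have "norm s \<le> R" by simp
    then show ?thesis using that by (simp add: Z_def)
  qed
  have "continuous_on UNIV (\<lambda>s. det (dde_matrix A G \<tau> s))"
    by (rule holomorphic_on_imp_continuous_on[OF det_dde_matrix_holomorphic])
  then have "closed {s. det (dde_matrix A G \<tau> s) = 0}"
    by (intro closed_Collect_eq continuous_on_const)
  then have cZ: "compact Z"
    unfolding Z_def by (intro closed_Int_compact compact_Int_closed closed_halfspace_Re_ge compact_cball)
      (auto simp: closed_Int_compact closed_halfspace_Re_ge)
  show thesis
  proof (cases "Z = {}")
    case True
    show thesis by (rule that[of 1]) (use inZ True in force)+
  next
    case False
    have "continuous_on Z Re" by (intro continuous_intros)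
    then obtain s0 where s0: "s0 \<in> Z" "\<And>s. s \<in> Z \<Longrightarrow> Re s \<le> Re s0"
      using continuous_attains_sup[OF cZ False] by blast
    have "Re s0 < 0" using s0(1) nz[of s0] by (auto simp: Z_def not_le[symmetric])
    show thesis
    proof (rule that[of "min 1 (- Re s0)"])
      show "0 < min 1 (- Re s0)" using \<open>Re s0 < 0\<close> by simp
      fix s assume s: "Re s > - min 1 (- Re s0)"
      show "det (dde_matrix A G \<tau> s) \<noteq> 0"
      proof
        assume "det (dde_matrix A G \<tau> s) = 0"
        then have "s \<in> Z" using inZ s by simp
        then show False using s0(2)[of s] s by simp
      qed
    qed
  qed
qed

section \<open>The transformed delay equation and the decay of its solutions\<close>

text \<open>Splitting the integral at \<tau> separates the initial history, whose contribution
  extends to an entire function of s, from exp (-s \<tau>) times the transform of the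
  solution.\<close>

lemma laplace_delay:
  fixes z :: "real \<Rightarrow> 'a::euclidean_space"
  assumes "\<tau> \<ge> 0" and cz: "continuous_on {-\<tau>..} z"
    and b1: "\<And>t. t \<ge> 0 \<Longrightarrow> norm (z t) \<le> C * exp (\<sigma> * t)"
    and b2: "\<And>t. t \<ge> 0 \<Longrightarrow> norm (z (t - \<tau>)) \<le> C * exp (\<sigma> * t)" and s: "s > \<sigma>"
  shows "laplace (\<lambda>t. z (t - \<tau>)) s =
     integral {0..\<tau>} (\<lambda>t. exp (- (s * t)) *\<^sub>R z (t - \<tau>))
     + exp (- (s * \<tau>)) *\<^sub>R laplace z s"
proof -
  let ?y = "\<lambda>t. exp (- (s * t)) *\<^sub>R z (t - \<tau>)"
  have cy: "continuous_on {0..} (\<lambda>t. z (t - \<tau>))"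
    using \<open>\<tau> \<ge> 0\<close> by (intro continuous_on_compose2[OF cz] continuous_intros) auto
  have i: "set_integrable lborel {0..} ?y"
    by (rule laplace_bounded_integrable[OF cy b2 s])
  have i1: "set_integrable lborel {0..\<tau>} ?y" by (rule set_integrable_subset[OF i]) auto
  have i2: "set_integrable lborel {\<tau>..} ?y" by (rule set_integrable_subset[OF i]) (use \<open>\<tau> \<ge> 0\<close> in auto)
  have "(LBINT t:{0..}. ?y t) = (LBINT t. indicator {0..\<tau>} t *\<^sub>R ?y t + indicator {\<tau>..} t *\<^sub>R ?y t)"
    unfolding set_lebesgue_integral_def
  proof (rule integral_cong_AE)
    show "(\<lambda>t. indicat_real {0..} t *\<^sub>R ?y t) \<in> borel_measurable lborel"
      using i unfolding set_integrable_def by (rule borel_measurable_integrable)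
    show "(\<lambda>t. indicat_real {0..\<tau>} t *\<^sub>R ?y t + indicat_real {\<tau>..} t *\<^sub>R ?y t) \<in> borel_measurable lborel"
      using i1 i2 unfolding set_integrable_def by (intro borel_measurable_add borel_measurable_integrable)
    show "AE t in lborel. indicat_real {0..} t *\<^sub>R ?y t = indicat_real {0..\<tau>} t *\<^sub>R ?y t + indicat_real {\<tau>..} t *\<^sub>R ?y t"
      using AE_lborel_singleton[of \<tau>] by eventually_elim (use \<open>\<tau> \<ge> 0\<close> in \<open>auto simp: indicator_def\<close>)
  qed
  also have "\<dots> = (LBINT t:{0..\<tau>}. ?y t) + (LBINT t:{\<tau>..}. ?y t)"
    using i1 i2 unfolding set_integrable_def set_lebesgue_integral_def by (rule Bochner_Integration.integral_add)
  also have "(LBINT t:{0..\<tau>}. ?y t) = integral {0..\<tau>} ?y"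
    by (rule set_borel_integral_eq_integral(2)[OF i1])
  also have "(LBINT t:{\<tau>..}. ?y t) = (LBINT t:{0..}. exp (- (s * \<tau>)) *\<^sub>R (exp (- (s * t)) *\<^sub>R z t))"
  proof -
    have "(LBINT t:{\<tau>..}. ?y t) = (LBINT t. indicator {\<tau>..} (\<tau> + t) *\<^sub>R ?y (\<tau> + t))"
      unfolding set_lebesgue_integral_def
      using lborel_integral_real_affine[of 1 "\<lambda>t. indicator {\<tau>..} t *\<^sub>R ?y t" \<tau>] by simp
    also have "\<dots> = (LBINT t. indicator {0..} t *\<^sub>R (exp (- (s * \<tau>)) *\<^sub>R (exp (- (s * t)) *\<^sub>R z t)))"
      by (intro Bochner_Integration.integral_cong) (auto simp: indicator_def exp_add[symmetric] algebra_simps)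
    finally show ?thesis by (simp add: set_lebesgue_integral_def)
  qed
  finally show ?thesis by (simp only: set_integral_scaleR_right)
qed

lemma matrix_vector_scaleR:
  fixes A :: "complex^'n^'m"
  shows "A *v (c *\<^sub>R x) = c *\<^sub>R (A *v x)"
  by (rule linear_cmul) (simp add: bounded_linear.linear)

lemma norm_vec_le_sum: "norm (v :: complex^'n) \<le> (\<Sum>i\<in>UNIV. norm (v $ i))"
  unfolding norm_vec_def by (rule L2_set_le_sum) auto

text \<open>Only real s beyond the growth rate occur, yet the right-hand side is written with
  complex exponentials: it is the restriction of a function holomorphic on a half plane reaching
  left of the imaginary axis, the \<open>b\<close> of \<open>dde_resolvent_decay\<close>.\<close>

lemma dde_laplace:
  fixes A G :: "complex^'n^'n" and z f :: "real \<Rightarrow> complex^'n"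
  assumes "\<tau> \<ge> 0" and cz: "continuous_on {-\<tau>..} z"
    and der: "\<And>t. t \<ge> 0 \<Longrightarrow> (z has_vector_derivative (A *v z t + G *v z (t - \<tau>) + f t)) (at t within {0..})"
    and cf: "continuous_on {0..} f"
    and b1: "\<And>t. t \<ge> 0 \<Longrightarrow> norm (z t) \<le> C * exp (\<sigma> * t)"
    and b2: "\<And>t. t \<ge> 0 \<Longrightarrow> norm (z (t - \<tau>)) \<le> C * exp (\<sigma> * t)"
    and b3: "\<And>t. t \<ge> 0 \<Longrightarrow> norm (A *v z t + G *v z (t - \<tau>) + f t) \<le> C * exp (\<sigma> * t)"
    and b4: "\<And>t. t \<ge> 0 \<Longrightarrow> norm (f t) \<le> Kf * exp (\<sigma> * t)"
    and s: "s > \<sigma>"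
  shows "dde_matrix A G \<tau> (of_real s) *v laplace z s
     = z 0 + G *v (\<chi> j. integral {0..\<tau>} (\<lambda>t. exp (- (of_real s * of_real t)) * z (t - \<tau>) $ j))
       + (\<chi> j. LBINT t:{0..}. exp (- (of_real s * of_real t)) * f t $ j)"
proof -
  let ?L = "\<lambda>g. laplace g s"
  have cz0: "continuous_on {0..} z" by (rule continuous_on_subset[OF cz]) (use \<open>\<tau> \<ge> 0\<close> in auto)
  have czd: "continuous_on {0..} (\<lambda>t. z (t - \<tau>))"
    using \<open>\<tau> \<ge> 0\<close> by (intro continuous_on_compose2[OF cz] continuous_intros) auto
  have iz: "set_integrable lborel {0..} (\<lambda>t. exp (- (s * t)) *\<^sub>R z t)"
    by (rule laplace_bounded_integrable[OF cz0 b1 s])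
  have iy: "set_integrable lborel {0..} (\<lambda>t. exp (- (s * t)) *\<^sub>R z (t - \<tau>))"
    by (rule laplace_bounded_integrable[OF czd b2 s])
  have ifs: "set_integrable lborel {0..} (\<lambda>t. exp (- (s * t)) *\<^sub>R f t)"
    by (rule laplace_bounded_integrable[OF cf b4 s])
  note iA = set_integral_bounded_linear[OF matrix_vector_mul_bounded_linear iz, of A]
  note iG = set_integral_bounded_linear[OF matrix_vector_mul_bounded_linear iy, of G]
  have "s *\<^sub>R ?L z - z 0 = ?L (\<lambda>t. A *v z t + G *v z (t - \<tau>) + f t)"
    by (rule laplace_derivative[OF der _ b1 b3 s, symmetric])
      (auto intro!: continuous_intros cz0 czd cf)
  also have "\<dots> = (LBINT t:{0..}. (A *v (exp (- (s * t)) *\<^sub>R z t) + G *v (exp (- (s * t)) *\<^sub>R z (t - \<tau>))) + exp (- (s * t)) *\<^sub>R f t)"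
    by (simp add: matrix_vector_scaleR scaleR_add_right)
  also have "\<dots> = A *v ?L z + G *v ?L (\<lambda>t. z (t - \<tau>)) + ?L f"
    unfolding set_integral_add(2)[OF set_integral_add(1)[OF iA(1) iG(1)] ifs] set_integral_add(2)[OF iA(1) iG(1)] iA(2) iG(2) ..
  also have "?L (\<lambda>t. z (t - \<tau>)) = integral {0..\<tau>} (\<lambda>t. exp (- (s * t)) *\<^sub>R z (t - \<tau>)) + exp (- (s * \<tau>)) *\<^sub>R ?L z"
    by (rule laplace_delay[OF \<open>\<tau> \<ge> 0\<close> cz b1 b2 s])
  finally have eq: "s *\<^sub>R ?L z - A *v ?L z - exp (- (s * \<tau>)) *\<^sub>R (G *v ?L z)
     = z 0 + G *v integral {0..\<tau>} (\<lambda>t. exp (- (s * t)) *\<^sub>R z (t - \<tau>)) + ?L f"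
    by (simp add: matrix_vector_right_distrib matrix_vector_scaleR algebra_simps)
  have e: "exp (- (complex_of_real s * complex_of_real t)) = complex_of_real (exp (- (s * t)))" for t
    by (simp add: exp_of_real[symmetric])
  have sc: "complex_of_real c *s v = c *\<^sub>R v" for c and v :: "complex^'n"
    by (simp add: vec_eq_iff scaleR_conv_of_real[of c "v $ _"])
  have h: "(\<chi> j. integral {0..\<tau>} (\<lambda>t. exp (- (of_real s * of_real t)) * z (t - \<tau>) $ j))
     = integral {0..\<tau>} (\<lambda>t. exp (- (s * t)) *\<^sub>R z (t - \<tau>))"
  proof -
    have "integral {0..\<tau>} (\<lambda>t. (exp (- (s * t)) *\<^sub>R z (t - \<tau>)) $ j) = integral {0..\<tau>} (\<lambda>t. exp (- (s * t)) *\<^sub>R z (t - \<tau>)) $ j" for j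
    proof -
      have "(\<lambda>t. exp (- (s * t)) *\<^sub>R z (t - \<tau>)) integrable_on {0..\<tau>}"
        by (intro integrable_continuous_real continuous_intros continuous_on_subset[OF czd]) auto
      from integral_linear[OF this bounded_linear_vec_nth[of j]] show ?thesis by (simp add: o_def)
    qed
    then show ?thesis unfolding e by (simp add: vec_eq_iff scaleR_conv_of_real[where 'a=complex, symmetric])
  qed
  have F: "(\<chi> j. LBINT t:{0..}. exp (- (of_real s * of_real t)) * f t $ j) = ?L f"
    using set_integral_bounded_linear(2)[OF bounded_linear_vec_nth ifs]
    unfolding e by (simp add: vec_eq_iff scaleR_conv_of_real[where 'a=complex, symmetric])
  show ?thesis
    unfolding h F unfolding dde_matrix_mult e sc by (rule eq)
qed

text \<open>Cramer's rule makes the solution of the characteristic system holomorphic wherever the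
  determinant is nonzero. The solution is O(1/|s|), and the factor 1/(s + 1) of the filter supplies
  the second power.\<close>

lemma dde_resolvent_decay:
  fixes A G :: "complex^'n^'n" and b :: "complex \<Rightarrow> complex^'n"
  assumes "\<tau> \<ge> 0" and nz: "\<And>s. Re s \<ge> 0 \<Longrightarrow> det (dde_matrix A G \<tau> s) \<noteq> 0" and "\<gamma> > 0"
    and bhol: "\<And>i. (\<lambda>s. b s $ i) holomorphic_on {s. Re s > - \<gamma>}"
    and bb: "\<And>s. Re s > - \<gamma> \<Longrightarrow> norm (b s) \<le> b0"
  obtains \<delta> M H where "\<delta> > 0" "\<delta> < 1"
    "\<And>k. H k holomorphic_on {s. Re s > - \<delta>}" "\<And>k s. Re s > - \<delta> \<Longrightarrow> norm (H k s) \<le> M / (1 + (norm s)\<^sup>2)"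
    "\<And>s v k. Re s > - \<delta> \<Longrightarrow> dde_matrix A G \<tau> s *v v = b s \<Longrightarrow> H k s = v $ k / (s + 1)"
proof -
  obtain \<delta>0 where \<delta>0: "\<delta>0 > 0" "\<And>s. Re s > - \<delta>0 \<Longrightarrow> det (dde_matrix A G \<tau> s) \<noteq> 0"
    using dde_zero_free_strip[OF assms(1) nz] by auto
  obtain R where R: "R \<ge> 1" "\<forall>s v. Re s \<ge> - 1 \<longrightarrow> norm s * norm v \<le> norm (dde_matrix A G \<tau> s *v v) + R * norm v"
    using dde_matrix_bound[OF assms(1), of A G] by auto
  \<comment> \<open>Halving puts the closed half plane Re s >= -\<delta> inside the domain of
    holomorphy, which the compactness argument on \<open>K\<close> uses; |s + 1| stays above
    1/2.\<close>
  define \<delta> where "\<delta> = min (1/2) (min \<delta>0 \<gamma>) / 2"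
  have \<delta>: "\<delta> > 0" "\<delta> < 1/2" "\<delta> < \<delta>0" "\<delta> < \<gamma>" using \<delta>0 \<open>\<gamma> > 0\<close> by (auto simp: \<delta>_def)
  define \<eta> where "\<eta> = min \<delta>0 \<gamma>"
  have \<eta>: "\<delta> < \<eta>" using \<delta> by (auto simp: \<eta>_def)
  have b0: "b0 \<ge> 0" using order_trans[OF norm_ge_zero bb[of 0]] \<open>\<gamma> > 0\<close> by simp
  define Z where "Z = (\<lambda>s. \<chi> k. det (\<chi> i j. if j = k then b s $ i else dde_matrix A G \<tau> s $ i $ j) / det (dde_matrix A G \<tau> s))"
  have Z: "dde_matrix A G \<tau> s *v v = b s \<longleftrightarrow> v = Z s" if "Re s > - \<eta>" for s v
    unfolding Z_def by (rule cramer) (use \<delta>0(2) that in \<open>auto simp: \<eta>_def\<close>)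
  have Zhol: "(\<lambda>s. Z s $ k) holomorphic_on {s. Re s > - \<eta>}" for k
  proof -
    have m: "(\<lambda>s. (\<chi> i j. if j = k then b s $ i else dde_matrix A G \<tau> s $ i $ j) $ i $ j) holomorphic_on {s. Re s > - \<eta>}" for i j
    proof (cases "j = k")
      case True
      then show ?thesis using bhol[of i] by (auto simp: \<eta>_def intro: holomorphic_on_subset)
    next
      case False
      then show ?thesis by (cases "i = j") (auto simp: dde_matrix_def intro!: holomorphic_intros)
    qed
    have "(\<lambda>s. det (\<chi> i j. if j = k then b s $ i else dde_matrix A G \<tau> s $ i $ j) / det (dde_matrix A G \<tau> s)) holomorphic_on {s. Re s > - \<eta>}"
      by (intro holomorphic_on_divide holomorphic_on_det m det_dde_matrix_holomorphic)
        (use \<delta>0(2) in \<open>auto simp: \<eta>_def\<close>)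
    then show ?thesis by (simp add: Z_def)
  qed
  define K where "K = {s. Re s \<ge> - \<delta>} \<inter> cball 0 (2 * R)"
  have "compact K" unfolding K_def by (intro closed_Int_compact closed_halfspace_Re_ge compact_cball)
  moreover have contZ: "continuous_on K Z"
  proof -
    have "continuous_on K (\<lambda>s. \<chi> k. Z s $ k)"
      by (intro continuous_on_vec_lambda continuous_on_subset[OF holomorphic_on_imp_continuous_on[OF Zhol]])
        (use \<eta> in \<open>auto simp: K_def\<close>)
    then show ?thesis by simp
  qed
  ultimately have "bounded (Z ` K)" by (intro compact_imp_bounded compact_continuous_image)
  then obtain B where B: "\<And>s. s \<in> K \<Longrightarrow> norm (Z s) \<le> B" unfolding bounded_iff by auto
  have B0: "B \<ge> 0"
    using order_trans[OF norm_ge_zero B[of 0]] \<delta> R by (simp add: K_def)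
  \<comment> \<open>For |s| <= 2R the quotient is at most 2B, beyond that at most 4 b0 / |s|^2;
    \<open>M\<close> covers both over the denominator 1 + |s|^2.\<close>
  define M where "M = 8 * b0 + 2 * B * (1 + (2 * R)\<^sup>2)"
  have den: "norm (s + 1) \<ge> 1/2" if "Re s > - \<delta>" for s
    using that \<delta> complex_Re_le_cmod[of "s + 1"] by simp
  show thesis
  proof (rule that[of \<delta> "\<lambda>k s. Z s $ k / (s + 1)" M])
    show "\<delta> > 0" "\<delta> < 1" using \<delta> by auto
    show "(\<lambda>s. Z s $ k / (s + 1)) holomorphic_on {s. Re s > - \<delta>}" for k
    proof (intro holomorphic_on_divide)
      show "(\<lambda>s. Z s $ k) holomorphic_on {s. Re s > - \<delta>}"
        by (rule holomorphic_on_subset[OF Zhol]) (use \<eta> in auto)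
      show "s + 1 \<noteq> 0" if "s \<in> {s. Re s > - \<delta>}" for s using den[of s] that by auto
    qed (intro holomorphic_intros)
    show "Z s $ k / (s + 1) = v $ k / (s + 1)" if "Re s > - \<delta>" "dde_matrix A G \<tau> s *v v = b s" for s v k
      using Z[of s v] that \<eta> by simp
    fix k s assume s: "Re s > - \<delta>"
    have Zk: "norm (Z s $ k / (s + 1)) \<le> norm (Z s) / norm (s + 1)"
      unfolding norm_divide by (intro divide_right_mono Finite_Cartesian_Product.norm_nth_le) auto
    have pos: "0 < 1 + (norm s)\<^sup>2" by (rule add_pos_nonneg) auto
    show "norm (Z s $ k / (s + 1)) \<le> M / (1 + (norm s)\<^sup>2)"
    proof (cases "norm s \<le> 2 * R")
      case True
      then have "norm (Z s) \<le> B" using s by (intro B) (auto simp: K_def)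
      then have "norm (Z s) / norm (s + 1) \<le> B / (1/2)"
        using den[OF s] B0 by (intro frac_le) auto
      also have "\<dots> = (2 * B * (1 + (norm s)\<^sup>2)) / (1 + (norm s)\<^sup>2)" using pos by simp
      also have "\<dots> \<le> M / (1 + (norm s)\<^sup>2)"
      proof (rule divide_right_mono)
        have "2 * B * (1 + (norm s)\<^sup>2) \<le> 2 * B * (1 + (2 * R)\<^sup>2)"
          using True B0 by (intro mult_left_mono add_left_mono power_mono) auto
        then show "2 * B * (1 + (norm s)\<^sup>2) \<le> M" using b0 by (simp add: M_def)
      qed (use pos in simp)
      finally show ?thesis using Zk by simp
    next
      case False
      have big: "norm s > 2 * R" "norm s > 2" using False R by auto
      have "dde_matrix A G \<tau> s *v Z s = b s" using Z[of s "Z s"] s \<eta> by simp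
      then have "norm s * norm (Z s) \<le> b0 + R * norm (Z s)"
        using R(2)[rule_format, of s "Z s"] s \<delta> bb[of s] by simp
      also have "R * norm (Z s) \<le> norm s / 2 * norm (Z s)" using big by (intro mult_right_mono) auto
      finally have "norm (Z s) * norm s \<le> 2 * b0" by (simp add: algebra_simps)
      then have Zb: "norm (Z s) \<le> 2 * b0 / norm s" using big
        by (subst pos_le_divide_eq) auto
      have s1: "norm (s + 1) \<ge> norm s / 2"
        using norm_triangle_ineq4[of "s + 1" 1] big by simp
      have "norm (Z s) / norm (s + 1) \<le> (2 * b0 / norm s) / (norm s / 2)"
        using Zb s1 big b0 by (intro frac_le) auto
      also have "\<dots> = 4 * b0 / (norm s)\<^sup>2" by (simp add: power2_eq_square)
      also have "\<dots> \<le> (8 * b0) / (1 + (norm s)\<^sup>2)"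
      proof -
        have "1 \<le> (norm s)\<^sup>2" using big by (simp add: power_le_one_iff)
        then have "b0 * 1 \<le> b0 * (norm s)\<^sup>2" using b0 by (intro mult_left_mono)
        then have "4 * b0 * (1 + (norm s)\<^sup>2) \<le> 8 * b0 * (norm s)\<^sup>2" by (simp add: algebra_simps)
        moreover have "0 < (norm s)\<^sup>2" using big by (intro zero_less_power) linarith
        ultimately show ?thesis using pos by (simp add: pos_le_divide_eq pos_divide_le_eq)
      qed
      also have "\<dots> \<le> M / (1 + (norm s)\<^sup>2)"
        using B0 pos by (intro divide_right_mono) (auto simp: M_def intro!: mult_nonneg_nonneg add_nonneg_nonneg)
      finally show ?thesis using Zk by simp
    qed
  qed
qed

lemma tendsto_zero_of_derivative_minus:
  fixes p :: "real \<Rightarrow> 'a::real_normed_vector"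
  assumes "\<And>t. t \<ge> 0 \<Longrightarrow> (p has_vector_derivative - p t) (at t within {0..})"
  shows "(p \<longlongrightarrow> 0) at_top"
proof (rule tendsto_zero_of_exp_bound)
  show "norm (p t) \<le> norm (p 0) * exp (- (1 * t))" if "t \<ge> 0" for t
    using first_order_filter_bound[of p "\<lambda>t. 0" 0 0 t] assms that by simp
qed simp

theorem dde_tendsto_zero:
  fixes A G :: "complex^'n^'n" and z f :: "real \<Rightarrow> complex^'n"
  assumes \<tau>: "\<tau> \<ge> 0" and cz: "continuous_on {-\<tau>..} z"
    and der: "\<And>t. t \<ge> 0 \<Longrightarrow> (z has_vector_derivative (A *v z t + G *v z (t - \<tau>) + f t)) (at t within {0..})"
    and cf: "continuous_on {0..} f" and fb: "\<And>t. t \<ge> 0 \<Longrightarrow> norm (f t) \<le> Kf * exp (- (\<gamma> * t))" and \<gamma>: "\<gamma> > 0"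
    and nz: "\<And>s. Re s \<ge> 0 \<Longrightarrow> det (dde_matrix A G \<tau> s) \<noteq> 0"
  shows "(z \<longlongrightarrow> 0) at_top"
proof -
  have Kf: "Kf \<ge> 0" using order_trans[OF norm_ge_zero fb[of 0]] by simp
  have fK: "norm (f t) \<le> Kf" if "t \<ge> 0" for t
    using fb[OF that] Kf \<gamma> that mult_left_mono[of "exp (- (\<gamma> * t))" 1 Kf] by simp
  obtain C \<sigma> where C: "C \<ge> 0" "\<sigma> > 0" and b1: "\<And>t. t \<ge> 0 \<Longrightarrow> norm (z t) \<le> C * exp (\<sigma> * t)"
    and b2: "\<And>t. t \<ge> 0 \<Longrightarrow> norm (z (t - \<tau>)) \<le> C * exp (\<sigma> * t)"
    and b3: "\<And>t. t \<ge> 0 \<Longrightarrow> norm (A *v z t + G *v z (t - \<tau>) + f t) \<le> C * exp (\<sigma> * t)"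
    using dde_exp_bounded[OF \<tau> cz der fK] by metis
  have b4: "norm (f t) \<le> Kf * exp (\<sigma> * t)" if "t \<ge> 0" for t
    using fK[OF that] Kf C that mult_left_mono[of 1 "exp (\<sigma> * t)" Kf] by simp
  have cz0: "continuous_on {0..} z" by (rule continuous_on_subset[OF cz]) (use \<tau> in auto)
  have czd: "continuous_on {0..} (\<lambda>t. z (t - \<tau>))"
    using \<tau> by (intro continuous_on_compose2[OF cz] continuous_intros) auto
  \<comment> \<open>Strictly below \<gamma> for a uniform bound on the transform of
    \<open>f\<close>; at most 1 so that exp (-s t) is bounded by exp \<tau> on the history
    interval.\<close>
  define \<gamma>' where "\<gamma>' = min (\<gamma> / 2) 1"
  have \<gamma>': "\<gamma>' > 0" "\<gamma>' < \<gamma>" "\<gamma>' \<le> 1" using \<gamma> by (auto simp: \<gamma>'_def)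
  define hist where "hist = (\<lambda>j s. integral {0..\<tau>} (\<lambda>t. exp (- (s * of_real t)) * z (t - \<tau>) $ j))"
  define F where "F = (\<lambda>j s. LBINT t:{0..}. exp (- (s * of_real t)) * f t $ j)"
  define b where "b = (\<lambda>s. z 0 + G *v (\<chi> j. hist j s) + (\<chi> j. F j s))"
  have cfj: "continuous_on {0..} (\<lambda>t. f t $ j)" for j by (intro continuous_intros cf)
  have fbj: "norm (f t $ j) \<le> Kf * exp (- (\<gamma> * t))" if "t \<ge> 0" for t j
    using fb[OF that] Finite_Cartesian_Product.norm_nth_le[of "f t" j] by linarith
  have Fhol: "F j holomorphic_on {s. Re s > - \<gamma>'}" for j
    unfolding F_def by (rule holomorphic_on_subset[OF laplace_holomorphic(1)[OF cfj fbj]]) (use \<gamma>' in auto)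
  have czj: "continuous_on {0..\<tau>} (\<lambda>t. z (t - \<tau>) $ j)" for j
    by (intro continuous_intros continuous_on_subset[OF czd]) auto
  have hhol: "hist j holomorphic_on S" for j S
    unfolding hist_def using finite_laplace_holomorphic[OF czj] by (rule holomorphic_on_subset) auto
  have bhol: "(\<lambda>s. b s $ i) holomorphic_on {s. Re s > - \<gamma>'}" for i
    unfolding b_def by (simp add: matrix_vector_mult_def) (intro holomorphic_intros Fhol hhol)
  have "bounded ((\<lambda>t. z (t - \<tau>)) ` {0..\<tau>})"
    by (intro compact_imp_bounded compact_continuous_image continuous_on_subset[OF czd]) auto
  then obtain h where h: "\<And>t. t \<in> {0..\<tau>} \<Longrightarrow> norm (z (t - \<tau>)) \<le> h" unfolding bounded_iff by blast
  have h0: "h \<ge> 0" using order_trans[OF norm_ge_zero h[of 0]] \<tau> by simp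
  have histb: "norm (hist j s) \<le> exp \<tau> * h * (\<tau> - 0)" if s: "Re s > - \<gamma>'" for j s
    unfolding hist_def
  proof (rule integral_bound[OF \<tau>])
    show "continuous_on {0..\<tau>} (\<lambda>t. exp (- (s * of_real t)) * z (t - \<tau>) $ j)"
      by (intro continuous_intros czj)
    fix t assume t: "t \<in> {0..\<tau>}"
    have "- Re s * t \<le> 1 * \<tau>" using s \<gamma>' t by (intro mult_mono) auto
    then have "exp (- (Re s * t)) \<le> exp \<tau>" by simp
    moreover have "norm (z (t - \<tau>) $ j) \<le> h"
      using h[OF t] Finite_Cartesian_Product.norm_nth_le[of "z (t - \<tau>)" j] by linarith
    ultimately show "norm (exp (- (s * of_real t)) * z (t - \<tau>) $ j) \<le> exp \<tau> * h"
      unfolding norm_mult norm_exp_eq_Re by (intro mult_mono) auto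
  qed
  have Fb: "norm (F j s) \<le> Kf / (\<gamma> - \<gamma>')" if s: "Re s > - \<gamma>'" for j s
    unfolding F_def by (rule laplace_holomorphic(2)[OF cfj fbj]) (use \<gamma>' s in auto)
  obtain g where g: "g > 0" "\<And>v. norm (G *v v) \<le> g * norm v" using matrix_vector_bound by blast
  define b0 where "b0 = norm (z 0) + g * (\<Sum>j\<in>(UNIV::'n set). exp \<tau> * h * (\<tau> - 0)) + (\<Sum>j\<in>(UNIV::'n set). Kf / (\<gamma> - \<gamma>'))"
  have bb: "norm (b s) \<le> b0" if s: "Re s > - \<gamma>'" for s
  proof -
    have 1: "norm (\<chi> j. hist j s) \<le> (\<Sum>j\<in>(UNIV::'n set). exp \<tau> * h * (\<tau> - 0))"
      using histb[OF s] by (intro order_trans[OF norm_vec_le_sum] sum_mono) simp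
    have 2: "norm (\<chi> j. F j s) \<le> (\<Sum>j\<in>(UNIV::'n set). Kf / (\<gamma> - \<gamma>'))"
      using Fb[OF s] by (intro order_trans[OF norm_vec_le_sum] sum_mono) simp
    have "norm (b s) \<le> norm (z 0) + norm (G *v (\<chi> j. hist j s)) + norm (\<chi> j. F j s)"
      unfolding b_def by (intro norm_triangle_le add_right_mono norm_triangle_ineq)
    also have "\<dots> \<le> b0"
      unfolding b0_def using 1 2 g by (intro add_mono order_trans[OF g(2)] mult_left_mono) auto
    finally show ?thesis .
  qed
  obtain \<delta> M H where \<delta>: "\<delta> > 0" "\<delta> < 1"
    and Hhol: "\<And>k. H k holomorphic_on {s. Re s > - \<delta>}"
    and Hb: "\<And>k s. Re s > - \<delta> \<Longrightarrow> norm (H k s) \<le> M / (1 + (norm s)\<^sup>2)"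
    and H: "\<And>s v k. Re s > - \<delta> \<Longrightarrow> dde_matrix A G \<tau> s *v v = b s \<Longrightarrow> H k s = v $ k / (s + 1)"
    using dde_resolvent_decay[OF \<tau> nz \<gamma>'(1) bhol bb] by metis
  \<comment> \<open>Filters of the solution, the delayed solution and the forcing; the start at 0
    makes the transform of \<open>w\<close> exactly that of \<open>z\<close> divided by s +
    1.\<close>
  obtain w where w0: "w 0 = 0" and w: "\<And>t. t \<ge> 0 \<Longrightarrow> (w has_vector_derivative (z t - w t)) (at t within {0..})"
    using first_order_filter_exists[OF cz0] by metis
  obtain v where v0: "v 0 = 0" and v: "\<And>t. t \<ge> 0 \<Longrightarrow> (v has_vector_derivative (z (t - \<tau>) - v t)) (at t within {0..})"
    using first_order_filter_exists[OF czd] by metis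
  obtain \<phi> where \<phi>0: "\<phi> 0 = 0" and \<phi>: "\<And>t. t \<ge> 0 \<Longrightarrow> (\<phi> has_vector_derivative (f t - \<phi> t)) (at t within {0..})"
    using first_order_filter_exists[OF cf] by metis
  have wb: "norm (w t) \<le> C * exp (\<sigma> * t)" if "t \<ge> 0" for t
  proof -
    have "norm (w t) \<le> C / (\<sigma> + 1) * exp (\<sigma> * t)"
      using first_order_filter_bound[OF w b1 _ that] C w0 by simp
    also have "\<dots> \<le> C * exp (\<sigma> * t)"
      using C by (intro mult_right_mono) (auto simp: field_simps)
    finally show ?thesis .
  qed
  have cw: "continuous_on {0..} w"
    by (rule continuous_on_vector_derivative) (use w in auto)
  have zwb: "norm (z t - w t) \<le> (C + C) * exp (\<sigma> * t)" if "t \<ge> 0" for t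
    using b1[OF that] wb[OF that] norm_triangle_ineq4[of "z t" "w t"] by (simp add: algebra_simps)
  have wlim: "((\<lambda>t. w t $ k) \<longlongrightarrow> 0) at_top" for k
  proof -
    have "\<exists>K. \<forall>t\<ge>0. norm (w t $ k) \<le> K * exp (- (\<delta> / 2) * t)"
    proof (rule laplace_decay[OF Hhol[of k] Hb])
      show "continuous_on {0..} (\<lambda>t. w t $ k)" by (intro continuous_intros cw)
      show "norm (w t $ k) \<le> C * exp (\<sigma> * t)" if "t \<ge> 0" for t
        using wb[OF that] Finite_Cartesian_Product.norm_nth_le[of "w t" k] by linarith
      fix s assume s: "s > \<sigma>"
      have iw: "set_integrable lborel {0..} (\<lambda>t. exp (- (s * t)) *\<^sub>R w t)"
        by (rule laplace_bounded_integrable[OF cw wb s])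
      have iz: "set_integrable lborel {0..} (\<lambda>t. exp (- (s * t)) *\<^sub>R z t)"
        by (rule laplace_bounded_integrable[OF cz0 b1 s])
      let ?L = "\<lambda>g. laplace g s"
      have "?L (\<lambda>t. z t - w t) = s *\<^sub>R ?L w - w 0"
        by (rule laplace_derivative[OF w _ wb zwb s]) (auto intro!: continuous_intros cz0 cw)
      moreover have "?L (\<lambda>t. z t - w t) = ?L z - ?L w"
        unfolding scaleR_diff_right by (rule set_integral_diff(2)[OF iz iw])
      ultimately have "?L z = (s + 1) *\<^sub>R ?L w" by (simp add: w0 algebra_simps)
      then have "?L z $ k = (s + 1) *\<^sub>R (?L w $ k)" by simp
      then have k: "?L z $ k = (of_real s + 1) * ?L w $ k"
        by (simp only: scaleR_conv_of_real of_real_add of_real_1)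
      have ne: "complex_of_real s + 1 \<noteq> 0" using s C by (auto simp: complex_eq_iff)
      have "dde_matrix A G \<tau> (of_real s) *v ?L z = b (of_real s)"
        unfolding b_def hist_def F_def by (rule dde_laplace[OF \<tau> cz der cf b1 b2 b3 b4 s])
      then have "H k (of_real s) = ?L z $ k / (of_real s + 1)"
        using s C \<delta> by (intro H) auto
      then have "H k (of_real s) = ?L w $ k" using k ne by simp
      also have "\<dots> = laplace (\<lambda>t. w t $ k) s"
        using set_integral_bounded_linear(2)[OF bounded_linear_vec_nth iw, of k] by simp
      finally show "laplace (\<lambda>t. w t $ k) s = H k (of_real s)" ..
    qed (use \<delta> in auto)
    then obtain K where "\<And>t. t \<ge> 0 \<Longrightarrow> norm (w t $ k) \<le> K * exp (- (\<delta> / 2 * t))" by auto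
    then show ?thesis by (rule tendsto_zero_of_exp_bound) (use \<delta> in auto)
  qed
  have wl: "(w \<longlongrightarrow> 0) at_top"
    by (rule vec_tendstoI) (use wlim in auto)
  \<comment> \<open>Advanced by \<tau>, \<open>v\<close> solves the same filter equation with input
    \<open>z\<close> as \<open>w\<close>, so the difference solves p' = -p.\<close>
  have "((\<lambda>t. v (t + \<tau>) - w t) \<longlongrightarrow> 0) at_top"
  proof (rule tendsto_zero_of_derivative_minus)
    fix t :: real assume t: "t \<ge> 0"
    have "((\<lambda>t. v (t + \<tau>)) has_vector_derivative (z (t + \<tau> - \<tau>) - v (t + \<tau>))) (at t within {0..})"
      by (rule has_vector_derivative_shift[OF v \<tau>]) (use t \<tau> in simp)
    from has_vector_derivative_diff[OF this w[OF t]]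
    show "((\<lambda>t. v (t + \<tau>) - w t) has_vector_derivative - (v (t + \<tau>) - w t)) (at t within {0..})"
      by simp
  qed
  from tendsto_add[OF this wl] have "((\<lambda>t. v (t + \<tau>)) \<longlongrightarrow> 0) at_top" by simp
  then have vl: "(v \<longlongrightarrow> 0) at_top" by (rule tendsto_at_top_unshift)
  have \<phi>l: "(\<phi> \<longlongrightarrow> 0) at_top"
  proof (rule tendsto_zero_of_exp_bound)
    \<comment> \<open>The filter bound requires an exponent above -1.\<close>
    define \<gamma>2 where "\<gamma>2 = min \<gamma> (1/2)"
    have fb2: "norm (f t) \<le> Kf * exp ((- \<gamma>2) * t)" if "t \<ge> 0" for t
    proof -
      have "exp (- (\<gamma> * t)) \<le> exp ((- \<gamma>2) * t)"
        using that mult_right_mono[of \<gamma>2 \<gamma> t] by (simp add: \<gamma>2_def)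
      then show ?thesis using fb[OF that] Kf mult_left_mono by (meson order_trans)
    qed
    show "norm (\<phi> t) \<le> Kf / (- \<gamma>2 + 1) * exp (- (\<gamma>2 * t))" if "t \<ge> 0" for t
      using first_order_filter_bound[OF \<phi> fb2 _ that] \<phi>0 by (simp add: \<gamma>2_def)
    show "\<gamma>2 > 0" using \<gamma> by (simp add: \<gamma>2_def)
  qed
  have bl: "bounded_linear ((*v) X)" for X :: "complex^'n^'n" by simp
  have mder: "((\<lambda>t. X *v y t) has_vector_derivative X *v y') (at t within {0..})"
    if "(y has_vector_derivative y') (at t within {0..})" for X :: "complex^'n^'n" and y y' t
    using bounded_linear.has_vector_derivative[OF bl that] .
  \<comment> \<open>In the derivative of \<open>?q\<close> the terms A z, G z(t - \<tau>) and f
    cancel and -\<open>?q\<close> remains, so \<open>z\<close> inherits the limit 0 from the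
    filtered functions.\<close>
  let ?q = "\<lambda>t. z t - A *v w t - G *v v t - \<phi> t - w t"
  have "(?q \<longlongrightarrow> 0) at_top"
  proof (rule tendsto_zero_of_derivative_minus)
    fix t :: real assume t: "t \<ge> 0"
    show "(?q has_vector_derivative - ?q t) (at t within {0..})"
      by (rule has_vector_derivative_eq_rhs,
        (rule has_vector_derivative_diff der[OF t] mder w[OF t] v[OF t] \<phi>[OF t])+)
        (simp add: matrix_vector_mult_diff_distrib)
  qed
  moreover have "((\<lambda>t. A *v w t) \<longlongrightarrow> 0) at_top"
    using bounded_linear.tendsto[OF bl wl] by simp
  moreover have "((\<lambda>t. G *v v t) \<longlongrightarrow> 0) at_top"
    using bounded_linear.tendsto[OF bl vl] by simp
  ultimately have "((\<lambda>t. ?q t + A *v w t + G *v v t + \<phi> t + w t) \<longlongrightarrow> 0 + 0 + 0 + 0 + 0) at_top"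
    by (intro tendsto_add wl \<phi>l)
  then show ?thesis by simp
qed

section \<open>Eigenvalues and annihilating polynomials\<close>

text \<open>Dependence is a property of the set of values, so a repeated value is treated apart;
  there the relation is x i - x j = 0.\<close>

lemma exists_linear_relation:
  fixes x :: "nat \<Rightarrow> 'a::euclidean_space"
  obtains c :: "nat \<Rightarrow> real" where "\<exists>k\<le>DIM('a). c k \<noteq> 0" "(\<Sum>k\<le>DIM('a). c k *\<^sub>R x k) = 0"
proof (cases "inj_on x {..DIM('a)}")
  case True
  have "dependent (x ` {..DIM('a)})"
    by (rule dependent_biggerset) (simp add: card_image[OF True])
  then obtain u where u: "(\<Sum>v\<in>x ` {..DIM('a)}. u v *\<^sub>R v) = 0" "\<exists>v\<in>x ` {..DIM('a)}. u v \<noteq> 0"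
    using dependent_finite[of "x ` {..DIM('a)}"] by auto
  show ?thesis
    by (rule that[of "\<lambda>k. u (x k)"]) (use u True in \<open>auto simp: sum.reindex\<close>)
next
  case False
  then obtain i j where ij: "i \<le> DIM('a)" "j \<le> DIM('a)" "i \<noteq> j" "x i = x j"
    by (auto simp: inj_on_def)
  show ?thesis
  proof (rule that[of "\<lambda>k. (if k = i then 1 else 0) - (if k = j then 1 else 0)"])
    show "\<exists>k\<le>DIM('a). (if k = i then 1 else 0) - (if k = j then 1 else 0) \<noteq> (0::real)"
      using ij by (intro exI[of _ i]) auto
    show "(\<Sum>k\<le>DIM('a). ((if k = i then 1 else 0) - (if k = j then 1 else 0)) *\<^sub>R x k) = 0"
      using ij by (simp add: scaleR_left_diff_distrib sum_subtractf if_distrib[of "\<lambda>c. c *\<^sub>R _"] cong: if_cong)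
  qed
qed

text \<open>Horner's scheme for p(A) v; its recursion over \<open>pCons\<close> drives the
  inductions on polynomials below.\<close>

definition poly_mat :: "complex^'n^'n \<Rightarrow> complex poly \<Rightarrow> complex^'n \<Rightarrow> complex^'n" where
  "poly_mat A p v = fold_coeffs (\<lambda>a x. a *s v + A *v x) p 0"

lemma poly_mat_0 [simp]: "poly_mat A 0 v = 0"
  by (simp add: poly_mat_def)

lemma poly_mat_pCons [simp]: "poly_mat A (pCons a p) v = a *s v + A *v poly_mat A p v"
  by (cases "p = 0 \<and> a = 0") (auto simp: poly_mat_def)

lemma poly_mat_add: "poly_mat A (p + q) v = poly_mat A p v + poly_mat A q v"
  by (induction p q rule: poly_induct2)
    (simp_all add: vector_sadd_rdistrib matrix_vector_right_distrib algebra_simps)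

lemma poly_mat_smult: "poly_mat A (smult c p) v = c *s poly_mat A p v"
  by (induction p) (simp_all add: vector_scalar_commute vector_add_ldistrib)

lemma poly_mat_mult: "poly_mat A (p * q) v = poly_mat A p (poly_mat A q v)"
  by (induction p) (simp_all add: poly_mat_add poly_mat_smult)

lemma poly_mat_sum: "poly_mat A (\<Sum>k\<in>S. p k) v = (\<Sum>k\<in>S. poly_mat A (p k) v)"
  by (induction S rule: infinite_finite_induct) (simp_all add: poly_mat_add)

lemma poly_mat_monom: "poly_mat A (monom c k) v = c *s ((((*v) A) ^^ k) v)"
  by (induction k) (simp_all add: monom_0 monom_Suc vector_scalar_commute)

lemma foldr_eq_poly_mat:
  "foldr (\<lambda>l x. A *v x - l *s x) ls v = poly_mat A (\<Prod>l\<leftarrow>ls. [:- l, 1:]) v"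
  by (induction ls) (simp_all add: poly_mat_mult one_pCons del: mult_pCons_left)

lemma matrix_sum_vector_mult: "(\<Sum>k\<in>S. X k) *v v = (\<Sum>k\<in>S. X k *v v)"
  by (induction S rule: infinite_finite_induct) (simp_all add: matrix_vector_mult_add_rdistrib)

text \<open>All factors are polynomials in A and commute, so any one of them can be moved past the
  others.\<close>

lemma foldr_shift_commute:
  fixes A :: "complex^'n^'n"
  shows "foldr (\<lambda>l x. A *v x - l *s x) ls (A *v w - k *s w)
    = A *v foldr (\<lambda>l x. A *v x - l *s x) ls w - k *s foldr (\<lambda>l x. A *v x - l *s x) ls w"
proof (induction ls)
  case (Cons l ls)
  have "A *v (A *v u - k *s u) - l *s (A *v u - k *s u) = A *v (A *v u - l *s u) - k *s (A *v u - l *s u)" for u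
    by (simp add: matrix_vector_mult_diff_distrib vector_scalar_commute vector_ssub_ldistrib mult.commute)
  then show ?case using Cons by simp
qed simp

text \<open>Factors of an annihilating polynomial at scalars that are not eigenvalues are invertible and can be dropped.\<close>
lemma annihilating_eigenvalue_list:
  fixes A :: "complex^'n^'n"
  obtains ls where "\<And>l. l \<in> set ls \<Longrightarrow> \<exists>v. v \<noteq> 0 \<and> A *v v = l *s v"
    "\<And>v. foldr (\<lambda>l x. A *v x - l *s x) ls v = 0"
proof -
  let ?D = "DIM(complex^'n^'n)"
  define M where "M = rec_nat (mat 1 :: complex^'n^'n) (\<lambda>_ X. A ** X)"
  have M: "M k *v v = (((*v) A) ^^ k) v" for k v
    by (induction k) (simp_all add: M_def matrix_vector_mul_assoc[symmetric])
  \<comment> \<open>The matrices form a real vector space of dimension \<open>?D\<close>, so the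
    powers of A up to exponent \<open>?D\<close> satisfy a linear relation; its coefficients give
    the annihilating polynomial.\<close>
  obtain c where c: "\<exists>k\<le>?D. c k \<noteq> 0" "(\<Sum>k\<le>?D. c k *\<^sub>R M k) = 0"
    using exists_linear_relation[of M] by blast
  define p where "p = (\<Sum>k\<le>?D. monom (complex_of_real (c k)) k)"
  have "coeff p k = complex_of_real (c k)" if "k \<le> ?D" for k
    using that by (simp add: p_def coeff_sum)
  then have "p \<noteq> 0" using c(1) by (metis coeff_0 of_real_eq_0_iff)
  have p0: "poly_mat A p v = 0" for v
  proof -
    have "poly_mat A p v = (\<Sum>k\<le>?D. complex_of_real (c k) *s (M k *v v))"
      by (simp add: p_def poly_mat_sum poly_mat_monom M)
    also have "\<dots> = (\<Sum>k\<le>?D. (c k *\<^sub>R M k) *v v)"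
    proof (rule sum.cong[OF refl])
      show "of_real (c k) *s (M k *v v) = (c k *\<^sub>R M k) *v v" for k
        unfolding vec_eq_iff matrix_vector_mult_def vector_smult_component vec_lambda_beta vector_scaleR_component
        by (simp add: scaleR_conv_of_real[where 'a=complex] sum_distrib_left mult.assoc)
    qed
    also have "\<dots> = (\<Sum>k\<le>?D. c k *\<^sub>R M k) *v v"
      by (rule matrix_sum_vector_mult[symmetric])
    finally show ?thesis using c(2) by simp
  qed
  obtain ms where ms: "p = smult (lead_coeff p) (\<Prod>x\<in>#ms. [:-x, 1:])"
    using alg_closed_imp_factorization[OF \<open>p \<noteq> 0\<close>] by blast
  obtain ls0 where ls0: "mset ls0 = ms" using ex_mset by blast
  let ?T = "\<lambda>l x. A *v x - l *s x"
  have z0: "foldr ?T ls0 v = 0" for v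
  proof -
    have "p = smult (lead_coeff p) (\<Prod>l\<leftarrow>ls0. [:- l, 1:])"
      using ms by (simp add: ls0[symmetric] prod_mset_prod_list[symmetric] mset_map)
    then have "poly_mat A p v = poly_mat A (smult (lead_coeff p) (\<Prod>l\<leftarrow>ls0. [:- l, 1:])) v"
      by (rule arg_cong)
    then have "0 = lead_coeff p *s foldr ?T ls0 v"
      unfolding p0 poly_mat_smult foldr_eq_poly_mat .
    then show ?thesis using \<open>p \<noteq> 0\<close> by (simp add: vec_eq_iff)
  qed
  note comm = foldr_shift_commute[of A]
  let ?eig = "\<lambda>l. \<exists>v. v \<noteq> 0 \<and> A *v v = l *s v"
  \<comment> \<open>The vector is generalised because a retained factor is commuted inwards and
    applied to \<open>w\<close> first.\<close>
  have filt: "foldr ?T ls w = 0 \<Longrightarrow> foldr ?T (filter ?eig ls) w = 0" for ls w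
  proof (induction ls arbitrary: w)
    case (Cons l ls)
    show ?case
    proof (cases "?eig l")
      case True
      have "foldr ?T ls (?T l w) = 0" using Cons.prems comm by simp
      then have "foldr ?T (filter ?eig ls) (?T l w) = 0" by (rule Cons.IH)
      then show ?thesis using True comm by simp
    next
      case False
      then have "foldr ?T ls w = 0" using Cons.prems by auto
      from Cons.IH[OF this] show ?thesis using False by simp
    qed
  qed simp
  show thesis
    by (rule that[of "filter ?eig ls0"]) (use filt[OF z0] in auto)
qed

section \<open>Eigenvalues of real matrices\<close>

lemma is_eigenvalue_iff: "is_eigenvalue A z \<longleftrightarrow> (\<exists>v. v \<noteq> 0 \<and> cmat A *v v = z *s v)"
proof -
  have "(mat z - cmat A) *v v = z *s v - cmat A *v v" for v
  proof -
    have "mat z *v v = z *s v"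
      by (simp add: vec_eq_iff matrix_vector_mult_def mat_def if_distrib[of "\<lambda>x. x * _"] cong: if_cong)
    then show ?thesis by (simp add: matrix_vector_mult_diff_rdistrib)
  qed
  then have "(mat z - cmat A) *v v = 0 \<longleftrightarrow> cmat A *v v = z *s v" for v by auto
  then have "det (mat z - cmat A) \<noteq> 0 \<longleftrightarrow> (\<forall>v. cmat A *v v = z *s v \<longrightarrow> v = 0)"
    unfolding det_nonzero_iff_ker by simp
  then show ?thesis unfolding is_eigenvalue_def by auto
qed

lemma is_eigenvalue_transpose: "is_eigenvalue (transpose A) z \<longleftrightarrow> is_eigenvalue A z"
proof -
  have "mat z - cmat (transpose A) = transpose (mat z - cmat A)"
    by (simp add: cmat_def transpose_def mat_def vec_eq_iff)
  then show ?thesis unfolding is_eigenvalue_def using det_transpose by metis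
qed

text \<open>On an eigenvector for z the annihilating product acts as the scalar product of all z -
  l, which is nonzero unless z occurs in the list.\<close>

lemma finite_eigenvalues: "finite {z. is_eigenvalue A z}"
proof -
  obtain ls where ls: "\<And>v. foldr (\<lambda>l x. cmat A *v x - l *s x) ls v = 0"
    using annihilating_eigenvalue_list by metis
  have "z \<in> set ls" if "is_eigenvalue A z" for z
  proof (rule ccontr)
    obtain v where v: "v \<noteq> 0" "cmat A *v v = z *s v" using \<open>is_eigenvalue A z\<close> unfolding is_eigenvalue_iff by blast
    assume "z \<notin> set ls"
    then have "\<exists>c. c \<noteq> 0 \<and> foldr (\<lambda>l x. cmat A *v x - l *s x) ls v = c *s v"
    proof (induction ls)
      case Nil then show ?case by (intro exI[of _ 1]) simp
    next
      case (Cons l ls)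
      then obtain c where c: "c \<noteq> 0" "foldr (\<lambda>l x. cmat A *v x - l *s x) ls v = c *s v" by auto
      have "foldr (\<lambda>l x. cmat A *v x - l *s x) (l # ls) v = (c * (z - l)) *s v"
        using c v by (simp add: vector_scalar_commute) (simp add: vec_eq_iff algebra_simps)
      then show ?case using Cons.prems c by (intro exI[of _ "c * (z - l)"]) auto
    qed
    then obtain c where "c \<noteq> 0" "c *s v = 0" using ls by metis
    then show False using v(1) by (simp add: vec_eq_iff)
  qed
  then have "{z. is_eigenvalue A z} \<subseteq> set ls" by auto
  then show ?thesis by (rule finite_subset) simp
qed

section \<open>Low-gain Riccati solutions\<close>

lemma cmat_add: "cmat (A + B) = cmat A + cmat B"
  by (simp add: cmat_def vec_eq_iff)

lemma cmat_diff: "cmat (A - B) = cmat A - cmat B"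
  by (simp add: cmat_def vec_eq_iff)

lemma cmat_mult: "cmat (A ** B) = cmat A ** cmat B"
  by (simp add: cmat_def matrix_matrix_mult_def vec_eq_iff)

lemma cmat_zero: "cmat 0 = 0"
  by (simp add: cmat_def vec_eq_iff)

lemma cmat_scaleR_mult: "cmat (r *\<^sub>R A) *v x = r *\<^sub>R (cmat A *v x)"
  unfolding vec_eq_iff matrix_vector_mult_def cmat_def vector_scaleR_component vec_lambda_beta
  by (simp add: scaleR_conv_of_real[where 'a=complex] sum_distrib_left mult.assoc)

lemma cmat_mat_1_mult: "cmat (mat 1) *v x = (x :: complex^'n)"
proof -
  have "cmat (mat 1) = (mat 1 :: complex^'n^'n)" by (simp add: cmat_def mat_def vec_eq_iff)
  then show ?thesis by simp
qed

text \<open>The inner product on complex vectors is the real part of the Hermitian one; a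
  complexified real matrix has its complexified transpose as adjoint. Quadratic arguments thus stay
  real-valued on complex vectors.\<close>

lemma inner_cmat_left:
  fixes M :: "real^'n^'m"
  shows "(cmat M *v x) \<bullet> y = x \<bullet> (cmat (transpose M) *v y)"
proof -
  have "(cmat M *v x) \<bullet> y = (\<Sum>i\<in>UNIV. \<Sum>j\<in>UNIV. M $ i $ j * (x $ j \<bullet> y $ i))"
    by (simp add: inner_vec_def matrix_vector_mult_def cmat_def inner_sum_left
        scaleR_conv_of_real[where 'a=complex, symmetric])
  also have "\<dots> = (\<Sum>j\<in>UNIV. \<Sum>i\<in>UNIV. M $ i $ j * (x $ j \<bullet> y $ i))" by (rule sum.swap)
  also have "\<dots> = x \<bullet> (cmat (transpose M) *v y)"
    by (simp add: inner_vec_def matrix_vector_mult_def cmat_def inner_sum_right transpose_def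
        scaleR_conv_of_real[where 'a=complex, symmetric])
  finally show ?thesis .
qed

lemma inner_smult_left: "((c *s x) :: complex^'n) \<bullet> y = x \<bullet> (cnj c *s y)"
  by (simp add: inner_vec_def inner_complex_def algebra_simps)

lemma inner_smult_self: "((c *s x) :: complex^'n) \<bullet> x = Re c * (x \<bullet> x)"
  by (simp add: inner_vec_def inner_complex_def sum_distrib_left algebra_simps)

text \<open>Multiplication by \<i> is skew for this inner product and commutes with
  \<open>P\<close>, so the product of \<i> x with P x equals its own negative; only the real part of
  \<open>c\<close> survives.\<close>

lemma inner_smult_symmetric:
  fixes P :: "real^'n^'n"
  assumes "transpose P = P"
  shows "(c *s x) \<bullet> (cmat P *v x) = Re c * (x \<bullet> (cmat P *v x))"
proof -
  have "cnj \<i> *s w = - (\<i> *s w)" for w :: "complex^'n" by (simp add: vec_eq_iff)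
  then have "(\<i> *s x) \<bullet> (cmat P *v x) = - (x \<bullet> (cmat P *v (\<i> *s x)))"
    unfolding inner_smult_left vector_scalar_commute by simp
  also have "x \<bullet> (cmat P *v (\<i> *s x)) = (cmat P *v x) \<bullet> (\<i> *s x)"
    by (simp add: inner_cmat_left assms)
  finally have i0: "(\<i> *s x) \<bullet> (cmat P *v x) = 0" by (simp add: inner_commute)
  have "c *s x = Re c *\<^sub>R x + Im c *\<^sub>R (\<i> *s x)"
    by (simp add: vec_eq_iff complex_eq_iff)
  then show ?thesis by (simp add: inner_add_left i0)
qed

lemma inner_cmat_Re_Im:
  fixes P :: "real^'n^'n"
  shows "x \<bullet> (cmat P *v x) = (\<chi> i. Re (x $ i)) \<bullet> (P *v (\<chi> i. Re (x $ i))) + (\<chi> i. Im (x $ i)) \<bullet> (P *v (\<chi> i. Im (x $ i)))"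
  by (simp add: inner_vec_def inner_complex_def matrix_vector_mult_def cmat_def sum.distrib)

lemma pos_def_complex_nonneg:
  assumes "pos_def P"
  shows "x \<bullet> (cmat P *v x) \<ge> 0"
proof -
  have "y \<bullet> (P *v y) \<ge> 0" for y using assms unfolding pos_def_def by (cases "y = 0") (auto simp: less_imp_le)
  then show ?thesis unfolding inner_cmat_Re_Im by (intro add_nonneg_nonneg)
qed

text \<open>Nonnegativity at x - t f(x) for a small t > 0 forces the linear term 2 t |f x|^2 to
  vanish.\<close>

lemma psd_inner_zero_imp:
  fixes f :: "'a::real_inner \<Rightarrow> 'a"
  assumes lin: "linear f" and sa: "\<And>x y. f x \<bullet> y = x \<bullet> f y" and psd: "\<And>x. x \<bullet> f x \<ge> 0" and z: "x \<bullet> f x = 0"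
  shows "f x = 0"
proof -
  define y where "y = f x"
  define c where "c = y \<bullet> f y"
  have c: "c \<ge> 0" using psd by (simp add: c_def)
  \<comment> \<open>The summand 1 keeps the quotient defined for c = 0; with this t the quadratic
    expression becomes -t^2 (c + 2).\<close>
  define t where "t = (y \<bullet> y) / (c + 1)"
  have "0 \<le> (x - t *\<^sub>R y) \<bullet> f (x - t *\<^sub>R y)" by (rule psd)
  also have "\<dots> = x \<bullet> f x - 2 * t * (y \<bullet> y) + t * t * c"
    using sa[of x y] by (simp add: linear_diff[OF lin] linear_cmul[OF lin] inner_diff_left inner_diff_right c_def y_def inner_commute algebra_simps)
  also have "\<dots> = t * (t * c - 2 * (y \<bullet> y))" using z by (simp add: algebra_simps)
  also have "t * c - 2 * (y \<bullet> y) = - (t * (c + 2))"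
    using c by (simp add: t_def field_simps)
  finally have "t * t * (c + 2) \<le> 0" by simp
  then have "t = 0" using c by (simp add: mult_le_0_iff zero_le_mult_iff)
    (smt (verit) zero_le_square)
  then have "y \<bullet> y = 0" using c by (simp add: t_def)
  then show ?thesis by (simp add: y_def)
qed

text \<open>Applied factor by factor to a vector of \<open>R\<close>, an annihilating product stays
  in \<open>R\<close>; the last nonzero vector before it vanishes is an eigenvector.\<close>

lemma invariant_range_eigenvector:
  fixes M :: "complex^'n^'n"
  assumes inv: "\<And>y. y \<in> R \<Longrightarrow> M *v y \<in> R" and diff: "\<And>y w. y \<in> R \<Longrightarrow> w \<in> R \<Longrightarrow> y - w \<in> R"
    and smult: "\<And>c y. y \<in> R \<Longrightarrow> c *s y \<in> R" and y0: "y0 \<in> R" "y0 \<noteq> 0"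
  obtains l y where "y \<in> R" "y \<noteq> 0" "M *v y = l *s y"
proof -
  let ?T = "\<lambda>l x. M *v x - l *s x"
  have mem: "foldr ?T ls y0 \<in> R" for ls
    by (induction ls) (auto intro: y0 inv diff smult)
  have ex: "foldr ?T ls y0 = 0 \<Longrightarrow> \<exists>l y. y \<in> R \<and> y \<noteq> 0 \<and> ?T l y = 0" for ls
  proof (induction ls)
    case (Cons l ls)
    then show ?case using mem[of ls] by (cases "foldr ?T ls y0 = 0") auto
  qed (use y0 in auto)
  obtain ls where "\<And>v. foldr ?T ls v = 0" using annihilating_eigenvalue_list[of M] by metis
  with ex[of ls] show thesis using that by auto
qed

text \<open>Since A^T Q + Q A is positive semidefinite, the kernel of Q is invariant under A, hence the range of Q is
  invariant under the transpose of A and contains one of its eigenvectors.\<close>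
lemma lyapunov_eigenvector:
  fixes A Q :: "real^'n^'n"
  assumes Qsym: "transpose Q = Q" and Qpsd: "\<And>x. x \<bullet> (cmat Q *v x) \<ge> 0" and Q0: "Q \<noteq> 0"
    and S: "\<And>x. (cmat Q *v x) \<bullet> (cmat A *v x) \<ge> 0"
  obtains l x where "cmat Q *v x \<noteq> 0" "cmat (transpose A) *v (cmat Q *v x) = l *s (cmat Q *v x)"
    "(cmat Q *v x) \<bullet> (cmat A *v x) = Re l * (x \<bullet> (cmat Q *v x))" "x \<bullet> (cmat Q *v x) > 0"
proof -
  let ?f = "(*v) (cmat Q)"
  have lin: "linear ?f" by (simp add: bounded_linear.linear)
  have sa: "?f x \<bullet> y = x \<bullet> ?f y" for x y by (simp add: inner_cmat_left Qsym)
  have adj: "adjoint ?f = ?f" by (rule adjoint_unique) (use sa in auto)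
  have "subspace (range ?f)" by (rule linear_subspace_image[OF lin subspace_UNIV])
  \<comment> \<open>The range of a self-adjoint map is the orthogonal complement of its kernel,
    which turns membership in the range into a condition on kernel vectors.\<close>
  then have rng: "range ?f = (?f -` {0})\<^sup>\<bottom>"
    using ker_orthogonal_comp_adjoint[OF lin] orthogonal_comp_self[of "range ?f"] adj by simp
  have memR: "y \<in> range ?f \<longleftrightarrow> (\<forall>k. ?f k = 0 \<longrightarrow> k \<bullet> y = 0)" for y
    unfolding rng orthogonal_comp_def orthogonal_def by auto
  let ?s = "\<lambda>x. cmat (transpose A) *v ?f x + ?f (cmat A *v x)"
  have slin: "linear ?s"
    by (intro linear_compose_add linear_compose[of ?f "(*v) (cmat (transpose A))", unfolded o_def]
       linear_compose[of "(*v) (cmat A)" ?f, unfolded o_def]) (simp_all add: bounded_linear.linear)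
  have tA: "(cmat (transpose A) *v u) \<bullet> w = u \<bullet> (cmat A *v w)" for u w
    by (simp add: inner_cmat_left)
  have s_inner: "x \<bullet> ?s x = 2 * (?f x \<bullet> (cmat A *v x))" for x
    using tA[of "?f x" x] sa[of x "cmat A *v x"] by (simp add: inner_add_right inner_commute)
  have ssa: "?s x \<bullet> y = x \<bullet> ?s y" for x y
    using tA[of "?f x" y] sa[of x "cmat A *v y"] sa[of "cmat A *v x" y] tA[of "?f y" x]
    by (simp add: inner_add_right inner_add_left inner_commute)
  have kerinv: "?f (cmat A *v k) = 0" if "?f k = 0" for k
  proof -
    have "?s k = 0"
    proof (rule psd_inner_zero_imp[OF slin ssa])
      show "x \<bullet> ?s x \<ge> 0" for x unfolding s_inner using S[of x] by simp
      show "k \<bullet> ?s k = 0" unfolding s_inner using that by simp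
    qed
    then show ?thesis using that by simp
  qed
  have "\<exists>x. ?f x \<noteq> 0"
  proof (rule ccontr)
    assume "\<nexists>x. ?f x \<noteq> 0"
    then have "?f (axis j 1) $ i = 0" for i j by simp
    then have "Q $ i $ j = 0" for i j
      by (simp add: matrix_vector_mult_def cmat_def axis_def if_distrib[of "\<lambda>x. _ * x"] cong: if_cong)
    then show False using Q0 by (simp add: vec_eq_iff)
  qed
  then obtain y0 where y0: "y0 \<in> range ?f" "y0 \<noteq> 0" by auto
  obtain l y where y: "y \<in> range ?f" "y \<noteq> 0" "cmat (transpose A) *v y = l *s y"
  proof (rule invariant_range_eigenvector[of "range ?f" "cmat (transpose A)"])
    show "cmat (transpose A) *v y \<in> range ?f" if y: "y \<in> range ?f" for y
      unfolding memR
    proof (intro allI impI)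
      fix k assume "?f k = 0"
      then have "(cmat A *v k) \<bullet> y = 0" using y kerinv unfolding memR by blast
      then show "k \<bullet> (cmat (transpose A) *v y) = 0" using tA[of y k] by (simp add: inner_commute)
    qed
    show "y - w \<in> range ?f" if "y \<in> range ?f" "w \<in> range ?f" for y w
      using that by (auto simp: matrix_vector_mult_diff_distrib[symmetric])
    show "c *s y \<in> range ?f" if "y \<in> range ?f" for c y
      using that by (auto simp: vector_scalar_commute[symmetric])
  qed (use y0 in auto)
  then obtain x where x: "y = ?f x" by auto
  have "?f x \<bullet> (cmat A *v x) = (l *s ?f x) \<bullet> x"
    using tA[of "?f x" x] y(3) by (simp add: x)
  also have "\<dots> = (l *s x) \<bullet> ?f x"
    using sa[of "l *s x" x] by (simp add: vector_scalar_commute)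
  also have "\<dots> = Re l * (x \<bullet> ?f x)" by (rule inner_smult_symmetric[OF Qsym])
  finally have 1: "?f x \<bullet> (cmat A *v x) = Re l * (x \<bullet> ?f x)" .
  have "x \<bullet> ?f x \<noteq> 0"
    using psd_inner_zero_imp[OF lin sa Qpsd, of x] y(2) x by auto
  then have "x \<bullet> ?f x > 0" using Qpsd[of x] by simp
  then show thesis using that[of x l] y x 1 by simp
qed

section \<open>The Riccati equation for vanishing \<epsilon>\<close>

abbreviation riccati :: "real^'n^'n \<Rightarrow> real^'m^'n \<Rightarrow> real \<Rightarrow> real^'n^'n \<Rightarrow> bool" where
  "riccati A B \<epsilon> P \<equiv> transpose A ** P + P ** A - P ** B ** transpose B ** P + \<epsilon> *\<^sub>R mat 1 = 0"

lemma riccati_quadratic: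
  fixes A P :: "real^'n^'n" and B :: "real^'m^'n"
  assumes sym: "transpose P = P"
    and are: "riccati A B \<epsilon> P"
  shows "2 * ((cmat P *v x) \<bullet> (cmat A *v x)) = (norm (cmat (transpose B) *v (cmat P *v x)))\<^sup>2 - \<epsilon> * (x \<bullet> x)"
proof -
  let ?P = "(*v) (cmat P)"
  have "cmat (transpose A ** P + P ** A - P ** B ** transpose B ** P + \<epsilon> *\<^sub>R mat 1) *v x = 0"
    unfolding are by (simp add: cmat_zero)
  then have "cmat (transpose A) *v ?P x + ?P (cmat A *v x) - ?P (cmat B *v (cmat (transpose B) *v ?P x)) + \<epsilon> *\<^sub>R x = 0"
    by (simp add: cmat_add cmat_diff cmat_mult cmat_scaleR_mult cmat_mat_1_mult matrix_vector_mult_add_rdistrib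
        matrix_vector_mult_diff_rdistrib matrix_vector_mul_assoc matrix_mul_assoc)
  then have "0 = x \<bullet> (cmat (transpose A) *v ?P x + ?P (cmat A *v x) - ?P (cmat B *v (cmat (transpose B) *v ?P x)) + \<epsilon> *\<^sub>R x)"
    by simp
  also have "\<dots> = x \<bullet> (cmat (transpose A) *v ?P x) + x \<bullet> ?P (cmat A *v x) - x \<bullet> ?P (cmat B *v (cmat (transpose B) *v ?P x)) + \<epsilon> * (x \<bullet> x)"
    by (simp add: inner_add_right inner_diff_right)
  also have "x \<bullet> (cmat (transpose A) *v ?P x) = ?P x \<bullet> (cmat A *v x)"
    using inner_cmat_left[of A x "?P x"] by (simp add: inner_commute)
  also have "x \<bullet> ?P (cmat A *v x) = ?P x \<bullet> (cmat A *v x)"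
    using inner_cmat_left[of P x "cmat A *v x"] sym by simp
  also have "x \<bullet> ?P (cmat B *v (cmat (transpose B) *v ?P x)) = (norm (cmat (transpose B) *v ?P x))\<^sup>2"
    using inner_cmat_left[of P x] sym inner_cmat_left[of "transpose B" "?P x" "cmat (transpose B) *v ?P x"]
    by (simp add: power2_norm_eq_inner)
  finally show ?thesis by simp
qed

text \<open>If the solutions did not tend to zero, a limit Q of the normalised solutions would satisfy
  2 Re (Qx, Ax) >= \<eta> |B^T Q x|^2; an eigenvector of the transpose of A in the range of Q
  would then be an uncontrollable mode on the imaginary axis, contradicting stabilizability.\<close>
lemma riccati_small:
  fixes A :: "real^'n^'n" and B :: "real^'m^'n"
  assumes stab: "stabilizable A B" and spec: "\<forall>z. is_eigenvalue A z \<longrightarrow> Re z \<le> 0" and \<eta>: "\<eta> > 0"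
  shows "\<exists>\<epsilon>s>0. \<forall>\<epsilon> P. 0 < \<epsilon> \<and> \<epsilon> \<le> \<epsilon>s \<and> pos_def P \<and>
    riccati A B \<epsilon> P \<longrightarrow> norm P < \<eta>"
proof (rule ccontr)
  assume neg: "\<not> ?thesis"
  have "\<exists>\<epsilon> P. 0 < \<epsilon> \<and> \<epsilon> \<le> 1 / real (Suc n) \<and> pos_def P \<and>
    riccati A B \<epsilon> P \<and> norm P \<ge> \<eta>" for n
  proof -
    have "1 / real (Suc n) > 0" by simp
    with neg show ?thesis unfolding not_le[symmetric] by (metis not_le)
  qed
  then obtain E P where E: "\<And>n::nat. 0 < E n" "\<And>n. E n \<le> 1 / real (Suc n)" and pd: "\<And>n. pos_def (P n)"
    and are: "\<And>n. riccati A B (E n) (P n)"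
    and nP: "\<And>n. norm (P n) \<ge> \<eta>"
    by metis
  have nP0: "norm (P n) > 0" for n using nP[of n] \<eta> by linarith
  define q where "q = (\<lambda>n. (1 / norm (P n)) *\<^sub>R P n)"
  have Pq: "P n = norm (P n) *\<^sub>R q n" for n using nP0[of n] by (simp add: q_def)
  have "\<forall>n. q n \<in> sphere 0 1" using nP0 by (simp add: q_def)
  then obtain Q r where Q: "Q \<in> sphere 0 1" "strict_mono r" "(q \<circ> r) \<longlonglongrightarrow> Q"
    using compact_sphere[of "0 :: real^'n^'n" 1] unfolding compact_def by blast
  have lin: "linear (\<lambda>M :: real^'n^'n. cmat M *v x)" for x
    by (intro linearI) (simp_all add: cmat_add matrix_vector_mult_add_rdistrib cmat_scaleR_mult)
  have lim: "(\<lambda>n. cmat (q (r n)) *v x) \<longlonglongrightarrow> cmat Q *v x" for x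
    using bounded_linear.tendsto[OF lin[of x, unfolded linear_conv_bounded_linear] Q(3)] by (simp add: o_def)
  have Elim: "(\<lambda>n. E (r n)) \<longlonglongrightarrow> 0"
  proof -
    have "E \<longlonglongrightarrow> 0"
    proof (rule tendsto_sandwich[where f = "\<lambda>_. 0" and h = "\<lambda>n. 1 / real (Suc n)"])
      show "(\<lambda>n. 1 / real (Suc n)) \<longlonglongrightarrow> 0" using LIMSEQ_inverse_real_of_nat by (simp add: inverse_eq_divide)
      show "\<forall>\<^sub>F n in sequentially. 0 \<le> E n" using E(1) by (simp add: less_imp_le)
      show "\<forall>\<^sub>F n in sequentially. E n \<le> 1 / real (Suc n)" by (rule always_eventually) (use E(2) in blast)
    qed auto
    then show ?thesis using LIMSEQ_subseq_LIMSEQ[OF _ Q(2)] by (auto simp: o_def)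
  qed
  have qsym: "transpose (q n) = q n" for n
    using pd[of n] by (simp add: q_def pos_def_def transpose_scalar)
  have Qsym: "transpose Q = Q"
  proof -
    have "Q $ i $ j = Q $ j $ i" for i j
    proof -
      have l: "(\<lambda>n. q (r n) $ i $ j) \<longlonglongrightarrow> Q $ i $ j" for i j
        using Q(3) by (auto simp: o_def intro!: tendsto_vec_nth)
      have "q (r n) $ i $ j = q (r n) $ j $ i" for n
        using arg_cong[OF qsym[of "r n"], of "\<lambda>M. M $ i $ j"] by (simp add: transpose_def)
      then show ?thesis using LIMSEQ_unique[OF l[of i j]] l[of j i] by simp
    qed
    then show ?thesis by (simp add: transpose_def vec_eq_iff)
  qed
  have Qpsd: "x \<bullet> (cmat Q *v x) \<ge> 0" for x
  proof (rule LIMSEQ_le_const)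
    show "(\<lambda>n. x \<bullet> (cmat (q (r n)) *v x)) \<longlonglongrightarrow> x \<bullet> (cmat Q *v x)" by (intro tendsto_intros lim)
    have "x \<bullet> (cmat (q (r n)) *v x) \<ge> 0" for n
      unfolding q_def cmat_scaleR_mult using pos_def_complex_nonneg[OF pd[of "r n"], of x] by simp
    then show "\<exists>N. \<forall>n\<ge>N. 0 \<le> x \<bullet> (cmat (q (r n)) *v x)" by blast
  qed
  have key: "\<eta> * (norm (cmat (transpose B) *v (cmat Q *v x)))\<^sup>2 \<le> 2 * ((cmat Q *v x) \<bullet> (cmat A *v x))" for x
  proof (rule LIMSEQ_le)
    let ?b = "\<lambda>M. norm (cmat (transpose B) *v (cmat M *v x))"
    show "(\<lambda>n. \<eta> * (?b (q (r n)))\<^sup>2 - E (r n) / \<eta> * (x \<bullet> x)) \<longlonglongrightarrow> \<eta> * (?b Q)\<^sup>2"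
    proof -
      have "(\<lambda>n. \<eta> * (?b (q (r n)))\<^sup>2 - E (r n) / \<eta> * (x \<bullet> x)) \<longlonglongrightarrow> \<eta> * (?b Q)\<^sup>2 - 0 / \<eta> * (x \<bullet> x)"
        by (intro tendsto_intros bounded_linear.tendsto[OF matrix_vector_mul_bounded_linear] lim Elim) (use \<eta> in auto)
      then show ?thesis by simp
    qed
    show "(\<lambda>n. 2 * ((cmat (q (r n)) *v x) \<bullet> (cmat A *v x))) \<longlonglongrightarrow> 2 * ((cmat Q *v x) \<bullet> (cmat A *v x))"
      by (intro tendsto_intros lim)
    \<comment> \<open>Division by p = |P n| leaves p |B^T q x|^2 - (E n / p) |x|^2. As p >= \<eta>,
      putting \<eta> for p only lowers this, so norms tending to infinity do no harm.\<close>
    have "\<eta> * (?b (q n))\<^sup>2 - E n / \<eta> * (x \<bullet> x) \<le> 2 * ((cmat (q n) *v x) \<bullet> (cmat A *v x))" for n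
    proof -
      define p where "p = norm (P n)"
      have p: "p > 0" "p \<ge> \<eta>" using nP0 nP by (auto simp: p_def)
      have "2 * ((cmat (P n) *v x) \<bullet> (cmat A *v x)) = (?b (P n))\<^sup>2 - E n * (x \<bullet> x)"
        by (rule riccati_quadratic[OF _ are]) (use pd in \<open>auto simp: pos_def_def\<close>)
      moreover have "cmat (P n) *v x = p *\<^sub>R (cmat (q n) *v x)"
        using arg_cong[OF Pq[of n], of "\<lambda>M. cmat M *v x"] by (simp add: cmat_scaleR_mult p_def)
      ultimately have "p * (2 * ((cmat (q n) *v x) \<bullet> (cmat A *v x))) = p * (p * (?b (q n))\<^sup>2) - E n * (x \<bullet> x)"
        using p by (simp add: matrix_vector_scaleR power_mult_distrib power2_eq_square algebra_simps)
      then have "2 * ((cmat (q n) *v x) \<bullet> (cmat A *v x)) = p * (?b (q n))\<^sup>2 - E n / p * (x \<bullet> x)"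
        using p by (simp add: field_simps)
      moreover have "\<eta> * (?b (q n))\<^sup>2 \<le> p * (?b (q n))\<^sup>2" using p by (intro mult_right_mono) auto
      moreover have "E n / p * (x \<bullet> x) \<le> E n / \<eta> * (x \<bullet> x)"
        using p \<eta> E(1)[of n] by (intro mult_right_mono divide_left_mono) auto
      ultimately show ?thesis by linarith
    qed
    then show "\<exists>N. \<forall>n\<ge>N. \<eta> * (?b (q (r n)))\<^sup>2 - E (r n) / \<eta> * (x \<bullet> x) \<le> 2 * ((cmat (q (r n)) *v x) \<bullet> (cmat A *v x))"
      by blast
  qed
  have S: "(cmat Q *v x) \<bullet> (cmat A *v x) \<ge> 0" for x
  proof -
    have "0 \<le> \<eta> * (norm (cmat (transpose B) *v (cmat Q *v x)))\<^sup>2" using \<eta> by (intro mult_nonneg_nonneg) auto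
    also note key[of x]
    finally show ?thesis by simp
  qed
  have "Q \<noteq> 0" using Q(1) by auto
  then obtain l x where y: "cmat Q *v x \<noteq> 0" "cmat (transpose A) *v (cmat Q *v x) = l *s (cmat Q *v x)"
    "(cmat Q *v x) \<bullet> (cmat A *v x) = Re l * (x \<bullet> (cmat Q *v x))" "x \<bullet> (cmat Q *v x) > 0"
    using lyapunov_eigenvector[OF Qsym Qpsd _ S] by metis
  have "is_eigenvalue (transpose A) l" unfolding is_eigenvalue_iff using y by blast
  then have l0: "Re l \<le> 0" using spec is_eigenvalue_transpose by blast
  have "Re l * (x \<bullet> (cmat Q *v x)) \<ge> 0" using S[of x] y(3) by simp
  then have Rel: "Re l = 0" using l0 y(4) by (simp add: zero_le_mult_iff)
  have "\<eta> * (norm (cmat (transpose B) *v (cmat Q *v x)))\<^sup>2 \<le> 0" using key[of x] y(3) Rel by simp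
  then have By: "cmat (transpose B) *v (cmat Q *v x) = 0"
    using \<eta> by (simp add: mult_le_0_iff)
  \<comment> \<open>Since B^T annihilates this eigenvector, every feedback \<open>F\<close> leaves
    it an eigenvector of the transposed closed-loop matrix with the same eigenvalue.\<close>
  obtain F :: "real^'n^'m" where F: "hurwitz (A + B ** F)" using stab unfolding stabilizable_def by blast
  have "cmat (transpose (A + B ** F)) *v (cmat Q *v x) = cmat (transpose A) *v (cmat Q *v x) + cmat (transpose F) *v (cmat (transpose B) *v (cmat Q *v x))"
  proof -
    have "transpose (A + B ** F) = transpose A + transpose F ** transpose B"
      by (simp add: matrix_transpose_mul[symmetric]) (simp add: transpose_def vec_eq_iff)
    then show ?thesis
      by (simp only: cmat_add cmat_mult matrix_vector_mult_add_rdistrib matrix_vector_mul_assoc[symmetric])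
  qed
  also have "\<dots> = l *s (cmat Q *v x)" using y(2) By by simp
  finally have "is_eigenvalue (transpose (A + B ** F)) l" unfolding is_eigenvalue_iff using y(1) by blast
  then have "Re l < 0" using F unfolding hurwitz_def is_eigenvalue_transpose by blast
  then show False using Rel by simp
qed

section \<open>Resolvent bound and eigenvalues on the imaginary axis\<close>

lemma cmat_norm_bound:
  "\<exists>N>0. \<forall>(P :: real^'n^'n) v. norm (cmat P *v v) \<le> N * norm P * norm v"
proof -
  have "bilinear (\<lambda>(P :: real^'n^'n) v. cmat P *v v)"
    unfolding bilinear_def
    by (auto intro!: linearI simp: cmat_add cmat_scaleR_mult matrix_vector_mult_add_rdistrib
        matrix_vector_right_distrib matrix_vector_scaleR)
  from bilinear_bounded_pos[OF this] show ?thesis by blast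
qed

text \<open>For |s| above a + 1 the vector s v exceeds A v by at least |v|. For smaller s in
  \<open>R\<close> the norm has a positive minimum over the compact set of pairs of s and a unit
  vector, as no such s is an eigenvalue.\<close>

lemma resolvent_bound:
  fixes A :: "real^'n^'n"
  assumes cl: "closed R" and ne: "\<And>s. s \<in> R \<Longrightarrow> \<not> is_eigenvalue A s"
  shows "\<exists>M>0. \<forall>s v. s \<in> R \<longrightarrow> norm v \<le> M * norm (s *s v - cmat A *v v)"
proof -
  obtain a where a: "a > 0" "\<And>v. norm (cmat A *v v) \<le> a * norm v" using matrix_vector_bound by blast
  define K where "K = (R \<inter> cball 0 (a + 1)) \<times> sphere (0 :: complex^'n) 1"
  have cK: "compact K" unfolding K_def by (intro compact_Times closed_Int_compact cl) auto
  let ?g = "\<lambda>(s, v). norm (s *s v - cmat A *v v)"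
  have cg: "continuous_on K ?g"
  proof -
    have "continuous_on K (\<lambda>x. \<chi> i. fst x * snd x $ i)"
      by (intro continuous_on_vec_lambda continuous_intros)
    then have "continuous_on K (\<lambda>x. fst x *s snd x)" by (simp add: vector_scalar_mult_def)
    then show ?thesis unfolding split_beta by (intro continuous_intros)
  qed
  have "\<exists>m>0. \<forall>x\<in>K. m \<le> ?g x"
  proof (cases "K = {}")
    case False
    obtain x0 where x0: "x0 \<in> K" "\<And>x. x \<in> K \<Longrightarrow> ?g x0 \<le> ?g x"
      using continuous_attains_inf[OF cK False cg] by blast
    obtain s0 v0 where sv: "x0 = (s0, v0)" by (cases x0)
    have "s0 *s v0 - cmat A *v v0 \<noteq> 0"
    proof
      assume "s0 *s v0 - cmat A *v v0 = 0"
      moreover have "v0 \<noteq> 0" using x0(1) by (auto simp: K_def sv)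
      ultimately have "is_eigenvalue A s0" unfolding is_eigenvalue_iff by (intro exI[of _ v0]) simp
      then show False using ne[of s0] x0(1) by (simp add: K_def sv)
    qed
    then show ?thesis using x0 by (intro exI[of _ "?g x0"]) (auto simp: sv)
  qed (auto intro: exI[of _ 1])
  then obtain m where m: "m > 0" "\<And>x. x \<in> K \<Longrightarrow> m \<le> ?g x" by blast
  have "norm v \<le> (1 / m + 1) * norm (s *s v - cmat A *v v)" if s: "s \<in> R" for s v
  proof (cases "norm s \<le> a + 1")
    case True
    have "m * norm v \<le> norm (s *s v - cmat A *v v)"
    proof (cases "v = 0")
      case False
      define u where "u = (1 / norm v) *\<^sub>R v"
      have u: "v = norm v *\<^sub>R u" using False by (simp add: u_def)
      have "m \<le> norm (s *s u - cmat A *v u)"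
        using m(2)[of "(s, u)"] s True False by (simp add: K_def u_def)
      then have "m * norm v \<le> norm v * norm (s *s u - cmat A *v u)" 
        using mult_left_mono[OF _ norm_ge_zero[of v]] by (metis mult.commute)
      also have "\<dots> = norm (norm v *\<^sub>R (s *s u - cmat A *v u))" by simp
      also have "norm v *\<^sub>R (s *s u - cmat A *v u) = s *s (norm v *\<^sub>R u) - cmat A *v (norm v *\<^sub>R u)"
        unfolding matrix_vector_scaleR by (simp add: scaleR_diff_right vec_eq_iff)
      finally show ?thesis using u by simp
    qed simp
    then have "norm v \<le> 1 / m * norm (s *s v - cmat A *v v)" using m(1) by (simp add: field_simps)
    then show ?thesis by (simp add: distrib_right add_increasing2)
  next
    case False
    have "(a + 1) * norm v \<le> norm (s *s v)"
      unfolding norm_smult_vec using False by (intro mult_right_mono) auto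
    also have "\<dots> \<le> norm (s *s v - cmat A *v v) + a * norm v"
      using norm_triangle_sub[of "s *s v" "cmat A *v v"] a(2)[of v] by simp
    finally have "norm v \<le> norm (s *s v - cmat A *v v)" by (simp add: algebra_simps)
    also have "\<dots> \<le> (1 / m + 1) * norm (s *s v - cmat A *v v)" using m(1) by (simp add: distrib_right)
    finally show ?thesis .
  qed
  then show ?thesis using m(1) by (intro exI[of _ "1 / m + 1"]) (auto simp: add_pos_pos)
qed

lemma is_eigenvalue_cnj:
  assumes "is_eigenvalue A z"
  shows "is_eigenvalue A (cnj z)"
proof -
  obtain v where v: "v \<noteq> 0" "cmat A *v v = z *s v" using assms unfolding is_eigenvalue_iff by blast
  have "(cmat A *v (\<chi> i. cnj (v $ i))) $ i = cnj ((cmat A *v v) $ i)" for i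
    by (simp add: matrix_vector_mult_def cmat_def)
  then have "cmat A *v (\<chi> i. cnj (v $ i)) = cnj z *s (\<chi> i. cnj (v $ i))"
    by (simp add: vec_eq_iff v(2))
  moreover have "(\<chi> i. cnj (v $ i)) \<noteq> 0" using v(1) by (auto simp: vec_eq_iff)
  ultimately show ?thesis unfolding is_eigenvalue_iff by blast
qed

text \<open>The maximum in \<open>omega_max\<close> is over a finite set, and the spectrum of a real
  matrix is closed under conjugation, so -\<omega> competes as well.\<close>

lemma omega_max_bound:
  fixes A :: "real^'n^'n"
  assumes "is_eigenvalue A (\<i> * complex_of_real \<omega>)"
  shows "\<bar>\<omega>\<bar> \<le> omega_max A"
proof -
  let ?W = "{\<omega>. is_eigenvalue A (\<i> * complex_of_real \<omega>)}"
  have "\<not> hurwitz A" using assms unfolding hurwitz_def by fastforce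
  then have om: "omega_max A = Max ?W" by (simp add: omega_max_def)
  have "finite ((\<lambda>\<omega>. \<i> * complex_of_real \<omega>) -` {z. is_eigenvalue A z})"
    by (rule finite_vimageI[OF finite_eigenvalues]) (simp add: inj_def)
  then have fin: "finite ?W" by (simp add: vimage_def)
  have "is_eigenvalue A (\<i> * complex_of_real (- \<omega>))"
    using is_eigenvalue_cnj[OF assms] by simp
  then have "\<omega> \<in> ?W" "- \<omega> \<in> ?W" using assms by auto
  then have "\<omega> \<le> Max ?W" "- \<omega> \<le> Max ?W" by (auto intro: Max_ge[OF fin])
  then show ?thesis using om by simp
qed

lemma omega_max_nonneg:
  fixes A :: "real^'n^'n"
  assumes "\<forall>z. is_eigenvalue A z \<longrightarrow> Re z \<le> 0"
  shows "0 \<le> omega_max A"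
proof (cases "hurwitz A")
  case False
  then obtain z where z: "is_eigenvalue A z" "Re z \<ge> 0" unfolding hurwitz_def by (auto simp: not_less)
  then have "Re z = 0" using assms by force
  then have "z = \<i> * complex_of_real (Im z)" by (simp add: complex_eq_iff)
  then have "\<bar>Im z\<bar> \<le> omega_max A" using z omega_max_bound by metis
  then show ?thesis by linarith
qed (simp add: omega_max_def)

section \<open>Exclusion of characteristic roots in the closed right half plane\<close>

lemma low_gain_zero_free:
  fixes A :: "real^'n^'n" and B :: "real^'m^'n"
  assumes stab: "stabilizable A B" and spec: "\<forall>z. is_eigenvalue A z \<longrightarrow> Re z \<le> 0"
    and \<tau>b: "\<tau>bar \<ge> 0" and om: "\<tau>bar * omega_max A < pi / 2"
  shows "\<exists>\<rho>>1. \<exists>\<epsilon>s>0. \<forall>\<epsilon> P \<tau> s. 0 < \<epsilon> \<and> \<epsilon> \<le> \<epsilon>s \<and> pos_def P \<and>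
    riccati A B \<epsilon> P \<and> 0 \<le> \<tau> \<and> \<tau> \<le> \<tau>bar \<and> 0 \<le> Re s \<longrightarrow>
    det (dde_matrix (cmat A) (cmat (- (\<rho> *\<^sub>R (B ** transpose B ** P)))) \<tau> s) \<noteq> 0"
proof -
  have om0: "0 \<le> omega_max A" by (rule omega_max_nonneg[OF spec])
  \<comment> \<open>A margin above \<open>omega_max\<close>: the imaginary eigenvalues of A lie
    strictly inside |Im s| < \<Omega>, where the phase |Im s| \<tau> still stays below pi/2.\<close>
  obtain \<Omega> where \<Omega>: "\<Omega> > omega_max A" "\<tau>bar * \<Omega> < pi / 2"
  proof (cases "\<tau>bar = 0")
    case True
    then show thesis using that[of "omega_max A + 1"] by simp
  next
    case False
    then have "omega_max A < pi / 2 / \<tau>bar" using om \<tau>b by (simp add: field_simps)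
    then obtain \<Omega> where "omega_max A < \<Omega>" "\<Omega> < pi / 2 / \<tau>bar" using dense by blast
    then show thesis using that[of \<Omega>] False \<tau>b by (simp add: field_simps)
  qed
  have \<Omega>0: "\<Omega> > 0" using \<Omega>(1) om0 by linarith
  define c where "c = cos (\<tau>bar * \<Omega>)"
  have c0: "c > 0" unfolding c_def
    by (rule cos_gt_zero_pi) (use \<Omega> \<Omega>0 \<tau>b pi_gt_zero mult_nonneg_nonneg[of \<tau>bar \<Omega>] in linarith)+
  \<comment> \<open>Ensures exp (-Re s \<tau>) >= 1/2 whenever Re s < \<sigma>1; the summand 1
    covers a zero maximal delay.\<close>
  define \<sigma>1 where "\<sigma>1 = ln 2 / (\<tau>bar + 1)"
  have \<sigma>1: "\<sigma>1 > 0" using \<tau>b by (simp add: \<sigma>1_def)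
  have \<sigma>1\<tau>: "\<sigma>1 * \<tau>bar \<le> ln 2"
    using \<tau>b by (simp add: \<sigma>1_def field_simps)
  \<comment> \<open>Makes \<rho> c / 2 >= 1/2, which is what outweighs the quadratic term of the
    Riccati equation; the summand 1 gives \<rho> > 1.\<close>
  define \<rho> where "\<rho> = 1 / c + 1"
  have \<rho>: "\<rho> > 1" using c0 by (simp add: \<rho>_def)
  \<comment> \<open>What remains of the closed right half plane after removing a thin rectangle
    along the critical segment of the imaginary axis; closed and free of eigenvalues, it has a
    uniform resolvent bound.\<close>
  define R where "R = {s. Re s \<ge> 0} \<inter> ({s. Im s \<ge> \<Omega>} \<union> {s. Im s \<le> - \<Omega>} \<union> {s. Re s \<ge> \<sigma>1})"
  have "closed R" unfolding R_def
    by (intro closed_Int closed_Un closed_halfspace_Re_ge closed_halfspace_Im_ge closed_halfspace_Im_le)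
  moreover have "\<not> is_eigenvalue A s" if s: "s \<in> R" for s
  proof
    assume e: "is_eigenvalue A s"
    then have "Re s = 0" using spec s by (force simp: R_def)
    then have "s = \<i> * complex_of_real (Im s)" by (simp add: complex_eq_iff)
    then have "\<bar>Im s\<bar> \<le> omega_max A" using e omega_max_bound by metis
    then show False using s \<open>Re s = 0\<close> \<sigma>1 \<Omega> by (auto simp: R_def)
  qed
  ultimately obtain M where M: "M > 0" "\<And>s v. s \<in> R \<Longrightarrow> norm v \<le> M * norm (s *s v - cmat A *v v)"
    using resolvent_bound by blast
  obtain b where b: "b > 0" "\<And>v. norm (cmat (B ** transpose B) *v v) \<le> b * norm v"
    using matrix_vector_bound by blast
  obtain N where N: "N > 0" "\<And>(P :: real^'n^'n) v. norm (cmat P *v v) \<le> N * norm P * norm v"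
    using cmat_norm_bound by blast
  \<comment> \<open>Tuned so that M \<rho> b N \<eta> = 1/2: on \<open>R\<close> a null vector
    \<open>v\<close> then satisfies |v| <= |v| / 2.\<close>
  define \<eta> where "\<eta> = 1 / (2 * M * \<rho> * b * N)"
  have \<eta>: "\<eta> > 0" using M b N \<rho> by (simp add: \<eta>_def)
  obtain \<epsilon>s where \<epsilon>s: "\<epsilon>s > 0" and small: "\<And>\<epsilon> P. 0 < \<epsilon> \<Longrightarrow> \<epsilon> \<le> \<epsilon>s \<Longrightarrow> pos_def P \<Longrightarrow>
    riccati A B \<epsilon> P \<Longrightarrow> norm P < \<eta>"
    using riccati_small[OF stab spec \<eta>] by blast
  have "det (dde_matrix (cmat A) (cmat (- (\<rho> *\<^sub>R (B ** transpose B ** P)))) \<tau> s) \<noteq> 0"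
    if \<epsilon>: "0 < \<epsilon>" "\<epsilon> \<le> \<epsilon>s" and pd: "pos_def P"
      and are: "riccati A B \<epsilon> P"
      and \<tau>: "0 \<le> \<tau>" "\<tau> \<le> \<tau>bar" and s: "0 \<le> Re s" for \<epsilon> P \<tau> s
    unfolding det_nonzero_iff_ker
  proof (intro allI impI)
    fix v assume "dde_matrix (cmat A) (cmat (- (\<rho> *\<^sub>R (B ** transpose B ** P)))) \<tau> s *v v = 0"
    define e where "e = exp (- (s * of_real \<tau>))"
    define w where "w = cmat (transpose B) *v (cmat P *v v)"
    have G: "cmat (- (\<rho> *\<^sub>R (B ** transpose B ** P))) *v v = - (\<rho> *\<^sub>R (cmat B *v w))"
    proof -
      have "cmat ((- \<rho>) *\<^sub>R (B ** transpose B ** P)) *v v = - (\<rho> *\<^sub>R (cmat B *v w))"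
        unfolding cmat_scaleR_mult w_def cmat_mult matrix_vector_mul_assoc[symmetric] by simp
      then show ?thesis by simp
    qed
    have sv: "s *s v = cmat A *v v - \<rho> *\<^sub>R (e *s (cmat B *v w))"
      using \<open>dde_matrix _ _ _ _ *v v = 0\<close> unfolding dde_matrix_mult G e_def[symmetric]
      by (simp add: vec_eq_iff algebra_simps)
    have sym: "transpose P = P" using pd by (simp add: pos_def_def)
    have ne: "norm e = exp (- (Re s * \<tau>))" by (simp add: e_def norm_exp_eq_Re)
    show "v = 0"
    proof (cases "s \<in> R")
      case True
      have "norm (s *s v - cmat A *v v) = \<rho> * (norm e * norm (cmat B *v w))"
        unfolding sv using \<rho> by (simp add: norm_smult_vec)
      also have "\<dots> \<le> \<rho> * (1 * (b * (N * norm P * norm v)))"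
      proof (intro mult_left_mono mult_mono)
        show "norm e \<le> 1" unfolding ne using s \<tau> by simp
        have "cmat B *v w = cmat (B ** transpose B) *v (cmat P *v v)"
          by (simp only: w_def cmat_mult matrix_vector_mul_assoc[symmetric])
        then have "norm (cmat B *v w) \<le> b * norm (cmat P *v v)" using b(2) by simp
        also have "\<dots> \<le> b * (N * norm P * norm v)"
          using b(1) N(2)[of P v] by (intro mult_left_mono) auto
        finally show "norm (cmat B *v w) \<le> b * (N * norm P * norm v)" .
      qed (use \<rho> in auto)
      also have "\<dots> \<le> \<rho> * (1 * (b * (N * \<eta> * norm v)))"
        using \<rho> b N small[OF \<epsilon> pd are] by (intro mult_left_mono mult_right_mono) auto
      finally have "M * norm (s *s v - cmat A *v v) \<le> M * (\<rho> * (1 * (b * (N * \<eta> * norm v))))"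
        using M(1) by (intro mult_left_mono) auto
      also have "\<dots> = norm v / 2" using M b N \<rho> by (simp add: \<eta>_def)
      finally have "norm v \<le> norm v / 2" using M(2)[OF True, of v] by linarith
      then show ?thesis by simp
    next
      case False
      then have im: "\<bar>Im s\<bar> < \<Omega>" and re: "Re s < \<sigma>1" using s by (auto simp: R_def)
      have "Re e = exp (- (Re s * \<tau>)) * cos (Im s * \<tau>)"
        by (simp add: e_def Re_exp)
      moreover have "exp (- (Re s * \<tau>)) \<ge> 1 / 2"
      proof -
        have "Re s * \<tau> \<le> \<sigma>1 * \<tau>bar" using re s \<tau> \<sigma>1 by (intro mult_mono) auto
        then have "exp (- ln 2) \<le> exp (- (Re s * \<tau>))" using \<sigma>1\<tau> by simp
        then show ?thesis by (simp add: exp_minus)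
      qed
      moreover have "cos (Im s * \<tau>) \<ge> c"
      proof -
        have "\<bar>Im s * \<tau>\<bar> \<le> \<tau>bar * \<Omega>"
          unfolding abs_mult using im \<tau> \<Omega>0 mult_mono[of "\<bar>Im s\<bar>" \<Omega> "\<bar>\<tau>\<bar>" \<tau>bar] by (simp add: mult.commute)
        then have "cos (\<tau>bar * \<Omega>) \<le> cos \<bar>Im s * \<tau>\<bar>"
          using \<Omega>(2) pi_gt_zero by (intro cos_monotone_0_pi_le) linarith+
        then show ?thesis by (simp add: c_def)
      qed
      ultimately have "Re e \<ge> 1 / 2 * c" using c0 mult_mono[of "1/2" "exp (- (Re s * \<tau>))" c "cos (Im s * \<tau>)"] by simp
      then have "\<rho> * Re e \<ge> \<rho> * (1 / 2 * c)" using \<rho> by (intro mult_left_mono) auto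
      moreover have "\<rho> * (1 / 2 * c) \<ge> 1 / 2" using c0 by (simp add: \<rho>_def field_simps)
      ultimately have \<rho>e: "\<rho> * Re e \<ge> 1 / 2" by linarith
      have "(e *s (cmat B *v w)) \<bullet> (cmat P *v v) = (cmat B *v (e *s w)) \<bullet> (cmat P *v v)"
        by (simp add: vector_scalar_commute)
      also have "\<dots> = (e *s w) \<bullet> w" by (simp add: inner_cmat_left w_def)
      also have "\<dots> = Re e * (norm w)\<^sup>2" by (simp add: inner_smult_self power2_norm_eq_inner)
      finally have eB: "(e *s (cmat B *v w)) \<bullet> (cmat P *v v) = Re e * (norm w)\<^sup>2" .
      have "Re s * (v \<bullet> (cmat P *v v)) = (s *s v) \<bullet> (cmat P *v v)"
        by (rule inner_smult_symmetric[OF sym, symmetric])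
      also have "\<dots> = (cmat P *v v) \<bullet> (cmat A *v v) - \<rho> * (Re e * (norm w)\<^sup>2)"
        unfolding sv inner_diff_left inner_scaleR_left eB by (simp add: inner_commute)
      \<comment> \<open>Rearranged, 2 Re s (v, P v) + \<epsilon> |v|^2 + (2 \<rho> Re e - 1) |w|^2 =
        0 with every summand nonnegative.\<close>
      finally have "2 * (Re s * (v \<bullet> (cmat P *v v))) = (norm w)\<^sup>2 - \<epsilon> * (v \<bullet> v) - 2 * ((\<rho> * Re e) * (norm w)\<^sup>2)"
        using riccati_quadratic[OF sym are, of v] by (simp add: w_def)
      moreover have "(\<rho> * Re e) * (norm w)\<^sup>2 \<ge> 1 / 2 * (norm w)\<^sup>2"
        using \<rho>e by (intro mult_right_mono) auto
      moreover have "Re s * (v \<bullet> (cmat P *v v)) \<ge> 0"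
        using s pos_def_complex_nonneg[OF pd] by simp
      ultimately have "\<epsilon> * (v \<bullet> v) \<le> 0" by linarith
      then have "v \<bullet> v \<le> 0" using \<epsilon>(1) by (simp add: mult_le_0_iff)
      then show ?thesis using inner_ge_zero[of v] by (metis antisym inner_eq_zero_iff)
    qed
  qed
  then show ?thesis using \<rho> \<epsilon>s by blast
qed

section \<open>Exponentially decaying networks\<close>

text \<open>Only times up to x are compared, since the maximum may sit at the right end of an
  interval; hence a sign rather than a vanishing derivative.\<close>

lemma derivative_nonneg_of_max_right:
  fixes f :: "real \<Rightarrow> real"
  assumes der: "(f has_real_derivative D) (at x within {0..})" and x: "x > 0"
    and max: "\<And>t. 0 \<le> t \<Longrightarrow> t \<le> x \<Longrightarrow> f t \<le> f x"
  shows "D \<ge> 0"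
proof (rule ccontr)
  assume "\<not> D \<ge> 0"
  then obtain d where d: "d > 0" "\<And>h. h > 0 \<Longrightarrow> x - h \<in> {0..} \<Longrightarrow> h < d \<Longrightarrow> f x < f (x - h)"
    using has_real_derivative_neg_dec_left[OF der] by force
  define h where "h = min x d / 2"
  have "h > 0" "h < d" "h \<le> x" using x d by (auto simp: h_def)
  then show False using d(2)[of h] max[of "x - h"] by simp
qed

text \<open>One rate for the whole family. A rate rather than a limit is what the induction over
  factors passes on and what the forcing of the delay equation must have.\<close>

definition exp_decaying :: "'i set \<Rightarrow> ('i \<Rightarrow> real \<Rightarrow> 'a::real_normed_vector) \<Rightarrow> bool" where
  "exp_decaying I f \<longleftrightarrow> (\<exists>K \<gamma>. \<gamma> > 0 \<and> (\<forall>i\<in>I. \<forall>t\<ge>0. norm (f i t) \<le> K * exp (- (\<gamma> * t))))"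

lemma exp_decaying_add:
  assumes "exp_decaying I f" "exp_decaying I g"
  shows "exp_decaying I (\<lambda>i t. f i t + g i t)"
proof -
  obtain K \<gamma> where f: "\<gamma> > 0" "\<And>i t. i \<in> I \<Longrightarrow> t \<ge> 0 \<Longrightarrow> norm (f i t) \<le> K * exp (- (\<gamma> * t))"
    using assms(1) unfolding exp_decaying_def by blast
  obtain L \<delta> where g: "\<delta> > 0" "\<And>i t. i \<in> I \<Longrightarrow> t \<ge> 0 \<Longrightarrow> norm (g i t) \<le> L * exp (- (\<delta> * t))"
    using assms(2) unfolding exp_decaying_def by blast
  define \<mu> where "\<mu> = min \<gamma> \<delta>"
  have "norm (f i t + g i t) \<le> (\<bar>K\<bar> + \<bar>L\<bar>) * exp (- (\<mu> * t))" if "i \<in> I" "t \<ge> 0" for i t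
  proof -
    have "norm (f i t + g i t) \<le> K * exp (- (\<gamma> * t)) + L * exp (- (\<delta> * t))"
      by (intro norm_triangle_le add_mono f g that)
    also have "\<dots> \<le> \<bar>K\<bar> * exp (- (\<mu> * t)) + \<bar>L\<bar> * exp (- (\<mu> * t))"
      using that(2) by (intro add_mono mult_mono) (auto simp: \<mu>_def intro!: mult_right_mono)
    finally show ?thesis by (simp add: algebra_simps)
  qed
  moreover have "\<mu> > 0" using f g by (simp add: \<mu>_def)
  ultimately show ?thesis unfolding exp_decaying_def by blast
qed

lemma exp_decaying_bounded_linear:
  assumes "exp_decaying I f" "bounded_linear T"
  shows "exp_decaying I (\<lambda>i t. T (f i t))"
proof -
  obtain K \<gamma> where f: "\<gamma> > 0" "\<And>i t. i \<in> I \<Longrightarrow> t \<ge> 0 \<Longrightarrow> norm (f i t) \<le> K * exp (- (\<gamma> * t))"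
    using assms(1) unfolding exp_decaying_def by blast
  obtain L where L: "\<And>x. norm (T x) \<le> norm x * L" "L > 0"
    using bounded_linear.pos_bounded[OF assms(2)] by blast
  have "norm (T (f i t)) \<le> (K * L) * exp (- (\<gamma> * t))" if "i \<in> I" "t \<ge> 0" for i t
    using order_trans[OF L(1) mult_right_mono[OF f(2)[OF that] less_imp_le[OF L(2)]]] by (simp add: mult_ac)
  then show ?thesis using f(1) unfolding exp_decaying_def by blast
qed

text \<open>The weighted maximum of the node norms decreases exponentially, because the weights form a
  strictly positive supersolution of the grounded Laplacian.\<close>
lemma scalar_network_decay:
  fixes w f :: "'i \<Rightarrow> real \<Rightarrow> complex^'n"
  assumes fin: "finite I" and a: "\<And>i j. i \<in> I \<Longrightarrow> j \<in> I \<Longrightarrow> a i j \<ge> 0"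
    and \<xi>: "\<And>i. i \<in> I \<Longrightarrow> \<xi> i > 0" and c: "c > 0"
    and sup: "\<And>i. i \<in> I \<Longrightarrow> (\<Sum>j\<in>I. a i j * (\<xi> i - \<xi> j)) + b i * \<xi> i \<ge> c * \<xi> i"
    and l: "Re l \<le> 0"
    and der: "\<And>i t. i \<in> I \<Longrightarrow> t \<ge> 0 \<Longrightarrow> (w i has_vector_derivative
       (l *s w i t - (\<Sum>j\<in>I. a i j *\<^sub>R (w i t - w j t)) - b i *\<^sub>R w i t + f i t)) (at t within {0..})"
    and f: "exp_decaying I f"
  shows "exp_decaying I w"
proof (cases "I = {}")
  case False
  obtain K \<gamma> where \<gamma>: "\<gamma> > 0" and fb: "\<And>i t. i \<in> I \<Longrightarrow> t \<ge> 0 \<Longrightarrow> norm (f i t) \<le> K * exp (- (\<gamma> * t))"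
    using f unfolding exp_decaying_def by blast
  obtain i0 where "i0 \<in> I" using False by blast
  have K: "K \<ge> 0" using order_trans[OF norm_ge_zero fb[OF \<open>i0 \<in> I\<close>, of 0]] by simp
  \<comment> \<open>Rescaling by exp (g t) keeps the forcing bounded by K and costs at most half of
    the margin \<open>c\<close> of the supersolution.\<close>
  define g where "g = min \<gamma> (c / 2)"
  have g: "g > 0" "g \<le> \<gamma>" "g \<le> c / 2" using \<gamma> c by (auto simp: g_def)
  define u where "u = (\<lambda>i t. exp (g * t) *\<^sub>R w i t)"
  define F where "F = (\<lambda>i t. exp (g * t) *\<^sub>R f i t)"
  have Fb: "norm (F i t) \<le> K" if "i \<in> I" "t \<ge> 0" for i t
  proof -
    have "norm (F i t) \<le> exp (g * t) * (K * exp (- (\<gamma> * t)))"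
      using fb[OF that] by (simp add: F_def)
    also have "\<dots> = K * exp ((g - \<gamma>) * t)" by (simp add: exp_add[symmetric] algebra_simps)
    also have "\<dots> \<le> K * 1" using K g that by (intro mult_left_mono) (auto simp: mult_nonpos_nonneg)
    finally show ?thesis by simp
  qed
  define D where "D = (\<lambda>i t. g *\<^sub>R u i t + l *s u i t - (\<Sum>j\<in>I. a i j *\<^sub>R (u i t - u j t)) - b i *\<^sub>R u i t + F i t)"
  have uder: "(u i has_vector_derivative D i t) (at t within {0..})" if "i \<in> I" "t \<ge> 0" for i t
  proof -
    have "l *s (e *\<^sub>R y) = e *\<^sub>R (l *s y)" for e and y :: "complex^'n"
      by (simp add: vec_eq_iff)
    then have eq: "D i t = exp (g * t) *\<^sub>R (l *s w i t - (\<Sum>j\<in>I. a i j *\<^sub>R (w i t - w j t)) - b i *\<^sub>R w i t + f i t) + (g * exp (g * t)) *\<^sub>R w i t"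
      by (simp add: D_def u_def F_def scaleR_add_right scaleR_diff_right scaleR_sum_right mult.commute)
    show ?thesis unfolding eq unfolding u_def
      by (rule has_vector_derivative_scaleR) (auto intro!: derivative_eq_intros der that)
  qed
  define \<xi>m where "\<xi>m = Min (\<xi> ` I)"
  have \<xi>m: "\<xi>m > 0" "\<And>i. i \<in> I \<Longrightarrow> \<xi>m \<le> \<xi> i"
    using \<xi> fin False by (auto simp: \<xi>m_def)
  define m0 where "m0 = (\<Sum>i\<in>I. norm (w i 0) / \<xi> i)"
  \<comment> \<open>The level at which the remaining margin c/2 balances the forcing; a maximum
    attained after time 0 cannot exceed it.\<close>
  define m1 where "m1 = 2 * K / (c * \<xi>m)"
  have m0: "norm (w i 0) / \<xi> i \<le> m0" if "i \<in> I" for i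
    unfolding m0_def using \<xi> that fin by (intro member_le_sum) (auto simp: less_imp_le)
  have main: "norm (u i T) / \<xi> i \<le> max m0 m1" if iI: "i \<in> I" and T: "T \<ge> 0" for i T
  proof -
    have "\<exists>t\<in>{0..T}. \<forall>s\<in>{0..T}. norm (u i s) \<le> norm (u i t)" if "i \<in> I" for i
    proof (rule continuous_attains_sup)
      have "continuous_on {0..} (u i)"
        by (rule continuous_on_vector_derivative) (use uder[OF that] in auto)
      then show "continuous_on {0..T} (\<lambda>t. norm (u i t))"
        by (intro continuous_intros) (auto intro: continuous_on_subset)
    qed (use T in auto)
    then obtain tm where tm: "\<And>i. i \<in> I \<Longrightarrow> tm i \<in> {0..T}"
      "\<And>i s. i \<in> I \<Longrightarrow> s \<in> {0..T} \<Longrightarrow> norm (u i s) \<le> norm (u i (tm i))"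
      by metis
    obtain k where k: "k \<in> I" "\<And>i. i \<in> I \<Longrightarrow> norm (u i (tm i)) / \<xi> i \<le> norm (u k (tm k)) / \<xi> k"
      using ex_is_arg_min_if_finite[OF fin False, of "\<lambda>i. - (norm (u i (tm i)) / \<xi> i)"]
      unfolding is_arg_min_linorder neg_le_iff_le by blast
    define t1 where "t1 = tm k"
    define m where "m = norm (u k t1) / \<xi> k"
    have ub: "norm (u i t) \<le> m * \<xi> i" if "i \<in> I" "t \<in> {0..T}" for i t
    proof -
      have "norm (u i t) / \<xi> i \<le> norm (u i (tm i)) / \<xi> i"
        using tm(2)[OF that] \<xi>[OF that(1)] by (intro divide_right_mono) auto
      also have "\<dots> \<le> m" using k(2)[OF that(1)] by (simp add: m_def t1_def)
      finally show ?thesis using \<xi>[OF that(1)] by (simp add: field_simps)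
    qed
    have m_nonneg: "m \<ge> 0" using \<xi>[OF k(1)] by (simp add: m_def)
    have t1: "t1 \<in> {0..T}" using tm(1)[OF k(1)] by (simp add: t1_def)
    have uk: "norm (u k t1) = m * \<xi> k" using \<xi>[OF k(1)] by (simp add: m_def)
    have "m \<le> max m0 m1"
    proof (cases "t1 = 0 \<or> m = 0")
      case True
      then show ?thesis
      proof
        assume "t1 = 0"
        then have "m \<le> m0" using m0[OF k(1)] by (simp add: m_def u_def)
        then show ?thesis by simp
      next
        assume "m = 0"
        moreover have "m1 \<ge> 0" using K c \<xi>m by (simp add: m1_def)
        ultimately show ?thesis by simp
      qed
    next
      case False
      then have t1p: "t1 > 0" and mp: "m > 0" using t1 m_nonneg by auto
      \<comment> \<open>At the node and time of the largest weighted norm the squared norm has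
        nonnegative derivative. Every neighbour is bounded by m \<xi> j, so coupling and damping
        together contribute at most -|v| m \<open>?h\<close>.\<close>
      let ?v = "u k t1" and ?h = "(\<Sum>j\<in>I. a k j * (\<xi> k - \<xi> j)) + b k * \<xi> k"
      have "((\<lambda>t. u k t \<bullet> u k t) has_vector_derivative (?v \<bullet> D k t1 + D k t1 \<bullet> ?v)) (at t1 within {0..})"
        by (rule bounded_bilinear.has_vector_derivative[OF bounded_bilinear_inner]) (use uder[OF k(1)] t1p in auto)
      then have "((\<lambda>t. u k t \<bullet> u k t) has_real_derivative 2 * (?v \<bullet> D k t1)) (at t1 within {0..})"
        by (simp add: has_real_derivative_iff_has_vector_derivative inner_commute)
      moreover have "u k t \<bullet> u k t \<le> ?v \<bullet> ?v" if "0 \<le> t" "t \<le> t1" for t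
      proof -
        have "norm (u k t) \<le> norm ?v" using tm(2)[OF k(1), of t] that t1 by (simp add: t1_def)
        then show ?thesis unfolding power2_norm_eq_inner[symmetric] by (intro power_mono) auto
      qed
      ultimately have "2 * (?v \<bullet> D k t1) \<ge> 0"
        using derivative_nonneg_of_max_right[OF _ t1p] by blast
      then have "0 \<le> ?v \<bullet> D k t1" by simp
      also have "?v \<bullet> D k t1 = g * (norm ?v)\<^sup>2 + Re l * (norm ?v)\<^sup>2 - (\<Sum>j\<in>I. a k j * ((norm ?v)\<^sup>2 - ?v \<bullet> u j t1)) - b k * (norm ?v)\<^sup>2 + ?v \<bullet> F k t1"
        using inner_smult_self[of l ?v]
        by (simp add: D_def inner_add_right inner_diff_right inner_sum_right power2_norm_eq_inner inner_commute[of ?v "l *s ?v"])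
      also have "\<dots> \<le> g * (norm ?v)\<^sup>2 + 0 - (\<Sum>j\<in>I. a k j * ((norm ?v)\<^sup>2 - norm ?v * (m * \<xi> j))) - b k * (norm ?v)\<^sup>2 + norm ?v * K"
      proof (intro add_mono diff_mono order_refl)
        show "Re l * (norm ?v)\<^sup>2 \<le> 0" using l by (intro mult_nonpos_nonneg) auto
        show "(\<Sum>j\<in>I. a k j * ((norm ?v)\<^sup>2 - norm ?v * (m * \<xi> j))) \<le> (\<Sum>j\<in>I. a k j * ((norm ?v)\<^sup>2 - ?v \<bullet> u j t1))"
        proof (intro sum_mono mult_left_mono diff_left_mono a k(1))
          fix j assume j: "j \<in> I"
          have "?v \<bullet> u j t1 \<le> norm ?v * norm (u j t1)" by (rule norm_cauchy_schwarz)
          also have "\<dots> \<le> norm ?v * (m * \<xi> j)" using ub[OF j t1] by (intro mult_left_mono) auto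
          finally show "?v \<bullet> u j t1 \<le> norm ?v * (m * \<xi> j)" .
        qed
        have "?v \<bullet> F k t1 \<le> norm ?v * norm (F k t1)" by (rule norm_cauchy_schwarz)
        also have "\<dots> \<le> norm ?v * K" using Fb[OF k(1), of t1] t1 by (intro mult_left_mono) auto
        finally show "?v \<bullet> F k t1 \<le> norm ?v * K" .
      qed
      also have "\<dots> = norm ?v * (m * (g * \<xi> k - ?h) + K)"
        by (simp add: uk power2_eq_square sum_distrib_left sum_subtractf algebra_simps)
      finally have pos: "0 \<le> norm ?v * (m * (g * \<xi> k - ?h) + K)" .
      have "norm ?v > 0" using uk mp \<xi>[OF k(1)] by simp
      with pos have "0 \<le> m * (g * \<xi> k - ?h) + K"
        by (meson mult_pos_neg not_le)
      also have "\<dots> \<le> m * (c / 2 * \<xi> k - c * \<xi> k) + K"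
        using sup[OF k(1)] mult_right_mono[OF g(3), of "\<xi> k"] \<xi>[OF k(1)] mp
        by (intro add_right_mono mult_left_mono) linarith+
      also have "\<dots> = K - m * (c / 2) * \<xi> k" by (simp add: algebra_simps)
      finally have "m * (c / 2) * \<xi> k \<le> K" by simp
      moreover have "m * (c / 2) * \<xi>m \<le> m * (c / 2) * \<xi> k"
        using \<xi>m(2)[OF k(1)] mp c by (intro mult_left_mono) auto
      ultimately have "m * (c / 2) * \<xi>m \<le> K" by linarith
      then have "m \<le> m1" using c \<xi>m(1) by (simp add: m1_def field_simps)
      then show ?thesis by simp
    qed
    moreover have "norm (u i T) / \<xi> i \<le> m" using ub[OF iI, of T] T \<xi>[OF iI] by (simp add: field_simps)
    ultimately show ?thesis by linarith
  qed
  define L where "L = max m0 m1 * (\<Sum>i\<in>I. \<xi> i)"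
  have "norm (w i t) \<le> L * exp (- (g * t))" if iI: "i \<in> I" and t: "t \<ge> 0" for i t
  proof -
    have "norm (u i t) \<le> max m0 m1 * \<xi> i" using main[OF that] \<xi>[OF iI] by (simp add: field_simps)
    also have "\<dots> \<le> L" unfolding L_def
    proof (intro mult_left_mono member_le_sum iI fin)
      show "0 \<le> max m0 m1" using main[OF iI, of 0] \<xi>[OF iI] order_trans[OF divide_nonneg_pos[OF norm_ge_zero]] by fastforce
    qed (use \<xi> in \<open>auto simp: less_imp_le\<close>)
    finally have "exp (- (g * t)) * norm (u i t) \<le> exp (- (g * t)) * L" by (intro mult_left_mono) auto
    moreover have "exp (- (g * t)) * norm (u i t) = norm (w i t)"
      by (simp add: u_def mult.assoc[symmetric] exp_add[symmetric])
    ultimately show ?thesis by (metis mult.commute)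
  qed
  then show ?thesis using g(1) unfolding exp_decaying_def by blast
qed (auto simp: exp_decaying_def intro: exI[of _ 1])

text \<open>An annihilating polynomial of M factors the system into scalar ones; each factor turns w
  into a network of the same form driven by the next one.\<close>
lemma network_decay:
  fixes w f :: "'i \<Rightarrow> real \<Rightarrow> complex^'n" and M :: "complex^'n^'n"
  assumes fin: "finite I" and a: "\<And>i j. i \<in> I \<Longrightarrow> j \<in> I \<Longrightarrow> a i j \<ge> 0"
    and \<xi>: "\<And>i. i \<in> I \<Longrightarrow> \<xi> i > 0" and c: "c > 0"
    and sup: "\<And>i. i \<in> I \<Longrightarrow> (\<Sum>j\<in>I. a i j * (\<xi> i - \<xi> j)) + b i * \<xi> i \<ge> c * \<xi> i"
    and spec: "\<And>l v. v \<noteq> 0 \<Longrightarrow> M *v v = l *s v \<Longrightarrow> Re l \<le> 0"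
    and der: "\<And>i t. i \<in> I \<Longrightarrow> t \<ge> 0 \<Longrightarrow> (w i has_vector_derivative
       (M *v w i t - (\<Sum>j\<in>I. a i j *\<^sub>R (w i t - w j t)) - b i *\<^sub>R w i t + f i t)) (at t within {0..})"
    and f: "exp_decaying I f"
  shows "exp_decaying I w"
proof -
  let ?T = "\<lambda>l x. M *v x - l *s x"
  obtain ls where ls: "\<And>l. l \<in> set ls \<Longrightarrow> \<exists>v. v \<noteq> 0 \<and> M *v v = l *s v" "\<And>v. foldr ?T ls v = 0"
    using annihilating_eigenvalue_list[of M] by metis
  have bl: "bounded_linear (?T l)" for l
  proof -
    have "linear (?T l)"
    proof (rule linearI)
      show "?T l (x + y) = ?T l x + ?T l y" for x y
        by (simp add: matrix_vector_right_distrib vector_add_ldistrib)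
      show "?T l (r *\<^sub>R x) = r *\<^sub>R ?T l x" for r x
        unfolding matrix_vector_scaleR by (simp add: vec_eq_iff scaleR_diff_right)
    qed
    then show ?thesis by (simp add: linear_conv_bounded_linear)
  qed
  have "exp_decaying I w" if "\<And>l. l \<in> set ls \<Longrightarrow> Re l \<le> 0" "\<And>i t. i \<in> I \<Longrightarrow> t \<ge> 0 \<Longrightarrow> foldr ?T ls (w i t) = 0"
    "\<And>i t. i \<in> I \<Longrightarrow> t \<ge> 0 \<Longrightarrow> (w i has_vector_derivative
       (M *v w i t - (\<Sum>j\<in>I. a i j *\<^sub>R (w i t - w j t)) - b i *\<^sub>R w i t + f i t)) (at t within {0..})"
    "exp_decaying I f" for ls w f
    using that
  proof (induction ls arbitrary: w f)
    case Nil
    then show ?case by (auto simp: exp_decaying_def intro!: exI[of _ 1])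
  next
    case (Cons l ls)
    let ?w = "\<lambda>i t. ?T l (w i t)" and ?f = "\<lambda>i t. ?T l (f i t)"
    have "exp_decaying I ?w"
    proof (rule Cons.IH)
      show "Re k \<le> 0" if "k \<in> set ls" for k using Cons.prems(1) that by simp
      show "foldr ?T ls (?w i t) = 0" if "i \<in> I" "t \<ge> 0" for i t
        using Cons.prems(2)[OF that] unfolding foldr_shift_commute by simp
      show "exp_decaying I ?f" by (rule exp_decaying_bounded_linear[OF Cons.prems(4) bl])
      show "(?w i has_vector_derivative
        (M *v ?w i t - (\<Sum>j\<in>I. a i j *\<^sub>R (?w i t - ?w j t)) - b i *\<^sub>R ?w i t + ?f i t)) (at t within {0..})"
        if it: "i \<in> I" "t \<ge> 0" for i t
      proof (rule has_vector_derivative_eq_rhs[OF bounded_linear.has_vector_derivative[OF bl Cons.prems(3)[OF it]]])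
        interpret T: bounded_linear "?T l" by (rule bl)
        have "?T l (M *v w i t) = M *v ?w i t"
          by (simp add: matrix_vector_mult_diff_distrib vector_scalar_commute)
        then show "?T l (M *v w i t - (\<Sum>j\<in>I. a i j *\<^sub>R (w i t - w j t)) - b i *\<^sub>R w i t + f i t)
          = M *v ?w i t - (\<Sum>j\<in>I. a i j *\<^sub>R (?w i t - ?w j t)) - b i *\<^sub>R ?w i t + ?f i t"
          by (simp only: T.add T.diff T.sum T.scaleR)
      qed
    qed
    then have decay: "exp_decaying I (\<lambda>i t. ?w i t + f i t)" using Cons.prems(4) by (rule exp_decaying_add)
    \<comment> \<open>Writing M w as l w + \<open>?w\<close> moves the part that is already known to
      decay into the forcing.\<close>
    show ?case
    proof (rule scalar_network_decay[OF fin a \<xi> c sup _ _ decay])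
      show "Re l \<le> 0" using Cons.prems(1) by simp
      show "(w i has_vector_derivative
        (l *s w i t - (\<Sum>j\<in>I. a i j *\<^sub>R (w i t - w j t)) - b i *\<^sub>R w i t + (?w i t + f i t))) (at t within {0..})"
        if it: "i \<in> I" "t \<ge> 0" for i t
        by (rule has_vector_derivative_eq_rhs[OF Cons.prems(3)[OF it]]) simp
    qed auto
  qed
  from this[of ls w f] show ?thesis using ls spec der f by blast
qed

text \<open>A network with zero weights: moving the spectral margin \<open>c\<close> from H into the
  damping leaves H + c I with spectrum in the closed left half plane, and the constant 1 is a
  supersolution.\<close>

lemma hurwitz_decay:
  fixes H :: "real^'n^'n" and e :: "'i \<Rightarrow> real \<Rightarrow> complex^'n"
  assumes H: "hurwitz H" and fin: "finite I"
    and der: "\<And>i t. i \<in> I \<Longrightarrow> t \<ge> 0 \<Longrightarrow> (e i has_vector_derivative cmat H *v e i t) (at t within {0..})"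
  shows "exp_decaying I e"
proof -
  let ?E = "{z. is_eigenvalue H z}"
  define c where "c = Min (insert 1 ((\<lambda>z. - Re z) ` ?E))"
  have fE: "finite ((\<lambda>z. - Re z) ` ?E)" using finite_eigenvalues by blast
  have c: "c > 0" unfolding c_def using fE H by (subst Min_gr_iff) (auto simp: hurwitz_def)
  have cle: "Re z \<le> - c" if "is_eigenvalue H z" for z
  proof -
    have "c \<le> - Re z" unfolding c_def using fE that by (intro Min_le) auto
    then show ?thesis by simp
  qed
  have M: "cmat (H + c *\<^sub>R mat 1) *v v = cmat H *v v + c *\<^sub>R v" for v
    unfolding cmat_add matrix_vector_mult_add_rdistrib cmat_scaleR_mult cmat_mat_1_mult ..
  show ?thesis
  proof (rule network_decay[OF fin, where a = "\<lambda>_ _. 0" and \<xi> = "\<lambda>_. 1" and b = "\<lambda>_. c" and f = "\<lambda>_ _. 0"])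
    show "Re l \<le> 0" if v: "v \<noteq> 0" "cmat (H + c *\<^sub>R mat 1) *v v = l *s v" for l v
    proof -
      have "cmat H *v v = (l - of_real c) *s v"
        using v(2) unfolding M by (simp add: vec_eq_iff scaleR_conv_of_real[where 'a=complex] algebra_simps)
      then have "is_eigenvalue H (l - of_real c)" unfolding is_eigenvalue_iff using v(1) by blast
      then show ?thesis using cle by fastforce
    qed
    show "(e i has_vector_derivative cmat (H + c *\<^sub>R mat 1) *v e i t - (\<Sum>j\<in>I. 0 *\<^sub>R (e i t - e j t)) - c *\<^sub>R e i t + 0) (at t within {0..})"
      if "i \<in> I" "t \<ge> 0" for i t
      by (rule has_vector_derivative_eq_rhs[OF der[OF that]]) (simp add: M)
    show "exp_decaying I (\<lambda>_ _. 0 :: complex^'n)" unfolding exp_decaying_def by (intro exI[of _ 1]) auto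
  qed (use c in auto)
qed

section \<open>A positive supersolution of the grounded Laplacian\<close>

text \<open>\<open>\<xi>\<close> increases with the distance from \<open>Cs\<close> as 1 - \<kappa>
  \<theta>^distance. The increments shrink geometrically, so the gain over a neighbour nearer to
  \<open>Cs\<close> outweighs the total loss against all others; nodes in \<open>Cs\<close> are paid
  for by the term with \<open>iota\<close>.\<close>

lemma in_GC_supersolution:
  assumes G: "in_GC N Cs a"
  obtains \<xi> c where "c > 0" "\<And>i. i \<in> {1..N} \<Longrightarrow> \<xi> i > 0"
    "\<And>i. i \<in> {1..N} \<Longrightarrow> (\<Sum>j\<in>{1..N}. a i j * (\<xi> i - \<xi> j)) + iota Cs i * \<xi> i \<ge> c * \<xi> i"
proof -
  let ?I = "{1..N}"
  have a0: "\<And>i j. i \<in> ?I \<Longrightarrow> j \<in> ?I \<Longrightarrow> a i j \<ge> 0" using G unfolding in_GC_def by blast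
  \<comment> \<open>Nodes reached from \<open>Cs\<close> by k edges, so that \<open>lv\<close> below
    is the distance from \<open>Cs\<close>; following parents in the directed tree shows that it is
    defined for every node.\<close>
  define R where "R = rec_nat Cs (\<lambda>_ X. {i \<in> ?I. \<exists>j\<in>?I. j \<in> X \<and> a i j > 0})"
  have R0: "R 0 = Cs" and RS: "R (Suc k) = {i \<in> ?I. \<exists>j\<in>?I. j \<in> R k \<and> a i j > 0}" for k
    by (simp_all add: R_def)
  have ex: "\<exists>k. i \<in> R k" if i: "i \<in> ?I" for i
  proof -
    obtain V r par where V: "V \<subseteq> ?I" "i \<in> V" "r \<in> Cs" "directed_tree a V r par"
      using G i unfolding in_GC_def by blast
    have par: "\<And>v. v \<in> V \<Longrightarrow> v \<noteq> r \<Longrightarrow> par v \<in> V \<and> a v (par v) > 0"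
      and root: "\<And>v. v \<in> V \<Longrightarrow> \<exists>k. (par ^^ k) v = r"
      using V(4) unfolding directed_tree_def by blast+
    have "v \<in> V \<Longrightarrow> (par ^^ k) v = r \<Longrightarrow> \<exists>m. v \<in> R m" for k v
    proof (induction k arbitrary: v)
      case 0
      then show ?case using V(3) R0 by (auto intro!: exI[of _ 0])
    next
      case (Suc k)
      show ?case
      proof (cases "v = r")
        case True
        then show ?thesis using V(3) R0 by (auto intro!: exI[of _ 0])
      next
        case False
        have p: "par v \<in> V" "a v (par v) > 0" using par[OF Suc.prems(1) False] by auto
        moreover have "(par ^^ k) (par v) = r" using Suc.prems(2) by (simp add: funpow_swap1)
        ultimately obtain m where "par v \<in> R m" using Suc.IH by blast
        then have "v \<in> R (Suc m)" unfolding RS using p V(1) Suc.prems(1) by blast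
        then show ?thesis by blast
      qed
    qed
    then show ?thesis using root[OF V(2)] V(2) by blast
  qed
  define lv where "lv = (\<lambda>i. LEAST k. i \<in> R k)"
  have lvR: "i \<in> R (lv i)" if "i \<in> ?I" for i
    unfolding lv_def using ex[OF that] by (rule LeastI_ex)
  have lvle: "lv i \<le> k" if "i \<in> R k" for i k
    unfolding lv_def using that by (rule Least_le)
  have lvC: "lv i = 0" if "i \<in> Cs" for i using lvle[of i 0] that R0 by simp
  have parent: "\<exists>j\<in>?I. a i j > 0 \<and> lv i = Suc m \<and> lv j \<le> m" if i: "i \<in> ?I" "i \<notin> Cs" "m = lv i - 1" for i m
  proof -
    have "lv i \<noteq> 0" using lvR[OF i(1)] i(2) R0 by metis
    then have "lv i = Suc m" using i(3) by simp
    then have "i \<in> R (Suc m)" using lvR[OF i(1)] by simp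
    then obtain j where "j \<in> ?I" "j \<in> R m" "a i j > 0" unfolding RS by blast
    then show ?thesis using lvle[of j m] \<open>lv i = Suc m\<close> by blast
  qed
  define S where "S = (\<Sum>i\<in>?I. \<Sum>j\<in>?I. a i j)"
  have S0: "S \<ge> 0" unfolding S_def by (intro sum_nonneg a0)
  have rowS: "(\<Sum>j\<in>?I. a i j) \<le> S" if "i \<in> ?I" for i
    unfolding S_def using that a0 by (intro member_le_sum[where f = "\<lambda>i. \<Sum>j\<in>?I. a i j"]) (auto intro!: sum_nonneg)
  define A where "A = insert 1 {a i j |i j. i \<in> ?I \<and> j \<in> ?I \<and> a i j > 0}"
  have "{a i j |i j. i \<in> ?I \<and> j \<in> ?I \<and> a i j > 0} \<subseteq> (\<lambda>(i, j). a i j) ` (?I \<times> ?I)" by auto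
  then have finA: "finite A" unfolding A_def by (simp add: finite_subset)
  define \<alpha> where "\<alpha> = Min A"
  have \<alpha>: "\<alpha> > 0" unfolding \<alpha>_def using finA by (subst Min_gr_iff) (auto simp: A_def)
  have \<alpha>le: "\<alpha> \<le> a i j" if "i \<in> ?I" "j \<in> ?I" "a i j > 0" for i j
    unfolding \<alpha>_def by (rule Min_le[OF finA]) (use that in \<open>auto simp: A_def\<close>)
  \<comment> \<open>Gives \<alpha> (1 - \<theta>) - S \<theta> = \<theta> > 0, so one edge of the
    smallest positive weight compensates all weights of a row.\<close>
  define \<theta> where "\<theta> = \<alpha> / (\<alpha> + S + 1)"
  have \<theta>: "0 < \<theta>" "\<theta> < 1" using \<alpha> S0 by (auto simp: \<theta>_def)
  have \<theta>S: "\<alpha> * (1 - \<theta>) - S * \<theta> > 0"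
  proof -
    have "\<theta> * (\<alpha> + S + 1) = \<alpha>" using \<alpha> S0 by (simp add: \<theta>_def)
    then show ?thesis using \<theta>(1) by (simp add: algebra_simps)
  qed
  \<comment> \<open>With \<kappa> (S + 1) = 1/2, a node of \<open>Cs\<close> has 1 - \<kappa> from
    its own term against a loss of at most \<kappa> S.\<close>
  define \<kappa> where "\<kappa> = 1 / (2 * (S + 1))"
  have \<kappa>: "\<kappa> > 0" "\<kappa> * (S + 1) = 1 / 2" "\<kappa> \<le> 1 / 2" using S0 by (auto simp: \<kappa>_def field_simps)
  define \<xi> where "\<xi> = (\<lambda>i. 1 - \<kappa> * \<theta> ^ lv i)"
  have \<theta>p: "0 < \<theta> ^ k" "\<theta> ^ k \<le> 1" for k using \<theta> by (auto intro: power_le_one)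
  have \<xi>p: "\<xi> i > 0" for i
  proof -
    have "\<kappa> * \<theta> ^ lv i \<le> \<kappa> * 1" using \<kappa> \<theta>p by (intro mult_left_mono) auto
    then show ?thesis using \<kappa>(3) by (simp add: \<xi>_def)
  qed
  define h where "h = (\<lambda>i. (\<Sum>j\<in>?I. a i j * (\<xi> i - \<xi> j)) + iota Cs i * \<xi> i)"
  have hp: "h i > 0" if i: "i \<in> ?I" for i
  proof (cases "i \<in> Cs")
    case True
    have "(\<Sum>j\<in>?I. a i j * (\<xi> i - \<xi> j)) \<ge> (\<Sum>j\<in>?I. a i j * (- \<kappa>))"
    proof (intro sum_mono mult_left_mono a0 i)
      fix j
      show "- \<kappa> \<le> \<xi> i - \<xi> j" using True lvC \<kappa> \<theta>p[of "lv j"] by (simp add: \<xi>_def)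
    qed
    moreover have "(\<Sum>j\<in>?I. a i j * (- \<kappa>)) = - (\<kappa> * (\<Sum>j\<in>?I. a i j))"
      by (simp add: sum_distrib_left sum_negf mult.commute)
    moreover have "\<kappa> * (\<Sum>j\<in>?I. a i j) \<le> \<kappa> * S" using rowS[OF i] \<kappa> by (intro mult_left_mono) auto
    moreover have "iota Cs i * \<xi> i = 1 - \<kappa>" using True lvC by (simp add: iota_def \<xi>_def)
    ultimately have "h i \<ge> 1 - \<kappa> * (S + 1)" unfolding h_def by (simp add: algebra_simps)
    then show ?thesis using \<kappa>(2) by simp
  next
    case False
    define m where "m = lv i - 1"
    obtain k where k: "k \<in> ?I" "a i k > 0" "lv i = Suc m" "lv k \<le> m" using parent[OF i False m_def] by blast
    have "h i = (\<Sum>j\<in>?I. a i j * (\<xi> i - \<xi> j))" using False by (simp add: h_def iota_def)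
    also have "\<dots> = a i k * (\<xi> i - \<xi> k) + (\<Sum>j\<in>?I - {k}. a i j * (\<xi> i - \<xi> j))"
      by (rule sum.remove) (use k in auto)
    also have "\<dots> \<ge> \<alpha> * (\<kappa> * \<theta> ^ m * (1 - \<theta>)) + (\<Sum>j\<in>?I - {k}. a i j * (- (\<kappa> * \<theta> ^ Suc m)))"
    proof (intro add_mono sum_mono mult_left_mono mult_mono)
      show "\<alpha> \<le> a i k" using \<alpha>le[OF i k(1,2)] .
      have "\<theta> ^ m \<le> \<theta> ^ lv k" using k(4) \<theta> by (intro power_decreasing) auto
      then have "\<kappa> * \<theta> ^ m \<le> \<kappa> * \<theta> ^ lv k" using \<kappa> by (intro mult_left_mono) auto
      then show "\<kappa> * \<theta> ^ m * (1 - \<theta>) \<le> \<xi> i - \<xi> k"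
        using k(3) by (simp add: \<xi>_def algebra_simps)
      show "- (\<kappa> * \<theta> ^ Suc m) \<le> \<xi> i - \<xi> j" for j
        using k(3) \<kappa> \<theta>p[of "lv j"] by (simp add: \<xi>_def less_imp_le)
    qed (use a0 i k \<alpha> \<kappa> \<theta> \<theta>p in \<open>auto simp: less_imp_le\<close>)
    also have "(\<Sum>j\<in>?I - {k}. a i j * (- (\<kappa> * \<theta> ^ Suc m))) = - (\<kappa> * \<theta> ^ Suc m * (\<Sum>j\<in>?I - {k}. a i j))"
      by (simp add: sum_distrib_left sum_negf mult.commute mult.left_commute)
    finally have "h i \<ge> \<alpha> * (\<kappa> * \<theta> ^ m * (1 - \<theta>)) - \<kappa> * \<theta> ^ Suc m * (\<Sum>j\<in>?I - {k}. a i j)" by simp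
    moreover have "\<kappa> * \<theta> ^ Suc m * (\<Sum>j\<in>?I - {k}. a i j) \<le> \<kappa> * \<theta> ^ Suc m * S"
    proof (rule mult_left_mono)
      have "(\<Sum>j\<in>?I - {k}. a i j) \<le> (\<Sum>j\<in>?I. a i j)" using a0 i by (intro sum_mono2) auto
      then show "(\<Sum>j\<in>?I - {k}. a i j) \<le> S" using rowS[OF i] by linarith
    qed (use \<kappa> \<theta> in auto)
    ultimately have "h i \<ge> \<kappa> * \<theta> ^ m * (\<alpha> * (1 - \<theta>) - S * \<theta>)" by (simp add: algebra_simps)
    moreover have "\<kappa> * \<theta> ^ m * (\<alpha> * (1 - \<theta>) - S * \<theta>) > 0" using \<kappa> \<theta>p \<theta>S by simp
    ultimately show ?thesis by linarith
  qed
  define c where "c = Min (insert 1 ((\<lambda>i. h i / \<xi> i) ` ?I))"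
  have "c > 0" unfolding c_def using hp \<xi>p by (subst Min_gr_iff) auto
  moreover have "c * \<xi> i \<le> h i" if "i \<in> ?I" for i
  proof -
    have "c \<le> h i / \<xi> i" unfolding c_def using that by (intro Min_le) auto
    then show ?thesis using \<xi>p[of i] by (simp add: field_simps)
  qed
  ultimately show thesis using \<xi>p that unfolding h_def by blast
qed

section \<open>Synchronization\<close>

definition cvec :: "real^'n \<Rightarrow> complex^'n" where
  "cvec x = (\<chi> i. of_real (x $ i))"

lemma norm_cvec: "norm (cvec x) = norm x"
  by (simp add: norm_vec_def cvec_def)

lemma bounded_linear_cvec: "bounded_linear cvec"
proof (rule bounded_linear_intro[where K = 1])
  show "cvec (x + y) = cvec x + cvec y" for x y :: "real^'n" by (simp add: cvec_def vec_eq_iff)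
  show "cvec (r *\<^sub>R x) = r *\<^sub>R cvec x" for r and x :: "real^'n"
    by (simp add: cvec_def vec_eq_iff scaleR_conv_of_real[where 'a=complex])
qed (simp add: norm_cvec)

lemma cvec_matrix_vector: "cvec (M *v x) = cmat M *v cvec x"
  by (simp add: cvec_def cmat_def matrix_vector_mult_def vec_eq_iff)

lemma matrix_vector_laplacian:
  fixes M :: "real^'n^'m"
  shows "M *v (\<Sum>j\<in>I. a j *\<^sub>R (p - q j)) = (\<Sum>j\<in>I. a j *\<^sub>R (M *v p - M *v q j))"
proof -
  have "linear ((*v) M)" by simp
  then show ?thesis by (simp add: linear_sum linear_cmul linear_diff)
qed

lemma closed_loop_synchronizes:
  fixes A :: "real^'n^'n" and B :: "real^'m^'n" and C :: "real^'n^'q" and K :: "real^'q^'n"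
  assumes spec: "\<forall>z. is_eigenvalue A z \<longrightarrow> Re z \<le> 0" and HK: "hurwitz (A - K ** C)"
    and G: "in_GC N Cs a" and \<tau>: "\<And>i. i \<in> {1..N} \<Longrightarrow> 0 \<le> \<tau> i \<and> \<tau> i \<le> \<tau>bar"
    and cl: "closed_loop A B C K \<rho> P N Cs a \<tau> \<tau>bar x xh chi xr"
    and nz: "\<And>i s. i \<in> {1..N} \<Longrightarrow> Re s \<ge> 0 \<Longrightarrow>
      det (dde_matrix (cmat A) (cmat (- (\<rho> *\<^sub>R (B ** transpose B ** P)))) (\<tau> i) s) \<noteq> 0"
    and i: "i \<in> {1..N}"
  shows "((\<lambda>t. x i t - xr t) \<longlongrightarrow> 0) at_top"
proof -
  let ?I = "{1..N}"
  define u where "u = (\<lambda>i t. - (\<rho> *\<^sub>R ((transpose B ** P) *v chi i t)))"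
  let ?x = "\<lambda>i t. A *v x i t + B *v u i (t - \<tau> i)"
  have xd: "(x i has_vector_derivative (?x i t)) (at t within {0..})"
    and xhd: "(xh i has_vector_derivative
        (A *v xh i t + B *v (\<Sum>j\<in>?I. a i j *\<^sub>R (u i (t - \<tau> i) - u j (t - \<tau> j)))
         + K *v ((\<Sum>j\<in>?I. a i j *\<^sub>R (C *v x i t - C *v x j t)) + iota Cs i *\<^sub>R (C *v x i t - C *v xr t) - C *v xh i t)
         + iota Cs i *\<^sub>R (B *v u i (t - \<tau> i)))) (at t within {0..})"
    and chid: "(chi i has_vector_derivative
        (A *v chi i t + B *v u i (t - \<tau> i) + xh i t - (\<Sum>j\<in>?I. a i j *\<^sub>R (chi i t - chi j t)) - iota Cs i *\<^sub>R chi i t))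
        (at t within {0..})"
    if "i \<in> ?I" "t \<ge> 0" for i t
    using cl that unfolding closed_loop_def Let_def u_def[symmetric] by blast+
  have xrd: "(xr has_vector_derivative A *v xr t) (at t within {0..})" if "t \<ge> 0" for t
    using cl that unfolding closed_loop_def Let_def by blast
  \<comment> \<open>The combination of states whose image under C is the measured signal;
    \<open>xh\<close> is a Luenberger observer for it.\<close>
  define S where "S = (\<lambda>i t. (\<Sum>j\<in>?I. a i j *\<^sub>R (x i t - x j t)) + iota Cs i *\<^sub>R (x i t - xr t))"
  define e where "e = (\<lambda>i t. xh i t - S i t)"
  define d where "d = (\<lambda>i t. x i t - xr t - chi i t)"
  have Sd: "(S i has_vector_derivative
      (\<Sum>j\<in>?I. a i j *\<^sub>R (?x i t - ?x j t))
      + iota Cs i *\<^sub>R (?x i t - A *v xr t)) (at t within {0..})"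
    if "i \<in> ?I" "t \<ge> 0" for i t
    unfolding S_def
    by (intro has_vector_derivative_add has_vector_derivative_sum has_vector_derivative_diff xd xrd that
        bounded_linear.has_vector_derivative[OF bounded_linear_scaleR_right])
  \<comment> \<open>The delayed inputs driving \<open>S\<close> are exactly the exchanged ones fed
    to the observer, so they cancel for any delays.\<close>
  have ed: "(e i has_vector_derivative (A - K ** C) *v e i t) (at t within {0..})" if it: "i \<in> ?I" "t \<ge> 0" for i t
    unfolding e_def
  proof (rule has_vector_derivative_eq_rhs[OF has_vector_derivative_diff[OF xhd[OF it] Sd[OF it]]])
    have CS: "(\<Sum>j\<in>?I. a i j *\<^sub>R (C *v x i t - C *v x j t)) + iota Cs i *\<^sub>R (C *v x i t - C *v xr t) = C *v S i t"
      unfolding S_def by (simp add: matrix_vector_right_distrib matrix_vector_laplacian matrix_vector_mult_scaleR matrix_vector_mult_diff_distrib)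
    have AS: "A *v S i t = (\<Sum>j\<in>?I. a i j *\<^sub>R (A *v x i t - A *v x j t)) + iota Cs i *\<^sub>R (A *v x i t - A *v xr t)"
      unfolding S_def by (simp add: matrix_vector_right_distrib matrix_vector_laplacian matrix_vector_mult_scaleR matrix_vector_mult_diff_distrib)
    have BS: "(\<Sum>j\<in>?I. a i j *\<^sub>R (?x i t - ?x j t))
      = (\<Sum>j\<in>?I. a i j *\<^sub>R (A *v x i t - A *v x j t)) + B *v (\<Sum>j\<in>?I. a i j *\<^sub>R (u i (t - \<tau> i) - u j (t - \<tau> j)))"
      unfolding matrix_vector_laplacian sum.distrib[symmetric] scaleR_add_right[symmetric]
      by (simp add: algebra_simps)
    show "A *v xh i t + B *v (\<Sum>j\<in>?I. a i j *\<^sub>R (u i (t - \<tau> i) - u j (t - \<tau> j)))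
         + K *v ((\<Sum>j\<in>?I. a i j *\<^sub>R (C *v x i t - C *v x j t)) + iota Cs i *\<^sub>R (C *v x i t - C *v xr t) - C *v xh i t)
         + iota Cs i *\<^sub>R (B *v u i (t - \<tau> i))
       - ((\<Sum>j\<in>?I. a i j *\<^sub>R (?x i t - ?x j t))
      + iota Cs i *\<^sub>R (?x i t - A *v xr t)) = (A - K ** C) *v (xh i t - S i t)"
      unfolding CS BS matrix_vector_mult_diff_rdistrib matrix_vector_mult_diff_distrib matrix_vector_mul_assoc[symmetric] AS
      by (simp add: algebra_simps)
  qed
  \<comment> \<open>Agent and \<open>chi\<close> receive the same delayed input, which drops out;
    with \<open>xh\<close> = e + S the remaining differences assemble into the grounded Laplacian of
    \<open>d\<close>.\<close>
  have dd: "(d i has_vector_derivative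
      (A *v d i t - (\<Sum>j\<in>?I. a i j *\<^sub>R (d i t - d j t)) - iota Cs i *\<^sub>R d i t + (- e i t))) (at t within {0..})"
    if it: "i \<in> ?I" "t \<ge> 0" for i t
    unfolding d_def
  proof (rule has_vector_derivative_eq_rhs[OF has_vector_derivative_diff[OF has_vector_derivative_diff[OF xd[OF it] xrd[OF it(2)]] chid[OF it]]])
    have L: "(\<Sum>j\<in>?I. a i j *\<^sub>R (x i t - x j t)) - (\<Sum>j\<in>?I. a i j *\<^sub>R (chi i t - chi j t))
      = (\<Sum>j\<in>?I. a i j *\<^sub>R (x i t - xr t - chi i t - (x j t - xr t - chi j t)))"
      unfolding sum_subtractf[symmetric] scaleR_diff_right[symmetric] by (simp add: algebra_simps)
    have xhe: "xh i t = e i t + S i t" by (simp add: e_def)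
    show "?x i t - A *v xr t
       - (A *v chi i t + B *v u i (t - \<tau> i) + xh i t - (\<Sum>j\<in>?I. a i j *\<^sub>R (chi i t - chi j t)) - iota Cs i *\<^sub>R chi i t)
       = A *v (x i t - xr t - chi i t) - (\<Sum>j\<in>?I. a i j *\<^sub>R (x i t - xr t - chi i t - (x j t - xr t - chi j t)))
         - iota Cs i *\<^sub>R (x i t - xr t - chi i t) + - e i t"
      unfolding xhe L[symmetric] unfolding S_def by (simp add: algebra_simps)
  qed
  note cder = bounded_linear.has_vector_derivative[OF bounded_linear_cvec]
  interpret cv: bounded_linear "cvec :: real^'n \<Rightarrow> complex^'n" by (rule bounded_linear_cvec)
  have "exp_decaying ?I (\<lambda>i t. cvec (e i t))"
    by (rule hurwitz_decay[OF HK]) (use cder[OF ed] in \<open>auto simp: cvec_matrix_vector\<close>)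
  then have decay_e: "exp_decaying ?I (\<lambda>i t. - cvec (e i t))"
    by (rule exp_decaying_bounded_linear) (rule bounded_linear_minus[OF bounded_linear_ident])
  obtain \<xi> c where \<xi>: "c > 0" "\<And>i. i \<in> ?I \<Longrightarrow> \<xi> i > 0"
    "\<And>i. i \<in> ?I \<Longrightarrow> (\<Sum>j\<in>?I. a i j * (\<xi> i - \<xi> j)) + iota Cs i * \<xi> i \<ge> c * \<xi> i"
    using in_GC_supersolution[OF G] by metis
  have decay_d: "exp_decaying ?I (\<lambda>i t. cvec (d i t))"
  proof (rule network_decay[OF _ _ \<xi>(2,1,3) _ _ decay_e])
    show "finite ?I" by simp
    show "a i j \<ge> 0" if "i \<in> ?I" "j \<in> ?I" for i j using G that unfolding in_GC_def by blast
    show "Re l \<le> 0" if "v \<noteq> 0" "cmat A *v v = l *s v" for l v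
      using spec that unfolding is_eigenvalue_iff by blast
    show "((\<lambda>t. cvec (d i t)) has_vector_derivative (cmat A *v cvec (d i t)
       - (\<Sum>j\<in>?I. a i j *\<^sub>R (cvec (d i t) - cvec (d j t))) - iota Cs i *\<^sub>R cvec (d i t) + - cvec (e i t))) (at t within {0..})"
      if "i \<in> ?I" "t \<ge> 0" for i t
      by (rule has_vector_derivative_eq_rhs[OF cder[OF dd[OF that]]])
        (simp only: cv.add cv.diff cv.sum cv.scaleR cv.neg cvec_matrix_vector)
  qed auto
  define Q where "Q = \<rho> *\<^sub>R (B ** transpose B ** P)"
  \<comment> \<open>The advance by \<tau> i places the history of \<open>z\<close> in times from 0
    on, where \<open>x\<close> and \<open>xr\<close> are differentiable, and evaluates the feedback
    at t >= 0, where the decay of \<open>d\<close> is known.\<close>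
  define z where "z = (\<lambda>t. cvec (x i (t + \<tau> i) - xr (t + \<tau> i)))"
  define f where "f = (\<lambda>t. cmat Q *v cvec (d i t))"
  have \<tau>i: "\<tau> i \<ge> 0" using \<tau>[OF i] by simp
  have cont_x: "continuous_on {0..} (x i)" by (rule continuous_on_vector_derivative) (use xd[OF i] in auto)
  have cont_xr: "continuous_on {0..} xr" by (rule continuous_on_vector_derivative) (use xrd in auto)
  have cont_d: "continuous_on {0..} (d i)" by (rule continuous_on_vector_derivative) (use dd[OF i] in auto)
  have cont_z: "continuous_on {- \<tau> i..} z"
    unfolding z_def
    by (intro bounded_linear.continuous_on[OF bounded_linear_cvec] continuous_on_diff
        continuous_on_compose2[OF cont_x] continuous_on_compose2[OF cont_xr] continuous_intros) auto
  have cont_f: "continuous_on {0..} f"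
    unfolding f_def by (intro continuous_intros bounded_linear.continuous_on[OF bounded_linear_cvec] cont_d)
  have "exp_decaying ?I (\<lambda>i t. cmat Q *v cvec (d i t))"
    by (rule exp_decaying_bounded_linear[OF decay_d]) simp
  then obtain Kf \<gamma> where \<gamma>: "\<gamma> > 0" and fb: "\<And>t. t \<ge> 0 \<Longrightarrow> norm (f t) \<le> Kf * exp (- (\<gamma> * t))"
    unfolding exp_decaying_def f_def using i by blast
  have "(z \<longlongrightarrow> 0) at_top"
  proof (rule dde_tendsto_zero[OF \<tau>i cont_z _ cont_f fb \<gamma> nz[OF i]])
    fix t :: real assume t: "t \<ge> 0"
    have t': "t + \<tau> i \<ge> 0" using t \<tau>i by simp
    \<comment> \<open>Substituting (x - xr) - d for \<open>chi\<close> splits the input into the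
      feedback of the delay equation and the forcing \<open>f\<close>.\<close>
    have "B *v u i t = - (Q *v (x i t - xr t)) + Q *v d i t"
    proof -
      have "B *v u i t = - (Q *v chi i t)"
        by (simp add: u_def Q_def scaleR_matrix_vector_assoc[symmetric] matrix_vector_mult_scaleR
            matrix_vector_mul_assoc matrix_mul_assoc linear_neg)
      also have "chi i t = (x i t - xr t) - d i t" by (simp add: d_def)
      finally show ?thesis by (simp add: matrix_vector_mult_diff_distrib)
    qed
    then have rhs: "A *v x i (t + \<tau> i) + B *v u i (t + \<tau> i - \<tau> i) - A *v xr (t + \<tau> i)
      = A *v (x i (t + \<tau> i) - xr (t + \<tau> i)) + (- (Q *v (x i t - xr t)) + Q *v d i t)"
      by (simp add: matrix_vector_mult_diff_distrib)
    show "(z has_vector_derivative cmat A *v z t + cmat (- (\<rho> *\<^sub>R (B ** transpose B ** P))) *v z (t - \<tau> i) + f t) (at t within {0..})"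
      unfolding z_def
    proof (rule has_vector_derivative_eq_rhs[OF cder[OF has_vector_derivative_diff[OF has_vector_derivative_shift[OF xd[OF i t'] \<tau>i] has_vector_derivative_shift[OF xrd[OF t'] \<tau>i]]]])
      have neg: "cmat (- Q) *v y = - (cmat Q *v y)" for y
        using cmat_scaleR_mult[of "-1" Q y] by simp
      show "cvec (A *v x i (t + \<tau> i) + B *v u i (t + \<tau> i - \<tau> i) - A *v xr (t + \<tau> i))
        = cmat A *v cvec (x i (t + \<tau> i) - xr (t + \<tau> i))
          + cmat (- (\<rho> *\<^sub>R (B ** transpose B ** P))) *v cvec (x i (t - \<tau> i + \<tau> i) - xr (t - \<tau> i + \<tau> i)) + f t"
        unfolding rhs Q_def[symmetric] neg f_def cv.add cv.neg cvec_matrix_vector by simp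
    qed
  qed
  then have "((\<lambda>t. norm (x i (t + \<tau> i) - xr (t + \<tau> i))) \<longlongrightarrow> 0) at_top"
    using tendsto_norm_zero unfolding z_def by (fastforce simp: norm_cvec)
  then have "((\<lambda>t. x i (t + \<tau> i) - xr (t + \<tau> i)) \<longlongrightarrow> 0) at_top"
    by (rule tendsto_norm_zero_cancel)
  then show ?thesis by (rule tendsto_at_top_unshift)
qed

theorem theorem2:
  fixes A :: "real^'n^'n" and B :: "real^'m^'n" and C :: "real^'n^'q" and \<tau>bar :: real
  assumes "stabilizable A B" and "detectable C A"
    and "\<forall>z. is_eigenvalue A z \<longrightarrow> Re z \<le> 0"
    and "\<tau>bar \<ge> 0" and "\<tau>bar * omega_max A < pi / 2"
  shows "\<exists>\<rho>>1. \<exists>\<epsilon>s>0. \<forall>(K :: real^'q^'n) \<epsilon> (P :: real^'n^'n) N Cs a \<tau> x xh chi xr.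
    hurwitz (A - K ** C) \<and> 0 < \<epsilon> \<and> \<epsilon> \<le> \<epsilon>s \<and>
    pos_def P \<and> transpose A ** P + P ** A - P ** B ** transpose B ** P + \<epsilon> *\<^sub>R mat 1 = 0 \<and>
    N \<ge> 1 \<and> Cs \<noteq> {} \<and> in_GC N Cs a \<and>
    (\<forall>i\<in>{1..N}. 0 \<le> \<tau> i \<and> \<tau> i \<le> \<tau>bar) \<and>
    closed_loop A B C K \<rho> P N Cs a \<tau> \<tau>bar x xh chi xr
    \<longrightarrow> (\<forall>i\<in>{1..N}. ((\<lambda>t. x i t - xr t) \<longlongrightarrow> 0) at_top)"
proof -
  \<comment> \<open>The exclusion of roots is uniform over all admissible delays, so both constants
    are fixed before \<open>K\<close>, the graph and the delays.\<close>
  obtain \<rho> \<epsilon>s where \<rho>: "\<rho> > 1" and \<epsilon>s: "\<epsilon>s > 0" and nz: "\<forall>\<epsilon> P \<tau> s. 0 < \<epsilon> \<and> \<epsilon> \<le> \<epsilon>s \<and> pos_def P \<and>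
    riccati A B \<epsilon> P \<and> 0 \<le> \<tau> \<and> \<tau> \<le> \<tau>bar \<and> 0 \<le> Re s \<longrightarrow>
    det (dde_matrix (cmat A) (cmat (- (\<rho> *\<^sub>R (B ** transpose B ** P)))) \<tau> s) \<noteq> 0"
    using low_gain_zero_free[OF assms(1,3,4,5)] by (elim exE conjE) (rule that)
  show ?thesis
  proof (intro exI[of _ \<rho>] exI[of _ \<epsilon>s] conjI \<rho> \<epsilon>s allI impI ballI; elim conjE)
    fix K :: "real^'q^'n" and \<epsilon> and P :: "real^'n^'n" and N Cs a \<tau> x xh chi xr i
    assume h: "hurwitz (A - K ** C)" "0 < \<epsilon>" "\<epsilon> \<le> \<epsilon>s" "pos_def P"
      "riccati A B \<epsilon> P"
      "in_GC N Cs a" "\<forall>i\<in>{1..N}. 0 \<le> \<tau> i \<and> \<tau> i \<le> \<tau>bar"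
      "closed_loop A B C K \<rho> P N Cs a \<tau> \<tau>bar x xh chi xr" and i: "i \<in> {1..N}"
    show "((\<lambda>t. x i t - xr t) \<longlongrightarrow> 0) at_top"
    proof (rule closed_loop_synchronizes[OF assms(3) h(1) h(6) _ h(8) _ i])
      show "0 \<le> \<tau> i \<and> \<tau> i \<le> \<tau>bar" if "i \<in> {1..N}" for i using h(7) that by blast
      show "det (dde_matrix (cmat A) (cmat (- (\<rho> *\<^sub>R (B ** transpose B ** P)))) (\<tau> i) s) \<noteq> 0"
        if "i \<in> {1..N}" "Re s \<ge> 0" for i s
        using nz h(2-5) h(7) that by blast
    qed
  qed
qed

end
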